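(* Let $1\leq r<s\leq\infty$ and suppose $T$ is a (sub)linear operator so that for all $f,g\in L^\infty_c(\mathbf{R}^d)$ we have \[ \|(Tf)g\|_{L^1(\mathbf{R}^d)}\leq C_T\|M_{r,s'}(f,g)\|_{L^1(\mathbf{R}^d)} . \] Then for all $p\in(r,s)$, $q\in[p,s)$, all weights $v$ satisfying \[ \sup_Q|Q|^{-(\frac1r-\frac1s+\frac1q-\frac1p)}\|v\mathbf{1}_Q\|_{L^{\frac1{\frac1q-\frac1s}}(\mathbf{R}^d)}\|v^{-1}\mathbf{1}_Q\|_{L^{\frac1{\frac1r-\frac1p}}(\mathbf{R}^d)}<\infty, \] and all $f\in L^q_v(\mathbf{R}^d)$, $T$ has an extension satisfying \[ \|Tf\|_{\mathcal{L}^{p,q}_v(\mathbf{R}^d)}\lesssim_d C_T\|f\|_{\mathcal{L}^{p,q}_v(\mathbf{R}^d)} . \]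
   Context: Conventions: $A\lesssim_d B$ means $A\leq C_dB$ for a constant $C_d$ depending only on the dimension $d$; $\frac1\infty=0$; $\frac1s+\frac1{s'}=1$. A weight is a measurable function with $0<v<\infty$ a.e. $L^\infty_c(\mathbf{R}^d)$ is the space of bounded functions with compact support. $\|f\|_{L^q_v}=\|fv\|_{L^q}$. $Q$ runs over cubes in $\mathbf{R}^d$ with sides parallel to the axes, $\langle f\rangle_{p,Q}=|Q|^{-1/p}\|f\mathbf{1}_Q\|_{L^p}$, and \[M_{r,s'}(f,g)=\sup_Q\langle f\rangle_{r,Q}\langle g\rangle_{s',Q}\mathbf{1}_Q.\] The weighted Morrey space $\mathcal{L}^{p,q}_v(\mathbf{R}^d)$, $0<p\le q<\infty$, consists of the measurable $f$ with $\|f\|_{\mathcal{L}^{p,q}_v}=\sup_Q|Q|^{1/q}\langle fv\rangle_{p,Q}<\infty$; one has $L^q_v(\mathbf{R}^d)\subseteq\mathcal{L}^{p,q}_v(\mathbf{R}^d)$.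
   Formalization: The implicit constant in the final bound depends on d, r, s, p, q and the supremum in the weight condition, not on d alone; with a constant depending only on d the claim fails (Hardy averaging operator, r=1, s=∞, v=1, q=p, as p→1). *)

theory Defs
  imports "HOL-Analysis.Analysis"
begin

text \<open>Everything is taken with respect to Lebesgue measure on \<open>real ^ 'd\<close>, whose dimension is
  \<open>CARD('d)\<close>. Functions are raw functions, identified only through almost-everywhere statements.\<close>

definition ennreal_powr :: "ennreal \<Rightarrow> real \<Rightarrow> ennreal" where
  "ennreal_powr x a = (if x = top then top else ennreal (enn2real x powr a))"
  \<comment> \<open>only used for exponents \<open>a > 0\<close>\<close>

definition Lp_norm :: "real \<Rightarrow> (real ^ 'd \<Rightarrow> 'b::real_normed_vector) \<Rightarrow> ennreal" where
  "Lp_norm p f = ennreal_powr (\<integral>\<^sup>+ x. ennreal (norm (f x) powr p) \<partial>lebesgue) (1 / p)"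

text \<open>Cubes are taken open, so that suprema of multiples of their indicators are lower
  semicontinuous; closed cubes give the same averages.\<close>

definition cubes :: "(real ^ 'd) set set" where
  "cubes = {box a (\<chi> i. a $ i + l) | a l. 0 < l}"

definition cube_avg :: "real \<Rightarrow> (real ^ 'd) set \<Rightarrow> (real ^ 'd \<Rightarrow> 'b::real_normed_vector) \<Rightarrow> ennreal" where
  "cube_avg p Q f =
     ennreal (measure lebesgue Q powr (- 1 / p)) * Lp_norm p (\<lambda>x. indicator Q x *\<^sub>R f x)"

text \<open>The reciprocal of an exponent in \<open>(0, \<infinity>]\<close>, with value 0 at infinity, and the dual exponent
  \<open>s'\<close> determined by \<open>1/s + 1/s' = 1\<close>, which is finite for \<open>s > 1\<close>.\<close>

definition recip :: "ereal \<Rightarrow> real" where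
  "recip s = real_of_ereal (1 / s)"

definition dual_exponent :: "ereal \<Rightarrow> real" where
  "dual_exponent s = 1 / (1 - recip s)"

definition bilinear_max ::
    "real \<Rightarrow> real \<Rightarrow> (real ^ 'd \<Rightarrow> 'b::real_normed_vector) \<Rightarrow> (real ^ 'd \<Rightarrow> 'b) \<Rightarrow> real ^ 'd \<Rightarrow> ennreal" where
  "bilinear_max r t f g x = (SUP Q\<in>cubes. cube_avg r Q f * cube_avg t Q g * indicator Q x)"

definition weight :: "(real ^ 'd \<Rightarrow> real) \<Rightarrow> bool" where
  "weight v \<longleftrightarrow> v \<in> borel_measurable lebesgue \<and> (AE x in lebesgue. 0 < v x)"

definition Linf_c :: "(real ^ 'd \<Rightarrow> 'b::real_normed_vector) set" where
  "Linf_c = {f. f \<in> borel_measurable lebesgue \<and>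
                (\<exists>B. AE x in lebesgue. norm (f x) \<le> B) \<and>
                (\<exists>K. compact K \<and> (AE x in lebesgue. x \<notin> K \<longrightarrow> f x = 0))}"

definition Lq_weighted :: "real \<Rightarrow> (real ^ 'd \<Rightarrow> real) \<Rightarrow> (real ^ 'd \<Rightarrow> 'b::real_normed_vector) set" where
  "Lq_weighted q v = {f. f \<in> borel_measurable lebesgue \<and> Lp_norm q (\<lambda>x. v x *\<^sub>R f x) < top}"

definition morrey_norm ::
    "real \<Rightarrow> real \<Rightarrow> (real ^ 'd \<Rightarrow> real) \<Rightarrow> (real ^ 'd \<Rightarrow> 'b::real_normed_vector) \<Rightarrow> ennreal" where
  "morrey_norm p q v f =
     (SUP Q\<in>cubes. ennreal (measure lebesgue Q powr (1 / q)) * cube_avg p Q (\<lambda>x. v x *\<^sub>R f x))"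

text \<open>No \<open>0 * \<infinity>\<close> occurs in the products below: both norms are positive, since a weight is
  positive almost everywhere.\<close>

definition weight_const :: "real \<Rightarrow> ereal \<Rightarrow> real \<Rightarrow> real \<Rightarrow> (real ^ 'd \<Rightarrow> real) \<Rightarrow> ennreal" where
  "weight_const r s p q v =
     (SUP Q\<in>cubes.
        ennreal (measure lebesgue Q powr (- (1 / r - recip s + 1 / q - 1 / p))) *
        Lp_norm (1 / (1 / q - recip s)) (\<lambda>x. indicator Q x *\<^sub>R v x) *
        Lp_norm (1 / (1 / r - 1 / p)) (\<lambda>x. indicator Q x *\<^sub>R inverse (v x)))"

text \<open>An operator on a space \<open>X\<close> of functions, taking values in the measurable functions and well
  defined on classes modulo null sets. Its values outside \<open>X\<close> are irrelevant. The scalars \<open>'k\<close>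
  are the reals or the complex numbers.\<close>

definition ae_operator ::
    "(real ^ 'd \<Rightarrow> 'k::{real_normed_field, euclidean_space}) set \<Rightarrow>
     ((real ^ 'd \<Rightarrow> 'k) \<Rightarrow> real ^ 'd \<Rightarrow> 'k) \<Rightarrow> bool" where
  "ae_operator X T \<longleftrightarrow>
     (\<forall>f\<in>X. T f \<in> borel_measurable lebesgue) \<and>
     (\<forall>f\<in>X. \<forall>g\<in>X. (AE x in lebesgue. f x = g x) \<longrightarrow> (AE x in lebesgue. T f x = T g x))"

definition linear_operator ::
    "(real ^ 'd \<Rightarrow> 'k::{real_normed_field, euclidean_space}) set \<Rightarrow>
     ((real ^ 'd \<Rightarrow> 'k) \<Rightarrow> real ^ 'd \<Rightarrow> 'k) \<Rightarrow> bool" where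
  "linear_operator X T \<longleftrightarrow> ae_operator X T \<and>
     (\<forall>f\<in>X. \<forall>g\<in>X. AE x in lebesgue. T (\<lambda>y. f y + g y) x = T f x + T g x) \<and>
     (\<forall>f\<in>X. \<forall>c. AE x in lebesgue. T (\<lambda>y. c * f y) x = c * T f x)"

definition sublinear_operator ::
    "(real ^ 'd \<Rightarrow> 'k::{real_normed_field, euclidean_space}) set \<Rightarrow>
     ((real ^ 'd \<Rightarrow> 'k) \<Rightarrow> real ^ 'd \<Rightarrow> 'k) \<Rightarrow> bool" where
  "sublinear_operator X T \<longleftrightarrow> ae_operator X T \<and>
     (\<forall>f\<in>X. \<forall>g\<in>X. AE x in lebesgue. norm (T (\<lambda>y. f y + g y) x) \<le> norm (T f x) + norm (T g x)) \<and>
     (\<forall>f\<in>X. \<forall>c. AE x in lebesgue. norm (T (\<lambda>y. c * f y) x) = norm c * norm (T f x))"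

text \<open>\<open>U\<close> extends \<open>T\<close> from \<open>X\<close> to \<open>Y\<close> within its class: linear if \<open>T\<close> is linear, and
  sublinear if \<open>T\<close> is sublinear.\<close>

definition operator_extension ::
    "(real ^ 'd \<Rightarrow> 'k::{real_normed_field, euclidean_space}) set \<Rightarrow> (real ^ 'd \<Rightarrow> 'k) set \<Rightarrow>
     ((real ^ 'd \<Rightarrow> 'k) \<Rightarrow> real ^ 'd \<Rightarrow> 'k) \<Rightarrow>
     ((real ^ 'd \<Rightarrow> 'k) \<Rightarrow> real ^ 'd \<Rightarrow> 'k) \<Rightarrow> bool" where
  "operator_extension X Y T U \<longleftrightarrow>
     X \<subseteq> Y \<and>
     (\<forall>f\<in>X. AE x in lebesgue. U f x = T f x) \<and>
     (linear_operator X T \<longrightarrow> linear_operator Y U) \<and>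
     (sublinear_operator X T \<longrightarrow> sublinear_operator Y U)"

end

theory Submission
  imports Defs
begin

text \<open>
  The operator is controlled only through the \<open>L\<^sup>1\<close> norm of the bilinear maximal function, so everything
  reduces to bounding that norm, first by a product of weighted Lebesgue norms of \<open>f\<close> and \<open>g\<close>, then by the
  Morrey norm of \<open>f\<close> and a Lebesgue norm of \<open>g\<close> when \<open>g\<close> lives in one cube. Duality on each cube turns the
  second bound into the desired estimate for bounded functions with compact support.

  For the first bound (\<open>bilinear_form_bound\<close>) no sparse domination is used. The weight condition says that
  \<open>w\<^sub>1 = v\<^sup>-\<^sup>a\<close> and \<open>w\<^sub>2 = v\<^sup>b\<close> have averages whose suitable powers have a bounded product. By Chebyshev's
  inequality each of them is then at least a multiple of its average on most of every cube
  (\<open>a_infinity_of_dual_average\<close>). Hence both define doubling measures, with bounded maximal operators.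
  Writing averages of powers of \<open>f\<close> and \<open>g\<close> as averages with respect to these measures, one finds a
  function \<open>H\<close>, a product of powers of weights and maximal functions, that dominates the product of the
  averages of \<open>f\<close> and \<open>g\<close> over a cube on at least half of that cube. A covering argument
  (\<open>sup_cubes_integral_le\<close>) shows that then the integral of the supremum over all cubes is bounded by that
  of \<open>H\<close>, and Hoelder's inequality and the maximal theorem finish.

  For the second bound (\<open>bilinear_form_morrey_bound\<close>) cubes that are small compared to the support \<open>Q\<close> of \<open>g\<close>
  only see \<open>f\<close> near \<open>Q\<close> and are handled by the first bound. Large cubes contribute a series over the dyadic
  dilates of \<open>Q\<close>, which converges geometrically because the mass of a weight that is bounded below by its
  average on most of each cube grows geometrically under dilation (\<open>a_infinity_reverse_doubling\<close>).

  The condition with exponents \<open>p\<close> and \<open>q\<close> also implies the one for \<open>q\<close> alone, so the operator is bounded on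
  the weighted Lebesgue space in the dense class of bounded functions with compact support. It extends by
  limits along fast approximating sequences (\<open>bounded_operator_extension\<close>); in the sublinear case only
  the pointwise norm has a limit, which suffices. Truncations approximate a function from below in norm,
  so Fatou's lemma carries the Morrey bound to the extension.
\<close>

section \<open>Powers and Hoelder's inequality in the extended nonnegative reals\<close>

text \<open>Real powers of extended nonnegative reals. Here 0 and \<open>\<infinity>\<close> are fixed by every power, also for
  exponents that are not positive; with this convention the multiplication and composition laws hold
  without side conditions, and negative powers of the (finite, positive) volume of a cube can be used
  freely to keep track of scaling.\<close>

notation ennreal_powr (infixr "powe" 80)

lemma powe_ennreal [simp]: "0 \<le> x \<Longrightarrow> ennreal x powe a = ennreal (x powr a)"
  by (simp add: ennreal_powr_def)

lemma powe_top [simp]: "top powe a = top"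
  by (simp add: ennreal_powr_def)

lemma powe_0 [simp]: "0 powe a = 0"
  by (simp add: ennreal_powr_def)

lemma powe_1 [simp]: "1 powe a = 1"
  by (simp add: ennreal_powr_def)

lemma powe_one [simp]: "x powe 1 = x"
  by (cases x rule: ennreal_cases) auto

lemma powe_eq_0_iff [simp]: "x powe a = 0 \<longleftrightarrow> x = 0"
  by (cases x rule: ennreal_cases) (auto simp: ennreal_eq_0_iff)

lemma powe_eq_top_iff [simp]: "x powe a = top \<longleftrightarrow> x = top"
  by (cases x rule: ennreal_cases) auto

lemma powe_less_top_iff [simp]: "x powe a < top \<longleftrightarrow> x < top"
  by (simp add: less_top[symmetric])

lemma powe_mono: "0 \<le> a \<Longrightarrow> x \<le> y \<Longrightarrow> x powe a \<le> y powe a"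
  by (cases x rule: ennreal_cases; cases y rule: ennreal_cases)
     (auto intro!: ennreal_leI powr_mono2 simp: top_unique)

lemma powe_mult: "(x * y) powe a = x powe a * y powe a"
proof (cases x rule: ennreal_cases; cases y rule: ennreal_cases)
  fix r s :: real assume "0 \<le> r" "x = ennreal r" "0 \<le> s" "y = ennreal s"
  then show ?thesis by (simp add: ennreal_mult[symmetric] powr_mult)
qed (auto simp: ennreal_mult_top ennreal_top_mult powr_def)

lemma powe_powe: "(x powe a) powe b = x powe (a * b)"
  by (cases x rule: ennreal_cases) (auto simp: powr_powr)

lemma powe_add: "x powe (a + b) = x powe a * x powe b"
  by (cases x rule: ennreal_cases) (auto simp: powr_add ennreal_mult)

lemma powe_inverse: "inverse x powe a = inverse (x powe a)"
proof (cases x rule: ennreal_cases)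
  case (real r)
  then show ?thesis
    by (cases "r = 0") (auto simp: inverse_ennreal inverse_powr powr_minus)
qed auto

lemma powe_divide: "(x / y) powe a = x powe a / y powe a"
  by (simp add: divide_ennreal_def powe_mult powe_inverse)

lemma powe_le_iff: "0 < a \<Longrightarrow> x powe a \<le> y powe a \<longleftrightarrow> x \<le> y"
  using powe_mono[of a x y] powe_mono[of "1/a" "x powe a" "y powe a"]
  by (auto simp: powe_powe)

lemma powe_le_swap: "0 < a \<Longrightarrow> x powe (1 / a) \<le> y \<longleftrightarrow> x \<le> y powe a"
  using powe_le_iff[of a "x powe (1/a)" y] by (simp add: powe_powe)

lemma measurable_powe [measurable]:
  assumes "f \<in> borel_measurable M" shows "(\<lambda>x. f x powe a) \<in> borel_measurable M"
  using assms unfolding ennreal_powr_def by measurable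

lemma powe_add_le: "0 < a \<Longrightarrow> (x + y) powe a \<le> 2 powe a * (x powe a + y powe a)"
proof -
  assume a: "0 < a"
  have "(x + y) powe a \<le> (2 * max x y) powe a"
    using a by (intro powe_mono) (auto simp: mult_2 intro: add_mono)
  also have "\<dots> = 2 powe a * max (x powe a) (y powe a)"
    by (simp add: powe_mult max_def powe_le_iff a)
  also have "\<dots> \<le> 2 powe a * (x powe a + y powe a)"
    by (intro mult_left_mono) (auto simp: max_def)
  finally show ?thesis .
qed


lemma young_powe:
  assumes "0 < \<alpha>" "0 < \<beta>" "\<alpha> + \<beta> = 1"
  shows "x powe \<alpha> * y powe \<beta> \<le> ennreal \<alpha> * x + ennreal \<beta> * y"
proof (cases "x = top \<or> y = top \<or> x = 0 \<or> y = 0")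
  case True
  then show ?thesis using assms by (auto simp: ennreal_mult_top ennreal_top_mult)
next
  case False
  then obtain a b where ab: "0 < a" "x = ennreal a" "0 < b" "y = ennreal b"
    by (cases x rule: ennreal_cases; cases y rule: ennreal_cases) (auto simp: less_le)
  have "exp (\<alpha> * ln a + \<beta> * ln b) \<le> \<alpha> * exp (ln a) + \<beta> * exp (ln b)"
  proof -
    have "\<alpha> = 1 - \<beta>" using assms by simp
    then show ?thesis using convex_onD[OF exp_convex, of \<beta> "ln a" "ln b"] assms(1,2) by simp
  qed
  then have "a powr \<alpha> * b powr \<beta> \<le> \<alpha> * a + \<beta> * b"
    using ab by (simp add: powr_def exp_add mult.commute)
  then show ?thesis
    using ab assms by (simp add: ennreal_mult[symmetric] ennreal_plus[symmetric] ennreal_leI del: ennreal_plus)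
qed

lemma ennreal_mult_divide_cancel: "c \<noteq> 0 \<Longrightarrow> c \<noteq> top \<Longrightarrow> c * (x / c) = (x :: ennreal)"
  using mult_divide_eq_ennreal[of c x] by (simp add: ennreal_times_divide mult.commute)

theorem holder_powe:
  assumes [measurable]: "f \<in> borel_measurable M" "g \<in> borel_measurable M"
  assumes ab: "0 < \<alpha>" "0 < \<beta>" "\<alpha> + \<beta> = 1"
  shows "(\<integral>\<^sup>+x. f x powe \<alpha> * g x powe \<beta> \<partial>M) \<le> (\<integral>\<^sup>+x. f x \<partial>M) powe \<alpha> * (\<integral>\<^sup>+x. g x \<partial>M) powe \<beta>"
proof -
  define F G where "F = (\<integral>\<^sup>+x. f x \<partial>M)" and "G = (\<integral>\<^sup>+x. g x \<partial>M)"
  consider "F = 0 \<or> G = 0" | "F \<noteq> 0" "G \<noteq> 0" "F = top \<or> G = top"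
    | "F \<noteq> 0" "G \<noteq> 0" "F \<noteq> top" "G \<noteq> top" by blast
  then show ?thesis
  proof cases
    case 1
    then have "AE x in M. f x powe \<alpha> * g x powe \<beta> = 0"
      unfolding F_def G_def by (auto simp: nn_integral_0_iff_AE)
    then have "(\<integral>\<^sup>+x. f x powe \<alpha> * g x powe \<beta> \<partial>M) = (\<integral>\<^sup>+x. 0 \<partial>M)"
      by (intro nn_integral_cong_AE) auto
    then show ?thesis by simp
  next
    case 2
    then show ?thesis by (auto simp: F_def G_def ennreal_mult_top ennreal_top_mult)
  next
    case 3
    have pw: "f x powe \<alpha> * g x powe \<beta> \<le>
        F powe \<alpha> * G powe \<beta> * (ennreal \<alpha> * (f x / F) + ennreal \<beta> * (g x / G))" for x
    proof -
      have "f x powe \<alpha> * g x powe \<beta> = (F * (f x / F)) powe \<alpha> * (G * (g x / G)) powe \<beta>"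
        using 3 by (simp add: ennreal_mult_divide_cancel)
      also have "\<dots> = F powe \<alpha> * G powe \<beta> * ((f x / F) powe \<alpha> * (g x / G) powe \<beta>)"
        by (simp only: powe_mult mult_ac)
      also have "\<dots> \<le> F powe \<alpha> * G powe \<beta> * (ennreal \<alpha> * (f x / F) + ennreal \<beta> * (g x / G))"
        by (intro mult_left_mono young_powe ab) auto
      finally show ?thesis .
    qed
    have "(\<integral>\<^sup>+x. f x powe \<alpha> * g x powe \<beta> \<partial>M) \<le>
       (\<integral>\<^sup>+x. F powe \<alpha> * G powe \<beta> * (ennreal \<alpha> * (f x / F) + ennreal \<beta> * (g x / G)) \<partial>M)"
      by (intro nn_integral_mono pw)
    also have "\<dots> = F powe \<alpha> * G powe \<beta> * (ennreal \<alpha> * (F / F) + ennreal \<beta> * (G / G))"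
      by (simp add: nn_integral_cmult nn_integral_add nn_integral_divide F_def G_def)
    also have "\<dots> = F powe \<alpha> * G powe \<beta>"
      using 3 ab by (simp add: ennreal_divide_self less_top ennreal_plus[symmetric] del: ennreal_plus)
    finally show ?thesis by (simp add: F_def G_def)
  qed
qed

text \<open>The measure is a parameter because the same quantity occurs with respect to Lebesgue measure,
  where it is the usual norm, and with respect to normalised Lebesgue measure on a cube, where it is an
  average in the sense of power means.\<close>

definition Lpn :: "'a measure \<Rightarrow> real \<Rightarrow> ('a \<Rightarrow> ennreal) \<Rightarrow> ennreal" where
  "Lpn M p h = (\<integral>\<^sup>+x. h x powe p \<partial>M) powe (1 / p)"

lemma Lpn_powe: "0 < p \<Longrightarrow> Lpn M p h powe p = (\<integral>\<^sup>+x. h x powe p \<partial>M)"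
  by (simp add: Lpn_def powe_powe)

lemma Lpn_mono_AE: "0 < p \<Longrightarrow> AE x in M. f x \<le> g x \<Longrightarrow> Lpn M p f \<le> Lpn M p g"
  unfolding Lpn_def by (intro powe_mono nn_integral_mono_AE, simp) (auto intro!: powe_mono)

lemma Lpn_mono: "0 < p \<Longrightarrow> (\<And>x. f x \<le> g x) \<Longrightarrow> Lpn M p f \<le> Lpn M p g"
  by (rule Lpn_mono_AE) auto

lemma Lpn_cong_AE: "AE x in M. f x = g x \<Longrightarrow> Lpn M p f = Lpn M p g"
  unfolding Lpn_def by (intro arg_cong[where f="\<lambda>x. x powe _"] nn_integral_cong_AE) auto

lemma Lpn_cmult:
  assumes [measurable]: "h \<in> borel_measurable M" and "0 < p"
  shows "Lpn M p (\<lambda>x. c * h x) = c * Lpn M p h"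
  using assms(2) by (simp add: Lpn_def powe_mult nn_integral_cmult powe_powe)

lemma Lpn_holder:
  assumes [measurable]: "f \<in> borel_measurable M" "g \<in> borel_measurable M"
  assumes "0 < p" "0 < q" "0 < r" "1 / r = 1 / p + 1 / q"
  shows "Lpn M r (\<lambda>x. f x * g x) \<le> Lpn M p f * Lpn M q g"
proof -
  have "r / p + r / q = 1" using arg_cong[OF assms(6), of "\<lambda>x. r * x"] assms(5) by (simp add: distrib_left)
  then have "(\<integral>\<^sup>+x. (f x powe p) powe (r / p) * (g x powe q) powe (r / q) \<partial>M)
      \<le> (\<integral>\<^sup>+x. f x powe p \<partial>M) powe (r / p) * (\<integral>\<^sup>+x. g x powe q \<partial>M) powe (r / q)"
    using assms by (intro holder_powe) auto
  then have "(\<integral>\<^sup>+x. (f x * g x) powe r \<partial>M) \<le> (Lpn M p f * Lpn M q g) powe r"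
    using assms by (simp add: powe_powe powe_mult Lpn_def)
  then show ?thesis
    unfolding Lpn_def[of M r] powe_le_swap[OF assms(5)] .
qed

lemma Lpn_Jensen:
  assumes [measurable]: "f \<in> borel_measurable M" and M: "emeasure M (space M) = 1"
  assumes "0 < p" "p \<le> q"
  shows "Lpn M p f \<le> Lpn M q f"
proof (cases "p = q")
  case False
  define e where "e = 1 / (1 / p - 1 / q)"
  have e: "0 < e" "1 / p = 1 / q + 1 / e"
    using assms False by (auto simp: e_def field_simps)
  have "Lpn M p (\<lambda>x. f x * 1) \<le> Lpn M q f * Lpn M e (\<lambda>x. 1)"
    using assms e by (intro Lpn_holder) auto
  then show ?thesis using M by (simp add: Lpn_def)
qed simp

section \<open>Cubes and the Vitali covering lemma\<close>

abbreviation vol :: "(real ^ 'd) set \<Rightarrow> ennreal" where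
  "vol \<equiv> emeasure lebesgue"

text \<open>Cubes are parametrised by a corner and a side length, because the covering argument compares side
  lengths, which are awkward to recover from the set; \<open>dilate k a l\<close> below is the cube with the same
  centre and \<open>k\<close> times the side.\<close>

definition qbox :: "real ^ 'd \<Rightarrow> real \<Rightarrow> (real ^ 'd) set" where
  "qbox a l = box a (\<chi> i. a $ i + l)"

definition dilate :: "real \<Rightarrow> real ^ 'd \<Rightarrow> real \<Rightarrow> (real ^ 'd) set" where
  "dilate k a l = qbox (\<chi> i. a $ i - (k - 1) / 2 * l) (k * l)"

lemma mem_qbox: "x \<in> qbox a l \<longleftrightarrow> (\<forall>i. a $ i < x $ i \<and> x $ i < a $ i + l)"
  by (simp add: qbox_def mem_box_cart)

lemma mem_dilate: "x \<in> dilate k a l \<longleftrightarrow> (\<forall>i. a $ i - (k - 1) / 2 * l < x $ i \<and> x $ i < a $ i + (k + 1) / 2 * l)"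
  by (auto simp: dilate_def mem_qbox field_simps)

lemma open_qbox [simp]: "open (qbox a l)" and open_dilate [simp]: "open (dilate k a l)"
  by (auto simp: qbox_def dilate_def)

lemma cubes_iff: "Q \<in> cubes \<longleftrightarrow> (\<exists>a l. 0 < l \<and> Q = qbox a l)"
  by (auto simp: cubes_def qbox_def)

lemma qbox_cubes: "0 < l \<Longrightarrow> qbox a l \<in> cubes"
  by (auto simp: cubes_iff)

lemma dilate_cubes: "0 < l \<Longrightarrow> 0 < k \<Longrightarrow> dilate k a l \<in> cubes"
  by (auto simp: dilate_def qbox_cubes)

lemma dilate_1: "dilate 1 a l = qbox a l"
  by (simp add: dilate_def vec_eq_iff)

lemma dilate_mono:
  assumes "0 \<le> l" "j \<le> k" shows "dilate j a l \<subseteq> dilate k a l"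
proof
  fix x assume x: "x \<in> dilate j a l"
  have "(j - 1) / 2 * l \<le> (k - 1) / 2 * l" "(j + 1) / 2 * l \<le> (k + 1) / 2 * l"
    using assms by (auto intro!: mult_right_mono divide_right_mono)
  moreover have "a $ i - (j - 1) / 2 * l < x $ i \<and> x $ i < a $ i + (j + 1) / 2 * l" for i
    using x by (simp add: mem_dilate)
  ultimately have "a $ i - (k - 1) / 2 * l < x $ i \<and> x $ i < a $ i + (k + 1) / 2 * l" for i
    by (meson add_left_mono diff_left_mono le_less_trans less_le_trans)
  then show "x \<in> dilate k a l" by (simp add: mem_dilate)
qed

lemma mem_centred_qbox:
  fixes x :: "real ^ 'd"
  assumes "norm x \<le> R"
  shows "x \<in> qbox (\<chi> i. - R - 1) (2 * R + 2)"
proof -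
  have "- R - 1 < x $ i \<and> x $ i < - R - 1 + (2 * R + 2)" for i
    using component_le_norm_cart[of x i] assms by linarith
  then show ?thesis unfolding mem_qbox by simp
qed

lemma emeasure_qbox:
  assumes "0 \<le> l"
  shows "vol (qbox a l :: (real ^ 'd) set) = ennreal (l ^ CARD('d))"
proof -
  have "(\<Prod>b\<in>(Basis :: (real ^ 'd) set). ((\<chi> i. a $ i + l) - a) \<bullet> b) = (\<Prod>b\<in>(Basis :: (real ^ 'd) set). l)"
    by (intro prod.cong) (auto simp: Basis_vec_def inner_axis)
  moreover have "\<forall>b\<in>Basis. a \<bullet> b \<le> (\<chi> i. a $ i + l) \<bullet> b"
    using assms by (auto simp: Basis_vec_def inner_axis)
  ultimately show ?thesis
    unfolding qbox_def by (simp add: emeasure_lborel_box_eq)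
qed

lemma qbox_subset_dilate:
  assumes "qbox a l \<inter> qbox b m \<noteq> {}" "m \<le> k * l"
  shows "qbox b m \<subseteq> dilate (1 + 2 * k) a l"
proof
  fix x assume x: "x \<in> qbox b m"
  obtain y where y: "y \<in> qbox a l" "y \<in> qbox b m" using assms by blast
  have "a $ i - k * l < x $ i \<and> x $ i < a $ i + (k + 1) * l" for i
    using x y[unfolded mem_qbox, THEN spec, of i] assms(2) unfolding mem_qbox
    by (auto simp: algebra_simps dest!: spec[of _ i])
  then show "x \<in> dilate (1 + 2 * k) a l"
    using distrib_right[of 1 k l] by (simp add: mem_dilate add_divide_distrib add_ac)
qed

text \<open>Greedy selection: a cube of maximal side swallows, after tripling, every cube that meets it, so
  it can be kept and these cubes discarded.\<close>

lemma qbox_Vitali: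
  assumes "finite I" "\<And>a l. (a, l) \<in> I \<Longrightarrow> 0 < l"
  shows "\<exists>J\<subseteq>I. disjoint_family_on (\<lambda>(a, l). qbox a l) J \<and>
    (\<Union>(a, l)\<in>I. qbox a l) \<subseteq> (\<Union>(a, l)\<in>J. dilate 3 a l)"
  using assms
proof (induction "card I" arbitrary: I rule: less_induct)
  case (less I)
  show ?case
  proof (cases "I = {}")
    case False
    have "Max (snd ` I) \<in> snd ` I" using less.prems False by auto
    then obtain a l where al: "(a, l) \<in> I" "l = Max (snd ` I)" by force
    define I' where "I' = {(b, m). (b, m) \<in> I \<and> qbox a l \<inter> qbox b m = {}}"
    have max: "m \<le> l" if "(b, m) \<in> I" for b m
      using that less.prems unfolding al(2) by (intro Max_ge) force+
    have l: "0 < l" using al less.prems by auto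
    have "(\<chi> i. a $ i + l / 2) \<in> qbox a l" using l by (simp add: mem_qbox)
    then have "(a, l) \<notin> I'" by (auto simp: I'_def)
    then have "I' \<subset> I" using al by (auto simp: I'_def)
    then have "\<exists>J\<subseteq>I'. disjoint_family_on (\<lambda>(a, l). qbox a l) J \<and>
        (\<Union>(a, l)\<in>I'. qbox a l) \<subseteq> (\<Union>(a, l)\<in>J. dilate 3 a l)"
      using less.prems \<open>I' \<subset> I\<close>
      by (intro less.hyps psubset_card_mono) (auto intro: finite_subset[of I' I])
    then obtain J where J: "J \<subseteq> I'" "disjoint_family_on (\<lambda>(a, l). qbox a l) J"
      "(\<Union>(a, l)\<in>I'. qbox a l) \<subseteq> (\<Union>(a, l)\<in>J. dilate 3 a l)" by blast
    have "disjoint_family_on (\<lambda>(a, l). qbox a l) (insert (a, l) J)"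
      using J(1,2) by (fastforce simp: disjoint_family_on_def I'_def)
    moreover have "qbox b m \<subseteq> dilate 3 a l \<or> (b, m) \<in> I'" if "(b, m) \<in> I" for b m
      using qbox_subset_dilate[of a l b m 1] max[OF that] that by (auto simp: I'_def)
    then have "(\<Union>(a, l)\<in>I. qbox a l) \<subseteq> (\<Union>(a, l)\<in>insert (a, l) J. dilate 3 a l)"
      using J(3) by fastforce
    ultimately show ?thesis
      using J(1) al \<open>I' \<subset> I\<close> by (intro exI[of _ "insert (a, l) J"]) auto
  qed (auto simp: disjoint_family_on_def)
qed

text \<open>Besides doubling, this asks for nontrivial values on cubes, so that averages over cubes make sense.\<close>

definition doubling :: "real \<Rightarrow> (real ^ 'd) measure \<Rightarrow> bool" where
  "doubling D \<mu> \<longleftrightarrow> sets \<mu> = sets lebesgue \<and> 0 \<le> D \<and>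
     (\<forall>a l. 0 < l \<longrightarrow> 0 < emeasure \<mu> (qbox a l) \<and> emeasure \<mu> (qbox a l) < top \<and>
        emeasure \<mu> (dilate 3 a l) \<le> ennreal D * emeasure \<mu> (qbox a l))"

lemma doubling_lebesgue: "doubling (3 ^ CARD('d)) (lebesgue :: (real ^ 'd) measure)"
  by (auto simp: doubling_def dilate_def emeasure_qbox power_mult_distrib ennreal_mult simp del: emeasure_completion)

lemma open_in_lebesgue: "open S \<Longrightarrow> S \<in> sets lebesgue"
  by (simp add: borel_open)

text \<open>The Vitali selection needs finitely many cubes. As cubes are open, the Lindelof property gives a
  countable subfamily with the same union, and hence an exhaustion by finite ones.\<close>

lemma union_qbox_countable:
  assumes "\<And>a l. (a, l) \<in> I \<Longrightarrow> 0 < l"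
  obtains A where "range A \<subseteq> {J. J \<subseteq> I \<and> finite J}"
    "incseq (\<lambda>n. \<Union>(a, l)\<in>A n. qbox a l)"
    "(\<Union>(a, l)\<in>I. qbox a l) = (\<Union>n::nat. \<Union>(a, l)\<in>A n. qbox a l)"
proof -
  have "open S" if "S \<in> (\<lambda>(a, l). qbox a l) ` I" for S
    using that by auto
  then obtain F' where F': "F' \<subseteq> (\<lambda>(a, l). qbox a l) ` I" "countable F'"
      "\<Union>F' = \<Union>((\<lambda>(a, l). qbox a l) ` I)"
    by (rule Lindelof)
  from F'(1,2) obtain J where J: "J \<subseteq> I" "countable J" "F' = (\<lambda>(a, l). qbox a l) ` J"
    using countable_subset_image[of F' "\<lambda>(a, l). qbox a l" I] by blast
  show ?thesis
  proof (cases "J = {}")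
    case True
    then show ?thesis using that[of "\<lambda>_. {}"] F' J by (auto simp: incseq_def)
  next
    case False
    define A where "A n = from_nat_into J ` {..n}" for n
    have r: "range (from_nat_into J) = J" using False J by (simp add: range_from_nat_into)
    have "A n \<subseteq> J" for n using r by (auto simp: A_def)
    moreover have "(\<Union>n::nat. {..n}) = UNIV" by auto
    then have "(\<Union>n. A n) = J" unfolding A_def image_UN[symmetric] using r by simp
    ultimately have AJ: "A n \<subseteq> I" "(\<Union>n. A n) = J" for n using J by blast+
    have "(\<Union>(a, l)\<in>I. qbox a l) = (\<Union>(a, l)\<in>(\<Union>n. A n). qbox a l)"
      unfolding AJ(2) using F'(3) J(3) by simp
    also have "\<dots> = (\<Union>n. \<Union>(a, l)\<in>A n. qbox a l)" by (rule UN_UN_flatten)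
    finally have "(\<Union>(a, l)\<in>I. qbox a l) = (\<Union>n. \<Union>(a, l)\<in>A n. qbox a l)" .
    moreover have "range A \<subseteq> {J. J \<subseteq> I \<and> finite J}"
      using AJ(1) by (simp add: image_subset_iff) (simp add: A_def)
    moreover have "incseq (\<lambda>n. \<Union>(a, l)\<in>A n. qbox a l)"
      unfolding incseq_def A_def by (intro allI impI UN_mono image_mono) auto
    ultimately show ?thesis using that[of A] by blast
  qed
qed

text \<open>If a function has average at least \<open>\<kappa>\<close> over every cube of a family, then, with respect to a doubling
  measure, the whole union has measure controlled by the integral of the function: pass to disjoint cubes
  whose triples still cover, and sum. Both the weak type bound for maximal functions and the comparison
  of a supremum over cubes with a pointwise majorant follow from this.\<close>

lemma covering_estimate:
  fixes \<mu> :: "(real ^ 'd) measure"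
  assumes \<mu>: "doubling D \<mu>" and [measurable]: "h \<in> borel_measurable \<mu>"
    and I: "\<And>a l. (a, l) \<in> I \<Longrightarrow> 0 < l"
    and avg: "\<And>a l. (a, l) \<in> I \<Longrightarrow> \<kappa> * emeasure \<mu> (qbox a l) \<le> (\<integral>\<^sup>+x\<in>qbox a l. h x \<partial>\<mu>)"
  shows "\<kappa> * emeasure \<mu> (\<Union>(a, l)\<in>I. qbox a l) \<le> ennreal D * (\<integral>\<^sup>+x. h x \<partial>\<mu>)"
proof -
  have sets_\<mu>: "sets \<mu> = sets lebesgue" using \<mu> by (simp add: doubling_def)
  have op[measurable]: "open S \<Longrightarrow> S \<in> sets \<mu>" for S
    unfolding sets_\<mu> by (rule open_in_lebesgue)
  have fin: "\<kappa> * emeasure \<mu> (\<Union>(a, l)\<in>F. qbox a l) \<le> ennreal D * (\<integral>\<^sup>+x. h x \<partial>\<mu>)"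
    if F: "F \<subseteq> I" "finite F" for F
  proof -
    obtain J where J: "J \<subseteq> F" "disjoint_family_on (\<lambda>(a, l). qbox a l) J"
      "(\<Union>(a, l)\<in>F. qbox a l) \<subseteq> (\<Union>(a, l)\<in>J. dilate 3 a l)"
      using qbox_Vitali[OF F(2)] F I by blast
    have fJ: "finite J" using J F finite_subset by blast
    have "\<kappa> * emeasure \<mu> (\<Union>(a, l)\<in>F. qbox a l) \<le> \<kappa> * emeasure \<mu> (\<Union>(a, l)\<in>J. dilate 3 a l)"
      using J(3) by (intro mult_left_mono emeasure_mono op) auto
    also have "\<dots> \<le> \<kappa> * (\<Sum>x\<in>J. emeasure \<mu> (case x of (a, l) \<Rightarrow> dilate 3 a l))"
      using fJ by (intro mult_left_mono emeasure_subadditive_finite) (auto intro: op)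
    also have "\<dots> = (\<Sum>x\<in>J. \<kappa> * emeasure \<mu> (case x of (a, l) \<Rightarrow> dilate 3 a l))"
      by (simp add: sum_distrib_left)
    also have "\<dots> \<le> (\<Sum>x\<in>J. ennreal D * (\<integral>\<^sup>+y. h y * indicator (case x of (a, l) \<Rightarrow> qbox a l) y \<partial>\<mu>))"
    proof (intro sum_mono)
      fix x assume "x \<in> J"
      then obtain a l where x: "x = (a, l)" "(a, l) \<in> I" using J F by (cases x) auto
      have "\<kappa> * emeasure \<mu> (dilate 3 a l) \<le> \<kappa> * (ennreal D * emeasure \<mu> (qbox a l))"
        using \<mu> I[OF x(2)] by (intro mult_left_mono) (auto simp: doubling_def)
      also have "\<dots> = ennreal D * (\<kappa> * emeasure \<mu> (qbox a l))" by (simp add: mult_ac)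
      also have "\<dots> \<le> ennreal D * (\<integral>\<^sup>+x\<in>qbox a l. h x \<partial>\<mu>)"
        by (intro mult_left_mono avg x) auto
      finally show "\<kappa> * emeasure \<mu> (case x of (a, l) \<Rightarrow> dilate 3 a l)
        \<le> ennreal D * (\<integral>\<^sup>+y. h y * indicator (case x of (a, l) \<Rightarrow> qbox a l) y \<partial>\<mu>)"
        by (simp add: x)
    qed
    also have "\<dots> = ennreal D * (\<Sum>x\<in>J. \<integral>\<^sup>+y. h y * indicator (case x of (a, l) \<Rightarrow> qbox a l) y \<partial>\<mu>)"
      by (simp add: sum_distrib_left)
    also have "\<dots> = ennreal D * (\<integral>\<^sup>+y. (\<Sum>x\<in>J. h y * indicator (case x of (a, l) \<Rightarrow> qbox a l) y) \<partial>\<mu>)"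
      by (subst nn_integral_sum) (auto intro!: borel_measurable_times_ennreal borel_measurable_indicator op)
    also have "\<dots> \<le> ennreal D * (\<integral>\<^sup>+y. h y \<partial>\<mu>)"
    proof (intro mult_left_mono nn_integral_mono)
      fix y
      have "(\<Sum>x\<in>J. indicator (case x of (a, l) \<Rightarrow> qbox a l) y :: ennreal)
          = indicator (\<Union>x\<in>J. case x of (a, l) \<Rightarrow> qbox a l) y"
        using fJ J(2) by (intro indicator_UN_disjoint[symmetric]) (auto simp: disjoint_family_on_def)
      then show "(\<Sum>x\<in>J. h y * indicator (case x of (a, l) \<Rightarrow> qbox a l) y) \<le> h y"
        by (simp add: sum_distrib_left[symmetric] split: split_indicator)
    qed auto
    finally show ?thesis .
  qed
  obtain A where A: "range A \<subseteq> {J. J \<subseteq> I \<and> finite J}"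
    "incseq (\<lambda>n. \<Union>(a, l)\<in>A n. qbox a l)"
    "(\<Union>(a, l)\<in>I. qbox a l) = (\<Union>n::nat. \<Union>(a, l)\<in>A n. qbox a l)"
    using I by (rule union_qbox_countable)
  have AI: "A n \<subseteq> I" "finite (A n)" for n using A(1) by auto
  have os: "(\<Union>(a, l)\<in>A n. qbox a l) \<in> sets \<mu>" for n
    by (intro op open_UN) auto
  have "\<kappa> * emeasure \<mu> (\<Union>(a, l)\<in>I. qbox a l) = \<kappa> * (SUP n. emeasure \<mu> (\<Union>(a, l)\<in>A n. qbox a l))"
    unfolding A(3) using os by (subst SUP_emeasure_incseq[OF _ A(2)]) blast+
  also have "\<dots> = (SUP n. \<kappa> * emeasure \<mu> (\<Union>(a, l)\<in>A n. qbox a l))"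
    by (rule SUP_mult_left_ennreal)
  also have "\<dots> \<le> ennreal D * (\<integral>\<^sup>+x. h x \<partial>\<mu>)"
    by (intro SUP_least fin AI)
  finally show ?thesis .
qed

section \<open>The layer cake formula\<close>

lemma nn_integral_powr_less:
  assumes "-1 < e"
  shows "(\<integral>\<^sup>+t. ennreal (t powr e) * indicator {t. 0 < t \<and> ennreal t < x} t \<partial>lborel)
    = ennreal (1 / (e + 1)) * x powe (e + 1)"
proof -
  have base: "(\<integral>\<^sup>+t. ennreal (t powr e) * indicator {t. 0 < t \<and> t < c} t \<partial>lborel)
      = ennreal (c powr (e + 1) / (e + 1))" if "0 \<le> c" for c
  proof -
    have "(\<integral>\<^sup>+t. ennreal (t powr e) * indicator {t. 0 < t \<and> t < c} t \<partial>lborel)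
        = (\<integral>\<^sup>+t. ennreal (t powr e) * indicator {0..c} t \<partial>lborel)"
    proof (intro nn_integral_cong_AE)
      have "AE t in lborel. t \<noteq> 0" "AE t in lborel. t \<noteq> c"
        by (rule AE_lborel_singleton)+
      then show "AE t in lborel. ennreal (t powr e) * indicator {t. 0 < t \<and> t < c} t =
          ennreal (t powr e) * indicator {0..c} t"
        by eventually_elim (auto split: split_indicator)
    qed
    also have "\<dots> = ennreal (c powr (e + 1) / (e + 1))"
      by (rule nn_integral_has_integral_lebesgue'[OF _ has_integral_powr_from_0[OF assms that]]) simp
    finally show ?thesis .
  qed
  show ?thesis
  proof (cases x rule: ennreal_cases)
    case (real c)
    then have "{t. 0 < t \<and> ennreal t < x} = {t. 0 < t \<and> t < c}"
      by (auto simp: ennreal_less_iff)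
    then show ?thesis using assms base[OF real(1)] real
      by (simp add: ennreal_mult[symmetric])
  next
    case top
    have "(\<integral>\<^sup>+t. ennreal (t powr e) * indicator {t. 0 < t \<and> ennreal t < x} t \<partial>lborel) \<ge> ennreal B" for B
    proof (cases "0 \<le> B")
      case True
      define c where "c = (B * (e + 1)) powr (1 / (e + 1))"
      have "ennreal B = ennreal (c powr (e + 1) / (e + 1))"
        using assms True by (simp add: c_def powr_powr)
      also have "\<dots> \<le> (\<integral>\<^sup>+t. ennreal (t powr e) * indicator {t. 0 < t \<and> ennreal t < x} t \<partial>lborel)"
        by (subst base[symmetric])
           (auto simp: c_def top intro!: nn_integral_mono split: split_indicator)
      finally show ?thesis .
    qed (simp add: ennreal_neg)
    note ge = this
    have "(\<integral>\<^sup>+t. ennreal (t powr e) * indicator {t. 0 < t \<and> ennreal t < x} t \<partial>lborel) = top"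
      (is "?I = top")
    proof (cases ?I rule: ennreal_cases)
      case (real c)
      then show ?thesis using ge[of "c + 1"] by (simp add: ennreal_le_iff)
    qed
    then show ?thesis using top assms by (simp add: ennreal_mult_top ennreal_eq_0_iff)
  qed
qed

lemma sigma_finite_lebesgue: "sigma_finite_measure (lebesgue :: (real ^ 'd) measure)"
proof
  obtain A :: "(real ^ 'd) set set" where A: "countable A" "A \<subseteq> sets lborel" "\<Union>A = space lborel" "\<forall>a\<in>A. emeasure lborel a \<noteq> \<infinity>"
    using lborel.sigma_finite_countable by auto
  then show "\<exists>A::(real ^ 'd) set set. countable A \<and> A \<subseteq> sets lebesgue \<and> \<Union> A = space lebesgue \<and> (\<forall>a\<in>A. vol a \<noteq> \<infinity>)"
    by (intro exI[of _ A]) auto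
qed

text \<open>The weight \<open>\<psi>\<close> inside the integral allows the formula to be used backwards in the proof of the
  strong type bound, where the inner integral is that of a function over its own superlevel sets.\<close>

lemma layer_cake:
  assumes "sigma_finite_measure \<mu>"
  assumes [measurable]: "\<phi> \<in> borel_measurable \<mu>" "\<psi> \<in> borel_measurable \<mu>" and e: "-1 < e"
  shows "(\<integral>\<^sup>+x. \<psi> x * \<phi> x powe (e + 1) \<partial>\<mu>) =
    ennreal (e + 1) * (\<integral>\<^sup>+t. ennreal (t powr e) * indicator {0<..} t *
       (\<integral>\<^sup>+x. \<psi> x * indicator {x. ennreal t < \<phi> x} x \<partial>\<mu>) \<partial>lborel)"
proof -
  interpret \<mu>: sigma_finite_measure \<mu> by fact
  interpret pair_sigma_finite \<mu> "lborel :: real measure" ..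
  have "(\<integral>\<^sup>+x. \<psi> x * \<phi> x powe (e + 1) \<partial>\<mu>) = (\<integral>\<^sup>+x. ennreal (e + 1) * (\<psi> x *
      (\<integral>\<^sup>+t. ennreal (t powr e) * indicator {t. 0 < t \<and> ennreal t < \<phi> x} t \<partial>lborel)) \<partial>\<mu>)"
  proof (intro nn_integral_cong)
    fix x
    have "ennreal (e + 1) * ennreal (1 / (e + 1)) = 1"
      using e by (simp flip: ennreal_mult)
    then show "\<psi> x * \<phi> x powe (e + 1) = ennreal (e + 1) * (\<psi> x *
      (\<integral>\<^sup>+t. ennreal (t powr e) * indicator {t. 0 < t \<and> ennreal t < \<phi> x} t \<partial>lborel))"
      unfolding nn_integral_powr_less[OF e] by (metis mult.assoc mult.commute mult_1)
  qed
  also have "\<dots> = (\<integral>\<^sup>+x. ennreal (e + 1) * (\<integral>\<^sup>+t. \<psi> x *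
      (ennreal (t powr e) * indicator {0<..} t * (if ennreal t < \<phi> x then 1 else 0)) \<partial>lborel) \<partial>\<mu>)"
  proof (intro nn_integral_cong)
    fix x
    have "(\<integral>\<^sup>+t. \<psi> x * (ennreal (t powr e) * indicator {0<..} t * (if ennreal t < \<phi> x then 1 else 0)) \<partial>lborel)
        = \<psi> x * (\<integral>\<^sup>+t. ennreal (t powr e) * indicator {0<..} t * (if ennreal t < \<phi> x then 1 else 0) \<partial>lborel)"
      by (rule nn_integral_cmult) measurable
    also have "(\<integral>\<^sup>+t. ennreal (t powr e) * indicator {0<..} t * (if ennreal t < \<phi> x then 1 else 0) \<partial>lborel)
        = (\<integral>\<^sup>+t. ennreal (t powr e) * indicator {t. 0 < t \<and> ennreal t < \<phi> x} t \<partial>lborel)"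
      by (intro nn_integral_cong) (auto split: split_indicator)
    finally show "ennreal (e + 1) * (\<psi> x *
        (\<integral>\<^sup>+t. ennreal (t powr e) * indicator {t. 0 < t \<and> ennreal t < \<phi> x} t \<partial>lborel)) =
      ennreal (e + 1) * (\<integral>\<^sup>+t. \<psi> x *
        (ennreal (t powr e) * indicator {0<..} t * (if ennreal t < \<phi> x then 1 else 0)) \<partial>lborel)"
      by simp
  qed
  also have "\<dots> = ennreal (e + 1) * (\<integral>\<^sup>+x. \<integral>\<^sup>+t. \<psi> x *
      (ennreal (t powr e) * indicator {0<..} t * (if ennreal t < \<phi> x then 1 else 0)) \<partial>lborel \<partial>\<mu>)"
    by (intro nn_integral_cmult) measurable
  also have "(\<integral>\<^sup>+x. \<integral>\<^sup>+t. \<psi> x *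
      (ennreal (t powr e) * indicator {0<..} t * (if ennreal t < \<phi> x then 1 else 0)) \<partial>lborel \<partial>\<mu>)
     = (\<integral>\<^sup>+t. \<integral>\<^sup>+x. \<psi> x *
      (ennreal (t powr e) * indicator {0<..} t * (if ennreal t < \<phi> x then 1 else 0)) \<partial>\<mu> \<partial>lborel)"
    by (intro Fubini'[symmetric]) measurable
  also have "\<dots> = (\<integral>\<^sup>+t. ennreal (t powr e) * indicator {0<..} t *
       (\<integral>\<^sup>+x. \<psi> x * indicator {x. ennreal t < \<phi> x} x \<partial>\<mu>) \<partial>lborel)"
    by (intro nn_integral_cong, subst nn_integral_cmult[symmetric])
       (auto intro!: nn_integral_cong simp: mult.commute split: split_indicator)
  finally show ?thesis .
qed

section \<open>Maximal functions for doubling measures\<close>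

text \<open>Superlevel sets of suprema over open cubes are unions of cubes. In particular they are open, which
  settles the measurability of all maximal functions below.\<close>

lemma sup_cubes_level:
  "{x. t < (SUP Q\<in>cubes. c Q * indicator Q x :: ennreal)} =
    (\<Union>(a, l)\<in>{(a, l). 0 < l \<and> t < c (qbox a l)}. qbox a l)"
proof -
  have ind: "t < c Q * indicator Q x \<longleftrightarrow> t < c Q \<and> x \<in> Q" for Q x
    by (cases "x \<in> Q") auto
  have "t < (SUP Q\<in>cubes. c Q * indicator Q x) \<longleftrightarrow> (\<exists>a l. 0 < l \<and> t < c (qbox a l) \<and> x \<in> qbox a l)" for x
    unfolding less_SUP_iff ind Bex_def cubes_iff by blast
  then show ?thesis by auto
qed

lemma borel_measurable_sup_cubes:
  fixes c :: "(real ^ 'd) set \<Rightarrow> ennreal"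
  assumes "sets \<mu> = sets lebesgue"
  shows "(\<lambda>x. SUP Q\<in>cubes. c Q * indicator Q x) \<in> borel_measurable \<mu>"
proof (rule borel_measurableI_greater)
  fix t
  have "open {x. t < (SUP Q\<in>cubes. c Q * indicator Q x)}"
    unfolding sup_cubes_level by auto
  moreover have "space \<mu> = UNIV"
    using sets_eq_imp_space_eq[OF assms] by simp
  ultimately show "{x \<in> space \<mu>. t < (SUP Q\<in>cubes. c Q * indicator Q x)} \<in> sets \<mu>"
    using open_in_lebesgue unfolding assms by simp
qed

lemma doubling_sigma_finite:
  fixes \<mu> :: "(real ^ 'd) measure"
  assumes "doubling D \<mu>" shows "sigma_finite_measure \<mu>"
proof
  define A :: "(real ^ 'd) set set" where "A = range (\<lambda>n::nat. qbox (\<chi> i. - real n - 1) (2 * real n + 2))"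
  have s: "sets \<mu> = sets lebesgue" using assms by (simp add: doubling_def)
  have "x \<in> \<Union>A" for x :: "real ^ 'd"
  proof -
    obtain n where n: "norm x \<le> real n" using real_arch_simple by blast
    then have "x \<in> qbox (\<chi> i. - real n - 1) (2 * real n + 2)" by (rule mem_centred_qbox)
    then show ?thesis by (auto simp: A_def)
  qed
  then have "\<Union>A = space \<mu>" using sets_eq_imp_space_eq[OF s] by auto
  moreover have "emeasure \<mu> a \<noteq> \<infinity>" if "a \<in> A" for a
    using that assms by (auto simp: A_def doubling_def less_top)
  moreover have "A \<subseteq> sets \<mu>" unfolding s A_def by (auto intro!: open_in_lebesgue)
  ultimately show "\<exists>A. countable A \<and> A \<subseteq> sets \<mu> \<and> \<Union>A = space \<mu> \<and> (\<forall>a\<in>A. emeasure \<mu> a \<noteq> \<infinity>)"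
    by (intro exI[of _ A]) (auto simp: A_def)
qed

text \<open>The uncentred maximal function over cubes with respect to an arbitrary measure.\<close>

definition maximal :: "(real ^ 'd) measure \<Rightarrow> (real ^ 'd \<Rightarrow> ennreal) \<Rightarrow> real ^ 'd \<Rightarrow> ennreal" where
  "maximal \<mu> h x = (SUP Q\<in>cubes. (\<integral>\<^sup>+y\<in>Q. h y \<partial>\<mu>) / emeasure \<mu> Q * indicator Q x)"

lemma le_maximal: "0 < l \<Longrightarrow> x \<in> qbox a l \<Longrightarrow> (\<integral>\<^sup>+y\<in>qbox a l. h y \<partial>\<mu>) / emeasure \<mu> (qbox a l) \<le> maximal \<mu> h x"
  using SUP_upper[OF qbox_cubes[of l a], of "\<lambda>Q. (\<integral>\<^sup>+y\<in>Q. h y \<partial>\<mu>) / emeasure \<mu> Q * indicator Q x"]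
  by (simp add: maximal_def)

lemma measurable_maximal:
  assumes "sets \<mu> = sets lebesgue" shows "maximal \<mu> h \<in> borel_measurable \<mu>"
  unfolding maximal_def[abs_def] by (rule borel_measurable_sup_cubes[OF assms])

text \<open>A cube over which \<open>h\<close> has average above \<open>t\<close> also has average at least \<open>t / 2\<close> of the part of \<open>h\<close> that
  exceeds \<open>t / 2\<close>. Keeping only this part on the right is what makes the bound strong enough to be
  integrated in \<open>t\<close>.\<close>

lemma maximal_weak_type:
  fixes \<mu> :: "(real ^ 'd) measure"
  assumes \<mu>: "doubling D \<mu>" and [measurable]: "h \<in> borel_measurable \<mu>" and t: "0 < t"
  shows "ennreal t * emeasure \<mu> {x. ennreal t < maximal \<mu> h x}
     \<le> ennreal (2 * D) * (\<integral>\<^sup>+x. h x * indicator {x. ennreal t < 2 * h x} x \<partial>\<mu>)"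
proof -
  have sets_\<mu>: "sets \<mu> = sets lebesgue" and D: "0 \<le> D" using \<mu> by (auto simp: doubling_def)
  have sp: "space \<mu> = UNIV" using sets_eq_imp_space_eq[OF sets_\<mu>] by simp
  \<comment> \<open>the part of \<open>h\<close> below \<open>t / 2\<close> adds at most \<open>t / 2\<close> to any average\<close>
  define h' where "h' x = h x * indicator {x. ennreal t < 2 * h x} x" for x
  have [measurable]: "h' \<in> borel_measurable \<mu>" unfolding h'_def by measurable
  define I where "I = {(a, l). 0 < l \<and> ennreal t < (\<integral>\<^sup>+y\<in>qbox a l. h y \<partial>\<mu>) / emeasure \<mu> (qbox a l)}"
  have "ennreal (t / 2) * emeasure \<mu> (\<Union>(a, l)\<in>I. qbox a l) \<le> ennreal D * (\<integral>\<^sup>+x. h' x \<partial>\<mu>)"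
  proof (rule covering_estimate[OF \<mu>])
    fix a l assume "(a, l) \<in> I"
    then have l: "0 < l" and av: "ennreal t < (\<integral>\<^sup>+y\<in>qbox a l. h y \<partial>\<mu>) / emeasure \<mu> (qbox a l)"
      by (auto simp: I_def)
    have m: "0 < emeasure \<mu> (qbox a l)" "emeasure \<mu> (qbox a l) < top"
      using \<mu> l by (auto simp: doubling_def)
    have [measurable]: "qbox a l \<in> sets \<mu>" unfolding sets_\<mu> by (rule open_in_lebesgue) simp
    let ?m = "emeasure \<mu> (qbox a l)"
    have "ennreal (t / 2) * ?m + ennreal (t / 2) * ?m = ennreal t * ?m"
      using t by (simp flip: ennreal_plus distrib_right)
    also have "\<dots> \<le> (\<integral>\<^sup>+y\<in>qbox a l. h y \<partial>\<mu>) / ?m * ?m"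
      using av by (intro mult_right_mono) auto
    also have "\<dots> = (\<integral>\<^sup>+y\<in>qbox a l. h y \<partial>\<mu>)"
      using m ennreal_mult_divide_cancel[of ?m] by (simp add: mult.commute)
    also have "\<dots> \<le> (\<integral>\<^sup>+y. ennreal (t / 2) * indicator (qbox a l) y + h' y * indicator (qbox a l) y \<partial>\<mu>)"
    proof (intro nn_integral_mono)
      fix y
      have "h y \<le> ennreal (t / 2)" if le: "\<not> ennreal t < 2 * h y"
      proof (cases "h y" rule: ennreal_cases)
        case (real c)
        then have "2 * h y = ennreal (2 * c)" by (simp add: ennreal_mult)
        then show ?thesis using le real t by (simp add: not_less ennreal_le_iff2)
      qed (use le in simp)
      then show "h y * indicator (qbox a l) y \<le> ennreal (t / 2) * indicator (qbox a l) y + h' y * indicator (qbox a l) y"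
        by (auto simp: h'_def indicator_def)
    qed
    also have "\<dots> = ennreal (t / 2) * ?m + (\<integral>\<^sup>+y\<in>qbox a l. h' y \<partial>\<mu>)"
      by (subst nn_integral_add) (auto simp: nn_integral_cmult_indicator)
    finally show "ennreal (t / 2) * ?m \<le> (\<integral>\<^sup>+y\<in>qbox a l. h' y \<partial>\<mu>)"
      using m t by (subst (asm) ennreal_add_left_cancel_le) (auto simp: ennreal_mult_eq_top_iff)
  qed (auto simp: I_def)
  then have "2 * (ennreal (t / 2) * emeasure \<mu> {x. ennreal t < maximal \<mu> h x}) \<le> 2 * (ennreal D * (\<integral>\<^sup>+x. h' x \<partial>\<mu>))"
    unfolding maximal_def sup_cubes_level I_def by (rule mult_left_mono) simp
  moreover have "2 * ennreal (t / 2) = ennreal t"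
    using t by (simp add: numeral_mult_ennreal)
  moreover have "2 * ennreal D = ennreal (2 * D)"
    using D by (simp add: numeral_mult_ennreal)
  ultimately show ?thesis unfolding h'_def by (metis (no_types, lifting) mult.assoc)
qed

text \<open>Marcinkiewicz interpolation with the trivial bound at infinity, carried out by hand: insert the weak
  type bound into the layer cake formula and exchange the order of integration.\<close>

theorem maximal_strong_type:
  fixes \<mu> :: "(real ^ 'd) measure"
  assumes \<mu>: "doubling D \<mu>" and h[measurable]: "h \<in> borel_measurable \<mu>" and m: "1 < m"
  shows "(\<integral>\<^sup>+x. maximal \<mu> h x powe m \<partial>\<mu>) \<le> ennreal (2 powr m * D * m / (m - 1)) * (\<integral>\<^sup>+x. h x powe m \<partial>\<mu>)"
proof -
  have sets_\<mu>: "sets \<mu> = sets lebesgue" and D: "0 \<le> D" using \<mu> by (auto simp: doubling_def)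
  have sp: "space \<mu> = UNIV" using sets_eq_imp_space_eq[OF sets_\<mu>] by simp
  have [measurable]: "maximal \<mu> h \<in> borel_measurable \<mu>" by (rule measurable_maximal[OF sets_\<mu>])
  note sf = doubling_sigma_finite[OF \<mu>]
  let ?I = "\<lambda>t. \<integral>\<^sup>+x. h x * indicator {x. ennreal t < 2 * h x} x \<partial>\<mu>"
  have "(\<integral>\<^sup>+x. maximal \<mu> h x powe m \<partial>\<mu>) = (\<integral>\<^sup>+x. 1 * maximal \<mu> h x powe ((m - 1) + 1) \<partial>\<mu>)" by simp
  also have "\<dots> = ennreal m * (\<integral>\<^sup>+t. ennreal (t powr (m - 1)) * indicator {0<..} t *
       (\<integral>\<^sup>+x. 1 * indicator {x. ennreal t < maximal \<mu> h x} x \<partial>\<mu>) \<partial>lborel)"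
    by (subst layer_cake[OF sf]) (use m in auto)
  \<comment> \<open>the weak type bound uses up one power of \<open>t\<close>; the remaining exponent \<open>m - 2\<close> exceeds \<open>-1\<close> as \<open>1 < m\<close>\<close>
  also have "\<dots> \<le> ennreal m * (\<integral>\<^sup>+t. ennreal (2 * D) * (ennreal (t powr (m - 2)) * indicator {0<..} t * ?I t) \<partial>lborel)"
  proof (intro mult_left_mono nn_integral_mono)
    fix t :: real
    show "ennreal (t powr (m - 1)) * indicator {0<..} t * (\<integral>\<^sup>+x. 1 * indicator {x. ennreal t < maximal \<mu> h x} x \<partial>\<mu>)
      \<le> ennreal (2 * D) * (ennreal (t powr (m - 2)) * indicator {0<..} t * ?I t)"
    proof (cases "0 < t")
      case True
      have "{x. ennreal t < maximal \<mu> h x} \<in> sets \<mu>"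
        using measurable_sets[OF \<open>maximal \<mu> h \<in> borel_measurable \<mu>\<close>, of "{ennreal t<..}"] by (simp add: vimage_def sp)
      then have "ennreal (t powr (m - 1)) * (\<integral>\<^sup>+x. 1 * indicator {x. ennreal t < maximal \<mu> h x} x \<partial>\<mu>)
          = ennreal (t powr (m - 2)) * (ennreal t * emeasure \<mu> {x. ennreal t < maximal \<mu> h x})"
        using True powr_add[of t "m - 2" 1] by (simp add: ennreal_mult mult.assoc)
      also have "\<dots> \<le> ennreal (t powr (m - 2)) * (ennreal (2 * D) * ?I t)"
        by (intro mult_left_mono maximal_weak_type[OF \<mu> h True]) simp
      finally show ?thesis using True by (simp add: mult_ac)
    qed simp
  qed simp
  also have "\<dots> = ennreal m * (ennreal (2 * D) * (\<integral>\<^sup>+t. ennreal (t powr (m - 2)) * indicator {0<..} t * ?I t \<partial>lborel))"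
  proof -
    interpret \<mu>: sigma_finite_measure \<mu> by (rule sf)
    have "?I = (\<lambda>t. \<integral>\<^sup>+x. h x * (if ennreal t < 2 * h x then 1 else 0) \<partial>\<mu>)"
      by (intro ext nn_integral_cong) (auto split: split_indicator)
    moreover have "\<dots> \<in> borel_measurable lborel"
      by (intro \<mu>.borel_measurable_nn_integral) measurable
    ultimately have [measurable]: "?I \<in> borel_measurable lborel" by simp
    show ?thesis by (subst nn_integral_cmult) auto
  qed
  also have "(\<integral>\<^sup>+t. ennreal (t powr (m - 2)) * indicator {0<..} t * ?I t \<partial>lborel)
      = ennreal (1 / (m - 1)) * (ennreal (m - 1) * (\<integral>\<^sup>+t. ennreal (t powr (m - 2)) * indicator {0<..} t * ?I t \<partial>lborel))"
    using m by (simp flip: mult.assoc ennreal_mult)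
  also have "ennreal (m - 1) * (\<integral>\<^sup>+t. ennreal (t powr (m - 2)) * indicator {0<..} t * ?I t \<partial>lborel)
      = (\<integral>\<^sup>+x. h x * (2 * h x) powe (m - 1) \<partial>\<mu>)"
    using m layer_cake[OF sf, of "\<lambda>x. 2 * h x" h "m - 2"] by simp
  also have "\<dots> = (\<integral>\<^sup>+x. ennreal (2 powr (m - 1)) * h x powe m \<partial>\<mu>)"
  proof (intro nn_integral_cong)
    fix x
    have "h x * h x powe (m - 1) = h x powe m"
      using powe_add[of "h x" 1 "m - 1"] by simp
    moreover have "2 powe (m - 1) = ennreal (2 powr (m - 1))"
      using powe_ennreal[of 2 "m - 1"] by simp
    ultimately show "h x * (2 * h x) powe (m - 1) = ennreal (2 powr (m - 1)) * h x powe m"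
      unfolding powe_mult by (metis mult.left_commute)
  qed
  also have "\<dots> = ennreal (2 powr (m - 1)) * (\<integral>\<^sup>+x. h x powe m \<partial>\<mu>)"
    by (rule nn_integral_cmult) measurable
  also have "ennreal m * (ennreal (2 * D) * (ennreal (1 / (m - 1)) * (ennreal (2 powr (m - 1)) * (\<integral>\<^sup>+x. h x powe m \<partial>\<mu>))))
     = ennreal (m * (2 * D) * (1 / (m - 1)) * 2 powr (m - 1)) * (\<integral>\<^sup>+x. h x powe m \<partial>\<mu>)"
  proof -
    have nn: "0 \<le> 2 * D" "0 \<le> 1 / (m - 1)" "0 \<le> 2 powr (m - 1)" using m D by auto
    show ?thesis
      by (simp only: ennreal_mult''[OF nn(3)] ennreal_mult''[OF nn(2)] ennreal_mult''[OF nn(1)]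
          mult.assoc[where 'a = ennreal])
  qed
  also have "m * (2 * D) * (1 / (m - 1)) * 2 powr (m - 1) = 2 powr m * D * m / (m - 1)"
    using m powr_add[of 2 1 "m - 1"] by (simp add: field_simps)
  finally show ?thesis .
qed

section \<open>Weights with a quantitative lower bound\<close>

text \<open>Simplification by this rule would replace a Lebesgue measurable set by its Borel part and thereby hide
  that it is, say, a subset of a cube.\<close>

declare emeasure_completion [simp del]

abbreviation unif :: "(real ^ 'd) set \<Rightarrow> (real ^ 'd) measure" where
  "unif Q \<equiv> uniform_measure lebesgue Q"

abbreviation avg :: "(real ^ 'd) set \<Rightarrow> (real ^ 'd \<Rightarrow> ennreal) \<Rightarrow> ennreal" where
  "avg Q h \<equiv> integral\<^sup>N (unif Q) h"

lemma qbox_lebesgue [measurable]: "qbox a l \<in> sets lebesgue"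
  by (rule open_in_lebesgue) simp

lemma dilate_lebesgue [measurable]: "dilate k a l \<in> sets lebesgue"
  by (rule open_in_lebesgue) simp

lemma emeasure_qbox_pos: "0 < l \<Longrightarrow> 0 < vol (qbox a l)"
  and emeasure_qbox_finite: "0 < l \<Longrightarrow> vol (qbox a l) < top"
  by (simp_all add: emeasure_qbox del: emeasure_completion)

lemma nn_integral_unif:
  assumes "f \<in> borel_measurable lebesgue" "Q \<in> sets lebesgue"
  shows "(avg Q f) = (\<integral>\<^sup>+x\<in>Q. f x \<partial>lebesgue) / vol Q"
  by (rule nn_integral_uniform_measure[OF assms])

lemma set_nn_integral_unif:
  assumes "f \<in> borel_measurable lebesgue" "0 < l"
  shows "(\<integral>\<^sup>+x\<in>qbox a l. f x \<partial>lebesgue) = vol (qbox a l) * (avg (qbox a l) f)"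
  unfolding nn_integral_unif[OF assms(1) qbox_lebesgue]
  using emeasure_qbox_pos[OF assms(2), of a] emeasure_qbox_finite[OF assms(2), of a]
  by (intro ennreal_mult_divide_cancel[symmetric]) auto

text \<open>A quantitative form of Muckenhoupt's \<open>A\<^sub>\<infinity>\<close> condition: off an exceptional set of small relative volume, the
  weight is at least a fixed multiple of its average. The admitted proportion is chosen such that its
  double is the relative volume of a cube in its triple, which is what the doubling property needs.\<close>

definition a_infinity :: "real \<Rightarrow> (real ^ 'd \<Rightarrow> ennreal) \<Rightarrow> bool" where
  "a_infinity c w \<longleftrightarrow> w \<in> borel_measurable lebesgue \<and> 0 < c \<and>
    (\<forall>a l. 0 < l \<longrightarrow> 0 < (avg (qbox a l) w) \<and> (avg (qbox a l) w) < top \<and>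
      vol {x \<in> qbox a l. w x < ennreal c * (avg (qbox a l) w)}
        \<le> ennreal (1 / (2 * 3 ^ CARD('d))) * vol (qbox a l))"

text \<open>By Chebyshev's inequality \<open>u\<close> exceeds a large multiple of its average only on a small part of the cube.
  Elsewhere \<open>w\<close>, a negative power of \<open>u\<close>, is bounded below by that power of the average of \<open>u\<close>, and this is
  comparable to the average of \<open>w\<close> by hypothesis.\<close>

lemma a_infinity_of_dual_average:
  fixes w u :: "real ^ 'd \<Rightarrow> ennreal"
  assumes w[measurable]: "w \<in> borel_measurable lebesgue" and u[measurable]: "u \<in> borel_measurable lebesgue"
    and wu: "AE x in lebesgue. u x \<noteq> top \<and> w x = inverse (u x powe \<gamma>)"
    and \<gamma>: "0 < \<gamma>" and K: "0 < K"
    and av: "\<And>a l. 0 < l \<Longrightarrow> 0 < (avg (qbox a l) w) \<and> (avg (qbox a l) w) < top"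
    and avu: "\<And>a l. 0 < l \<Longrightarrow> 0 < (avg (qbox a l) u) \<and> (avg (qbox a l) u) < top"
    and le: "\<And>a l. 0 < l \<Longrightarrow> (avg (qbox a l) w) * (avg (qbox a l) u) powe \<gamma> \<le> ennreal K"
  shows "a_infinity ((1 / (2 * 3 ^ CARD('d))) powr \<gamma> / K) w"
  unfolding a_infinity_def
proof (intro conjI allI impI w)
  define \<delta> :: real where "\<delta> = 1 / (2 * 3 ^ CARD('d))"
  have \<delta>: "0 < \<delta>" by (simp add: \<delta>_def)
  define c where "c = \<delta> powr \<gamma> / K"
  have c: "0 < c" using \<delta> K by (simp add: c_def)
  show "0 < (1 / (2 * 3 ^ CARD('d))) powr \<gamma> / K" using c by (simp add: c_def \<delta>_def)
  fix a :: "real ^ 'd" and l :: real assume l: "0 < l"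
  let ?Q = "qbox a l"
  define W where "W = enn2real (avg ?Q w)"
  define U where "U = enn2real (avg ?Q u)"
  have W: "0 < W" "(avg ?Q w) = ennreal W" using av[OF l] by (auto simp: W_def enn2real_positive_iff)
  have U: "0 < U" "(avg ?Q u) = ennreal U" using avu[OF l] by (auto simp: U_def enn2real_positive_iff)
  have WU: "W * U powr \<gamma> \<le> K"
    using le[OF l, of a, unfolded W(2) U(2)] W(1) U(1) K by (simp add: ennreal_le_iff flip: ennreal_mult)
  \<comment> \<open>where \<open>w\<close> is small compared to its average, \<open>u\<close> is large compared to its own\<close>
  have pt: "U < \<delta> * t" if t: "inverse (ennreal t powe \<gamma>) < ennreal (c * W)" "0 \<le> t" for t
  proof (rule ccontr)
    assume "\<not> U < \<delta> * t"
    then have t': "t \<le> U / \<delta>" using \<delta> by (simp add: field_simps)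
    have t0: "0 < t" using t by (cases "t = 0") auto
    have "c * W \<le> \<delta> powr \<gamma> / K * (K / U powr \<gamma>)"
      unfolding c_def using WU U \<delta> K by (intro mult_left_mono) (auto simp: field_simps)
    also have "\<dots> = inverse ((U / \<delta>) powr \<gamma>)" using U \<delta> K by (simp add: powr_divide field_simps)
    also have "\<dots> \<le> inverse (t powr \<gamma>)"
      using t' t0 \<gamma> U \<delta> by (intro le_imp_inverse_le powr_mono2) auto
    finally have "ennreal (c * W) \<le> inverse (ennreal t powe \<gamma>)"
      using t0 by (simp add: inverse_ennreal ennreal_leI)
    with t show False by simp
  qed
  have "vol {x \<in> ?Q. w x < ennreal c * (avg ?Q w)}
      \<le> vol {x \<in> ?Q. ennreal U \<le> ennreal \<delta> * u x}"
  proof (intro emeasure_mono_AE)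
    show "AE x in lebesgue. x \<in> {x \<in> ?Q. w x < ennreal c * (avg ?Q w)} \<longrightarrow>
        x \<in> {x \<in> ?Q. ennreal U \<le> ennreal \<delta> * u x}"
      using wu
    proof eventually_elim
      case (elim x)
      then obtain t where t: "0 \<le> t" "u x = ennreal t" by (cases "u x" rule: ennreal_cases) auto
      show ?case
        using pt[of t] elim t W(1) c \<delta> U unfolding W(2)
        by (auto simp: ennreal_mult[symmetric] intro!: ennreal_leI)
    qed
    show "{x \<in> ?Q. ennreal U \<le> ennreal \<delta> * u x} \<in> sets lebesgue" by measurable
  qed
  moreover have "ennreal U * vol {x \<in> ?Q. ennreal U \<le> ennreal \<delta> * u x}
      \<le> ennreal U * (ennreal \<delta> * vol ?Q)"
  proof -
    have "ennreal U * vol {x \<in> ?Q. ennreal U \<le> ennreal \<delta> * u x}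
        = (\<integral>\<^sup>+x. ennreal U * indicator {x \<in> ?Q. ennreal U \<le> ennreal \<delta> * u x} x \<partial>lebesgue)"
      by (intro nn_integral_cmult_indicator[symmetric]) measurable
    also have "\<dots> \<le> (\<integral>\<^sup>+x. ennreal \<delta> * (u x * indicator ?Q x) \<partial>lebesgue)"
      by (intro nn_integral_mono) (auto simp: indicator_def)
    also have "\<dots> = ennreal \<delta> * (\<integral>\<^sup>+x\<in>?Q. u x \<partial>lebesgue)"
      by (intro nn_integral_cmult) measurable
    also have "\<dots> = ennreal U * (ennreal \<delta> * vol ?Q)"
      unfolding set_nn_integral_unif[OF u l] U(2) by (simp only: mult_ac)
    finally show ?thesis .
  qed
  then have "vol {x \<in> ?Q. ennreal U \<le> ennreal \<delta> * u x} \<le> ennreal \<delta> * vol ?Q"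
    using U by (subst (asm) ennreal_mult_le_mult_iff) (auto simp: ennreal_eq_0_iff)
  ultimately show "vol {x \<in> ?Q. w x < ennreal ((1 / (2 * 3 ^ CARD('d))) powr \<gamma> / K) * (avg ?Q w)}
      \<le> ennreal (1 / (2 * 3 ^ CARD('d))) * vol ?Q"
    unfolding c_def \<delta>_def by (rule order_trans)
qed (use av in auto)

text \<open>A subset of at least twice the exceptional proportion has a good part of at least that proportion,
  on which the weight is bounded below by a multiple of its average.\<close>

lemma a_infinity_subset:
  fixes w :: "real ^ 'd \<Rightarrow> ennreal"
  assumes fl: "a_infinity c w" and l: "0 < l" and E[measurable]: "E \<in> sets lebesgue" and EQ: "E \<subseteq> qbox a l"
    and large: "vol (qbox a l) \<le> ennreal (3 ^ CARD('d)) * vol E"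
  shows "ennreal (c / (2 * 3 ^ CARD('d))) * (\<integral>\<^sup>+x\<in>qbox a l. w x \<partial>lebesgue) \<le> (\<integral>\<^sup>+x\<in>E. w x \<partial>lebesgue)"
proof -
  let ?Q = "qbox a l"
  define k :: real where "k = 3 ^ CARD('d)"
  have k: "0 < k" by (simp add: k_def)
  define W where "W = (avg ?Q w)"
  have w[measurable]: "w \<in> borel_measurable lebesgue" and c: "0 < c" using fl by (auto simp: a_infinity_def)
  define B where "B = {x \<in> ?Q. w x < ennreal c * W}"
  have [measurable]: "B \<in> sets lebesgue" unfolding B_def by measurable
  have B: "vol B \<le> ennreal (1 / (2 * k)) * vol ?Q"
    using fl l unfolding a_infinity_def B_def W_def k_def by blast
  obtain q where q: "vol ?Q = ennreal q" "0 < q"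
    using emeasure_qbox[of l a] l by (metis less_imp_le zero_less_power)
  have "vol E \<le> vol ?Q" "vol B \<le> vol ?Q"
    using EQ by (auto intro!: emeasure_mono simp: B_def simp del: emeasure_completion)
  then obtain e b where e: "vol E = ennreal e" "0 \<le> e" and b: "vol B = ennreal b" "0 \<le> b"
    unfolding q by (metis ennreal_cases ennreal_less_top leD top.not_eq_extremum)
  have "q \<le> k * e" using large q e k unfolding k_def[symmetric] by (simp add: ennreal_le_iff flip: ennreal_mult)
  moreover have "b \<le> 1 / (2 * k) * q" using B q b k by (simp add: ennreal_le_iff flip: ennreal_mult)
  ultimately have eb: "q / (2 * k) \<le> e - b" using k by (simp add: field_simps)
  have "ennreal (e - b) = vol E - vol B"
    using e b by (simp add: ennreal_minus)
  also have "\<dots> \<le> vol (E - B)"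
  proof -
    have "vol E \<le> vol ((E - B) \<union> B)" by (intro emeasure_mono) auto
    also have "\<dots> \<le> vol (E - B) + vol B"
      by (intro emeasure_subadditive) auto
    finally show ?thesis
      using e(1) b(1) by (subst ennreal_minus_le_iff) (auto simp: add.commute)
  qed
  finally have EB: "ennreal (q / (2 * k)) \<le> vol (E - B)"
    using eb ennreal_leI order_trans by blast
  have "ennreal (c / (2 * k)) * (\<integral>\<^sup>+x\<in>?Q. w x \<partial>lebesgue) = ennreal (c / (2 * k)) * (ennreal q * W)"
    unfolding set_nn_integral_unif[OF w l] W_def q by simp
  also have "\<dots> = (ennreal c * W) * ennreal (q / (2 * k))"
  proof -
    have "ennreal (c / (2 * k)) * ennreal q = ennreal c * ennreal (q / (2 * k))"
      using c q k by (simp flip: ennreal_mult)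
    then show ?thesis by (metis mult.assoc mult.commute)
  qed
  also have "\<dots> \<le> (ennreal c * W) * vol (E - B)"
    by (intro mult_left_mono EB) auto
  also have "\<dots> = (\<integral>\<^sup>+x. (ennreal c * W) * indicator (E - B) x \<partial>lebesgue)"
    by (intro nn_integral_cmult_indicator[symmetric]) measurable
  also have "\<dots> \<le> (\<integral>\<^sup>+x\<in>E. w x \<partial>lebesgue)"
    using EQ by (intro nn_integral_mono) (auto simp: B_def indicator_def)
  finally show ?thesis unfolding k_def .
qed

lemma a_infinity_doubling:
  fixes w :: "real ^ 'd \<Rightarrow> ennreal"
  assumes fl: "a_infinity c w"
  shows "doubling (2 * 3 ^ CARD('d) / c) (density lebesgue w)"
proof -
  have w[measurable]: "w \<in> borel_measurable lebesgue" and c: "0 < c" using fl by (auto simp: a_infinity_def)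
  have em: "emeasure (density lebesgue w) A = (\<integral>\<^sup>+x\<in>A. w x \<partial>lebesgue)" if "A \<in> sets lebesgue" for A
    using that by (rule emeasure_density[OF w])
  show ?thesis unfolding doubling_def
  proof (intro conjI allI impI)
    fix a :: "real ^ 'd" and l :: real assume l: "0 < l"
    let ?Q = "qbox a l"
    have "0 < (avg ?Q w)" "(avg ?Q w) < top" using fl l by (auto simp: a_infinity_def)
    then show "0 < emeasure (density lebesgue w) ?Q" "emeasure (density lebesgue w) ?Q < top"
      unfolding em[OF qbox_lebesgue] set_nn_integral_unif[OF w l]
      using emeasure_qbox_pos[OF l, of a] emeasure_qbox_finite[OF l, of a]
      by (auto simp: ennreal_zero_less_mult_iff ennreal_mult_less_top simp del: emeasure_completion)
    let ?P = "dilate 3 a l"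
    have "?Q \<subseteq> ?P" using dilate_mono[of l 1 3 a] l by (simp add: dilate_1)
    then have "ennreal (c / (2 * 3 ^ CARD('d))) * (\<integral>\<^sup>+x\<in>?P. w x \<partial>lebesgue) \<le> (\<integral>\<^sup>+x\<in>?Q. w x \<partial>lebesgue)"
      unfolding dilate_def using l
      by (intro a_infinity_subset[OF fl])
         (auto simp: emeasure_qbox power_mult_distrib ennreal_mult simp del: emeasure_completion)
    then have "ennreal (2 * 3 ^ CARD('d) / c) * (ennreal (c / (2 * 3 ^ CARD('d))) * (\<integral>\<^sup>+x\<in>?P. w x \<partial>lebesgue))
        \<le> ennreal (2 * 3 ^ CARD('d) / c) * (\<integral>\<^sup>+x\<in>?Q. w x \<partial>lebesgue)"
      by (rule mult_left_mono) simp
    moreover have "ennreal (2 * 3 ^ CARD('d) / c) * ennreal (c / (2 * 3 ^ CARD('d))) = 1"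
      using c by (simp flip: ennreal_mult)
    ultimately show "emeasure (density lebesgue w) ?P \<le> ennreal (2 * 3 ^ CARD('d) / c) * emeasure (density lebesgue w) ?Q"
      unfolding em[OF qbox_lebesgue] em[OF dilate_lebesgue] by (simp flip: mult.assoc)
  qed (use c in auto)
qed

text \<open>The shell between a cube and its double is large, so it carries a fixed proportion of the mass of the
  double. Iterating gives geometric growth of the mass of dilated cubes. This is what makes the
  contributions of large cubes summable in the Morrey space estimate.\<close>

lemma a_infinity_reverse_doubling:
  fixes w :: "real ^ 'd \<Rightarrow> ennreal"
  assumes fl: "a_infinity c w" and l: "0 < l"
  shows "ennreal (1 + c / (2 * 3 ^ CARD('d))) ^ n * (\<integral>\<^sup>+x\<in>qbox a l. w x \<partial>lebesgue)
    \<le> (\<integral>\<^sup>+x\<in>dilate (2 ^ n) a l. w x \<partial>lebesgue)"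
proof (induction n)
  case (Suc n)
  define c' where "c' = c / (2 * 3 ^ CARD('d))"
  have w[measurable]: "w \<in> borel_measurable lebesgue" and c: "0 < c" using fl by (auto simp: a_infinity_def)
  then have c': "0 < c'" by (simp add: c'_def)
  let ?P = "dilate (2 ^ n) a l" and ?R = "dilate (2 ^ Suc n) a l"
  have PR: "?P \<subseteq> ?R" using l by (intro dilate_mono) auto
  have eP: "vol ?P = ennreal ((2 ^ n * l) ^ CARD('d))"
    and eR: "vol ?R = ennreal ((2 ^ Suc n * l) ^ CARD('d))"
    unfolding dilate_def using l by (simp_all add: emeasure_qbox del: emeasure_completion)
  have "vol (?R - ?P) = vol ?R - vol ?P"
    using PR eP by (intro emeasure_Diff) (auto simp del: emeasure_completion)
  also have "\<dots> = ennreal ((2 ^ Suc n * l) ^ CARD('d) - (2 ^ n * l) ^ CARD('d))"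
    unfolding eP eR using l by (intro ennreal_minus) auto
  finally have eD: "vol (?R - ?P) = ennreal ((2 ^ Suc n * l) ^ CARD('d) - (2 ^ n * l) ^ CARD('d))" .
  have "ennreal c' * (\<integral>\<^sup>+x\<in>?R. w x \<partial>lebesgue) \<le> (\<integral>\<^sup>+x\<in>?R - ?P. w x \<partial>lebesgue)"
    unfolding c'_def dilate_def[of "2 ^ Suc n"]
  proof (intro a_infinity_subset[OF fl])
    define X where "X = (2 ^ n * l) ^ CARD('d)"
    have X: "(2 ^ Suc n * l) ^ CARD('d) = 2 ^ CARD('d) * X" "0 \<le> X"
      using l by (auto simp: X_def power_mult_distrib)
    have "(2::real) ^ 1 \<le> 2 ^ CARD('d)" by (intro power_increasing) (auto simp: Suc_le_eq)
    moreover have "(3::real) ^ 1 \<le> 3 ^ CARD('d)" by (intro power_increasing) (auto simp: Suc_le_eq)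
    ultimately have "2 ^ CARD('d) \<le> 3 ^ CARD('d) * ((2::real) ^ CARD('d) - 1)"
      using mult_right_mono[of 3 "3 ^ CARD('d)" "(2::real) ^ CARD('d) - 1"] by simp
    then have "2 ^ CARD('d) * X \<le> 3 ^ CARD('d) * ((2::real) ^ CARD('d) - 1) * X"
      using X by (intro mult_right_mono) auto
    then have "(2 ^ Suc n * l) ^ CARD('d) \<le> 3 ^ CARD('d) * ((2 ^ Suc n * l) ^ CARD('d) - (2 ^ n * l) ^ CARD('d))"
      unfolding X(1) X_def[symmetric] by (simp add: algebra_simps)
    then show "vol (qbox (\<chi> i. a $ i - (2 ^ Suc n - 1) / 2 * l) (2 ^ Suc n * l))
      \<le> ennreal (3 ^ CARD('d)) * vol (qbox (\<chi> i. a $ i - (2 ^ Suc n - 1) / 2 * l) (2 ^ Suc n * l) - ?P)"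
      unfolding dilate_def[of "2 ^ Suc n", symmetric] eD eR
      by (simp add: ennreal_leI del: power_Suc flip: ennreal_mult')
  qed (use l in auto)
  then have *: "ennreal c' * (\<integral>\<^sup>+x\<in>?R. w x \<partial>lebesgue) + (\<integral>\<^sup>+x\<in>?P. w x \<partial>lebesgue)
      \<le> (\<integral>\<^sup>+x\<in>?R - ?P. w x \<partial>lebesgue) + (\<integral>\<^sup>+x\<in>?P. w x \<partial>lebesgue)"
    by (rule add_right_mono)
  also have "\<dots> = (\<integral>\<^sup>+x\<in>?R. w x \<partial>lebesgue)"
    using PR by (subst nn_integral_add[symmetric]) (auto intro!: nn_integral_cong split: split_indicator)
  finally have R: "ennreal c' * (\<integral>\<^sup>+x\<in>?R. w x \<partial>lebesgue) + (\<integral>\<^sup>+x\<in>?P. w x \<partial>lebesgue) \<le> (\<integral>\<^sup>+x\<in>?R. w x \<partial>lebesgue)" .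
  have "ennreal (1 + c') ^ Suc n * (\<integral>\<^sup>+x\<in>qbox a l. w x \<partial>lebesgue)
      = ennreal (1 + c') * (ennreal (1 + c') ^ n * (\<integral>\<^sup>+x\<in>qbox a l. w x \<partial>lebesgue))"
    by (simp only: power_Suc mult.assoc)
  also have "\<dots> \<le> ennreal (1 + c') * (\<integral>\<^sup>+x\<in>?P. w x \<partial>lebesgue)"
    using Suc.IH unfolding c'_def by (rule mult_left_mono) simp
  also have "\<dots> = ennreal c' * (\<integral>\<^sup>+x\<in>?P. w x \<partial>lebesgue) + (\<integral>\<^sup>+x\<in>?P. w x \<partial>lebesgue)"
    using c' by (simp add: distrib_right add.commute)
  also have "\<dots> \<le> ennreal c' * (\<integral>\<^sup>+x\<in>?R. w x \<partial>lebesgue) + (\<integral>\<^sup>+x\<in>?P. w x \<partial>lebesgue)"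
    using PR by (intro add_right_mono mult_left_mono nn_integral_mono) (auto split: split_indicator)
  also note R
  finally show ?case unfolding c'_def .
qed (simp add: dilate_1)

section \<open>The bilinear maximal form on weighted Lebesgue spaces\<close>

text \<open>The \<open>L\<^sup>1\<close> norm of the bilinear maximal function.\<close>

abbreviation maximal_form ::
    "real \<Rightarrow> real \<Rightarrow> (real ^ 'd \<Rightarrow> ennreal) \<Rightarrow> (real ^ 'd \<Rightarrow> ennreal) \<Rightarrow> ennreal" where
  "maximal_form r t F G \<equiv>
     (\<integral>\<^sup>+x. (SUP Q\<in>cubes. Lpn (unif Q) r F * Lpn (unif Q) t G * indicator Q x) \<partial>lebesgue)"

text \<open>This replaces sparse domination. If each cube admits \<open>c Q \<le> H\<close> on half of it, then, at every height, each
  cube in the superlevel set of the supremum is half filled by the superlevel set of \<open>H\<close>; the covering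
  estimate compares the volumes and the layer cake formula integrates them.\<close>

lemma sup_cubes_integral_le:
  fixes H :: "real ^ 'd \<Rightarrow> ennreal"
  assumes [measurable]: "H \<in> borel_measurable lebesgue"
    and half: "\<And>a l. 0 < l \<Longrightarrow> vol (qbox a l) \<le> 2 * vol {x \<in> qbox a l. c (qbox a l) \<le> H x}"
  shows "(\<integral>\<^sup>+x. (SUP Q\<in>cubes. c Q * indicator Q x) \<partial>lebesgue) \<le> 2 * ennreal (3 ^ CARD('d)) * (\<integral>\<^sup>+x. H x \<partial>lebesgue)"
proof -
  let ?S = "\<lambda>x. SUP Q\<in>cubes. c Q * indicator Q x"
  have [measurable]: "?S \<in> borel_measurable lebesgue"
    by (rule borel_measurable_sup_cubes) simp
  \<comment> \<open>every cube in the left-hand set has average at least 1 of twice the indicator of the right-hand set\<close>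
  have level: "vol {x. \<tau> < ?S x} \<le> 2 * ennreal (3 ^ CARD('d)) * vol {x. \<tau> < H x}" for \<tau>
  proof -
    have [measurable]: "{x. \<tau> < H x} \<in> sets lebesgue"
      using measurable_sets[OF assms(1), of "{\<tau><..}"] by (simp add: vimage_def)
    have "1 * vol (\<Union>(a, l)\<in>{(a, l). 0 < l \<and> \<tau> < c (qbox a l)}. qbox a l)
        \<le> ennreal (3 ^ CARD('d)) * (\<integral>\<^sup>+x. 2 * indicator {x. \<tau> < H x} x \<partial>lebesgue)"
    proof (rule covering_estimate[OF doubling_lebesgue])
      fix a l assume al: "(a, l) \<in> {(a, l). 0 < l \<and> \<tau> < c (qbox a l)}"
      then have "1 * vol (qbox a l) \<le> 2 * vol {x \<in> qbox a l. c (qbox a l) \<le> H x}"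
        using half by simp
      also have "\<dots> = (\<integral>\<^sup>+x. 2 * indicator {x \<in> qbox a l. c (qbox a l) \<le> H x} x \<partial>lebesgue)"
        by (intro nn_integral_cmult_indicator[symmetric]) measurable
      also have "\<dots> \<le> (\<integral>\<^sup>+x\<in>qbox a l. 2 * indicator {x. \<tau> < H x} x \<partial>lebesgue)"
        using al by (intro nn_integral_mono) (auto simp: indicator_def)
      finally show "1 * vol (qbox a l) \<le> (\<integral>\<^sup>+x\<in>qbox a l. 2 * indicator {x. \<tau> < H x} x \<partial>lebesgue)" .
    qed auto
    moreover have "(\<integral>\<^sup>+x. 2 * indicator {x. \<tau> < H x} x \<partial>lebesgue) = 2 * vol {x. \<tau> < H x}"
      by (intro nn_integral_cmult_indicator) measurable
    ultimately show ?thesis unfolding sup_cubes_level by (simp add: mult_ac)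
  qed
  have lc: "(\<integral>\<^sup>+x. f x \<partial>lebesgue) = (\<integral>\<^sup>+t. ennreal (t powr 0) * indicator {0<..} t *
       vol {x. ennreal t < f x} \<partial>lborel)"
    if [measurable]: "f \<in> borel_measurable lebesgue" for f :: "real ^ 'd \<Rightarrow> ennreal"
  proof -
    have "{x. ennreal t < f x} \<in> sets lebesgue" for t
      using measurable_sets[OF that, of "{ennreal t<..}"] by (simp add: vimage_def)
    then show ?thesis
      using layer_cake[OF sigma_finite_lebesgue that, of "\<lambda>_. 1" 0] by simp
  qed
  have [measurable]: "(\<lambda>t. vol {x. ennreal t < H x}) \<in> borel_measurable lborel"
  proof -
    interpret sigma_finite_measure "lebesgue :: (real ^ 'd) measure" by (rule sigma_finite_lebesgue)
    have "vol {x. ennreal t < H x} = (\<integral>\<^sup>+x. (if ennreal t < H x then 1 else 0) \<partial>lebesgue)" for t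
    proof -
      have "{x. ennreal t < H x} \<in> sets lebesgue"
        using measurable_sets[OF assms(1), of "{ennreal t<..}"] by (simp add: vimage_def)
      then have "vol {x. ennreal t < H x} = (\<integral>\<^sup>+x. indicator {x. ennreal t < H x} x \<partial>lebesgue)"
        by simp
      also have "\<dots> = (\<integral>\<^sup>+x. (if ennreal t < H x then 1 else 0) \<partial>lebesgue)"
        by (intro nn_integral_cong) (simp add: indicator_def)
      finally show ?thesis .
    qed
    moreover have "(\<lambda>t. \<integral>\<^sup>+x. (if ennreal t < H x then 1 else 0) \<partial>lebesgue) \<in> borel_measurable lborel"
      by (intro borel_measurable_nn_integral) measurable
    ultimately show ?thesis by simp
  qed
  have "(\<integral>\<^sup>+x. ?S x \<partial>lebesgue) \<le> (\<integral>\<^sup>+t. 2 * ennreal (3 ^ CARD('d)) * (ennreal (t powr 0) * indicator {0<..} t *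
       vol {x. ennreal t < H x}) \<partial>lborel)"
    unfolding lc[OF \<open>?S \<in> _\<close>]
  proof (intro nn_integral_mono)
    fix t
    show "ennreal (t powr 0) * indicator {0<..} t * vol {x. ennreal t < ?S x}
      \<le> 2 * ennreal (3 ^ CARD('d)) * (ennreal (t powr 0) * indicator {0<..} t * vol {x. ennreal t < H x})"
      using mult_left_mono[OF level[of "ennreal t"], of "ennreal (t powr 0) * indicator {0<..} t"]
      by (simp add: mult_ac)
  qed
  also have "\<dots> = 2 * ennreal (3 ^ CARD('d)) * (\<integral>\<^sup>+x. H x \<partial>lebesgue)"
    unfolding lc[OF assms(1)] by (intro nn_integral_cmult) measurable
  finally show ?thesis .
qed

text \<open>Change of measure: with \<open>w = V\<^sup>-\<^sup>a\<close> and \<open>\<phi> = F\<^sup>r V\<^sup>a\<close>, the average of \<open>F\<^sup>r\<close> over a cube is the average of \<open>w\<close> times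
  the average of \<open>\<phi>\<close> with respect to the measure \<open>w dx\<close>, and the latter is at most the maximal function of
  \<open>\<phi>\<close>. The power of the average of \<open>w\<close> is split in two: one factor is kept, to be controlled by the
  weight condition; the other is at most a power of the weight at the point, if the point is not
  exceptional. As \<open>w dx\<close> is doubling and \<open>r < p\<close>, the maximal function is bounded on \<open>L\<^sup>p\<^sup>/\<^sup>r (w dx)\<close>, and the
  powers of \<open>V\<close> are chosen such that this is the weighted bound for \<open>F\<close>.\<close>

lemma weighted_average_majorant:
  fixes V F :: "real ^ 'd \<Rightarrow> ennreal"
  assumes V[measurable]: "V \<in> borel_measurable lebesgue" and F[measurable]: "F \<in> borel_measurable lebesgue"
    and Vpos: "AE x in lebesgue. 0 < V x \<and> V x < top"
    and fl: "a_infinity c (\<lambda>x. inverse (V x powe a))"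
    and ex: "0 < r" "0 < p" "0 < a" "1 / r = 1 / p + 1 / a"
  shows "\<exists>H. H \<in> borel_measurable lebesgue \<and>
    (\<forall>b l x. 0 < l \<longrightarrow> x \<in> qbox b l \<longrightarrow> ennreal c * (avg (qbox b l) (\<lambda>x. inverse (V x powe a))) \<le> inverse (V x powe a) \<longrightarrow>
       Lpn (unif (qbox b l)) r F \<le> (avg (qbox b l) (\<lambda>x. inverse (V x powe a))) powe (1 / a) * (ennreal ((1 / c) powr (1 / p)) * H x)) \<and>
    Lpn lebesgue p H \<le> ennreal ((2 powr (p / r) * (2 * 3 ^ CARD('d) / c) * (p / r) / (p / r - 1)) powr (1 / p)) * Lpn lebesgue p (\<lambda>x. F x * V x)"
proof -
  define w where "w x = inverse (V x powe a)" for x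
  have w[measurable]: "w \<in> borel_measurable lebesgue" unfolding w_def by measurable
  have fl: "a_infinity c w" using fl by (simp add: w_def[abs_def])
  have c: "0 < c" using fl by (simp add: a_infinity_def)
  define \<mu> where "\<mu> = density lebesgue w"
  have s\<mu>: "sets \<mu> = sets lebesgue" by (simp add: \<mu>_def)
  have d\<mu>: "doubling (2 * 3 ^ CARD('d) / c) \<mu>" unfolding \<mu>_def by (rule a_infinity_doubling[OF fl])
  define \<phi> where "\<phi> x = F x powe r * V x powe a" for x
  have \<phi>[measurable]: "\<phi> \<in> borel_measurable lebesgue" unfolding \<phi>_def by measurable
  then have \<phi>'[measurable]: "\<phi> \<in> borel_measurable \<mu>" by (simp add: \<mu>_def)
  have M[measurable]: "maximal \<mu> \<phi> \<in> borel_measurable lebesgue"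
    using measurable_maximal[OF s\<mu>, of \<phi>] by (simp add: \<mu>_def)
  have w\<phi>: "AE x in lebesgue. w x * \<phi> x = F x powe r"
    using Vpos
  proof eventually_elim
    case (elim x)
    then have "V x powe a * inverse (V x powe a) = 1"
      using ennreal_divide_self[of "V x powe a"] by (auto simp: divide_ennreal_def)
    then show ?case unfolding w_def \<phi>_def by (metis mult.commute mult.left_commute mult_1)
  qed
  have "1 / p < 1 / r" using ex(3) unfolding ex(4) by simp
  then have pr: "1 < p / r" using ex(1,2) by (simp add: field_simps)
  define H where "H x = w x powe (1 / p) * maximal \<mu> \<phi> x powe (1 / r)" for x
  show ?thesis
  proof (intro exI[of _ H] conjI allI impI)
    show "H \<in> borel_measurable lebesgue" unfolding H_def by measurable
  next
    fix b :: "real ^ 'd" and l x assume l: "0 < l" and x: "x \<in> qbox b l"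
      and "ennreal c * (avg (qbox b l) (\<lambda>x. inverse (V x powe a))) \<le> inverse (V x powe a)"
    let ?Q = "qbox b l"
    let ?W = "avg ?Q w"
    have wx: "ennreal c * ?W \<le> w x" using \<open>_ \<le> inverse (V x powe a)\<close> by (simp add: w_def[abs_def])
    have W: "0 < ?W" "?W < top" using fl l by (auto simp: a_infinity_def)
    have em: "emeasure \<mu> ?Q = vol ?Q * ?W"
      unfolding \<mu>_def using set_nn_integral_unif[OF w l, of b] by (subst emeasure_density) auto
    have int: "(\<integral>\<^sup>+y\<in>?Q. \<phi> y \<partial>\<mu>) = vol ?Q * (avg ?Q (\<lambda>x. F x powe r))"
    proof -
      have "(\<integral>\<^sup>+y\<in>?Q. \<phi> y \<partial>\<mu>) = (\<integral>\<^sup>+y. w y * (\<phi> y * indicator ?Q y) \<partial>lebesgue)"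
        unfolding \<mu>_def by (rule nn_integral_density) measurable
      also have "\<dots> = (\<integral>\<^sup>+y\<in>?Q. F y powe r \<partial>lebesgue)"
        using w\<phi> by (intro nn_integral_cong_AE) (auto simp flip: mult.assoc)
      finally show ?thesis using l by (subst (asm) set_nn_integral_unif) auto
    qed
    have mQ: "0 < vol ?Q" "vol ?Q < top"
      using emeasure_qbox_pos emeasure_qbox_finite l by auto
    have "(avg ?Q (\<lambda>x. F x powe r)) / ?W = (\<integral>\<^sup>+y\<in>?Q. \<phi> y \<partial>\<mu>) / emeasure \<mu> ?Q"
      unfolding int em using mQ W
      by (metis divide_mult_eq infinity_ennreal_def mult.commute order_less_irrefl)
    also have "\<dots> \<le> maximal \<mu> \<phi> x" by (rule le_maximal[OF l x])
    finally have "?W * ((avg ?Q (\<lambda>x. F x powe r)) / ?W) \<le> ?W * maximal \<mu> \<phi> x"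
      by (rule mult_left_mono) simp
    then have le: "(avg ?Q (\<lambda>x. F x powe r)) \<le> ?W * maximal \<mu> \<phi> x"
      using W by (subst (asm) ennreal_mult_divide_cancel) auto
    have "Lpn (unif ?Q) r F \<le> (?W * maximal \<mu> \<phi> x) powe (1 / r)"
      unfolding Lpn_def using le ex by (intro powe_mono) auto
    also have "\<dots> = ?W powe (1 / a) * (?W powe (1 / p) * maximal \<mu> \<phi> x powe (1 / r))"
      unfolding powe_mult using ex by (simp only: powe_add mult_ac)
    also have "\<dots> \<le> ?W powe (1 / a) * ((ennreal (1 / c) * w x) powe (1 / p) * maximal \<mu> \<phi> x powe (1 / r))"
    proof (intro mult_left_mono mult_right_mono powe_mono)
      have "ennreal (1 / c) * (ennreal c * ?W) \<le> ennreal (1 / c) * w x"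
        by (intro mult_left_mono wx) simp
      moreover have "ennreal (1 / c) * ennreal c = 1" using c by (simp flip: ennreal_mult)
      ultimately show "?W \<le> ennreal (1 / c) * w x" by (simp flip: mult.assoc)
    qed (use ex in auto)
    also have "\<dots> = ?W powe (1 / a) * (ennreal ((1 / c) powr (1 / p)) * H x)"
      using c by (simp add: H_def powe_mult mult.assoc)
    finally show "Lpn (unif ?Q) r F \<le> (avg ?Q (\<lambda>x. inverse (V x powe a))) powe (1 / a) * (ennreal ((1 / c) powr (1 / p)) * H x)"
      by (simp add: w_def[abs_def])
  next
    let ?C = "2 powr (p / r) * (2 * 3 ^ CARD('d) / c) * (p / r) / (p / r - 1)"
    have "(\<integral>\<^sup>+x. H x powe p \<partial>lebesgue) = (\<integral>\<^sup>+x. w x * maximal \<mu> \<phi> x powe (p / r) \<partial>lebesgue)"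
      using ex(1-3) by (simp add: H_def powe_mult powe_powe)
    also have "\<dots> = (\<integral>\<^sup>+x. maximal \<mu> \<phi> x powe (p / r) \<partial>\<mu>)"
      unfolding \<mu>_def by (rule nn_integral_density[symmetric]) (measurable, simp flip: \<mu>_def)
    also have "\<dots> \<le> ennreal ?C * (\<integral>\<^sup>+x. \<phi> x powe (p / r) \<partial>\<mu>)"
      by (rule maximal_strong_type[OF d\<mu> \<phi>' pr])
    also have "(\<integral>\<^sup>+x. \<phi> x powe (p / r) \<partial>\<mu>) = (\<integral>\<^sup>+x. w x * \<phi> x powe (p / r) \<partial>lebesgue)"
      unfolding \<mu>_def by (rule nn_integral_density) measurable
    also have "\<dots> = (\<integral>\<^sup>+x. (F x * V x) powe p \<partial>lebesgue)"
      using Vpos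
    proof (intro nn_integral_cong_AE, eventually_elim)
      case (elim x)
      then obtain v where v: "V x = ennreal v" "0 < v" by (cases "V x" rule: ennreal_cases) auto
      have e: "a * (p / r) = p + a"
        using ex(1-3) arg_cong[OF ex(4), of "\<lambda>x. a * p * x"] by (simp add: distrib_left)
      have "inverse (V x powe a) * V x powe (a * (p / r)) = V x powe p"
        unfolding e using v by (simp add: inverse_ennreal powr_add flip: ennreal_mult)
      then show ?case
        unfolding w_def \<phi>_def using ex by (simp add: powe_mult powe_powe mult.left_commute)
    qed
    finally have "Lpn lebesgue p H \<le> (ennreal ?C * (\<integral>\<^sup>+x. (F x * V x) powe p \<partial>lebesgue)) powe (1 / p)"
      unfolding Lpn_def using ex by (intro powe_mono) auto
    also have "\<dots> = ennreal (?C powr (1 / p)) * Lpn lebesgue p (\<lambda>x. F x * V x)"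
    proof -
      have "0 \<le> ?C" using pr c ex by (intro divide_nonneg_nonneg mult_nonneg_nonneg) auto
      then show ?thesis unfolding Lpn_def powe_mult[of "ennreal ?C"] by (subst powe_ennreal) auto
    qed
    finally show "Lpn lebesgue p H \<le> ennreal (?C powr (1 / p)) * Lpn lebesgue p (\<lambda>x. F x * V x)" .
  qed
qed

lemma ennreal_inverse_inverse [simp]: "inverse (inverse x) = (x :: ennreal)"
  using one_divide_one_divide_ennreal[of x] by (simp add: divide_ennreal_def)

text \<open>The two-exponent condition of Muckenhoupt type: the power means of \<open>V\<^sup>-\<^sup>1\<close> with exponent \<open>a\<close> and of
  \<open>V\<close> with exponent \<open>b\<close> over a cube have a product of at most \<open>K\<close>.\<close>

definition muckenhoupt :: "real \<Rightarrow> real \<Rightarrow> real \<Rightarrow> (real ^ 'd \<Rightarrow> ennreal) \<Rightarrow> bool" where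
  "muckenhoupt a b K V \<longleftrightarrow> V \<in> borel_measurable lebesgue \<and> (AE x in lebesgue. 0 < V x \<and> V x < top) \<and>
    (\<forall>z l. 0 < l \<longrightarrow>
       0 < (avg (qbox z l) (\<lambda>x. inverse (V x powe a))) \<and> (avg (qbox z l) (\<lambda>x. inverse (V x powe a))) < top \<and>
       0 < (avg (qbox z l) (\<lambda>x. V x powe b)) \<and> (avg (qbox z l) (\<lambda>x. V x powe b)) < top \<and>
       (avg (qbox z l) (\<lambda>x. inverse (V x powe a))) powe (1 / a) * (avg (qbox z l) (\<lambda>x. V x powe b)) powe (1 / b)
         \<le> ennreal K)"

lemma powe_pull:
  assumes "x powe (1 / a) * y powe (1 / b) \<le> ennreal K" "0 < a" "0 < K"
  shows "x * y powe (a / b) \<le> ennreal (K powr a)"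
proof -
  have "(x powe (1 / a) * y powe (1 / b)) powe a \<le> ennreal K powe a"
    using assms by (intro powe_mono) auto
  then show ?thesis using assms by (simp add: powe_mult powe_powe)
qed

text \<open>Each of \<open>V\<^sup>-\<^sup>a\<close> and \<open>V\<^sup>b\<close> is a negative power of the other, so the previous criterion applies to both.\<close>

lemma muckenhoupt_a_infinity:
  fixes V :: "real ^ 'd \<Rightarrow> ennreal"
  assumes M: "muckenhoupt a b K V" and ab: "0 < a" "0 < b" "0 < K"
  shows "a_infinity ((1 / (2 * 3 ^ CARD('d))) powr (a / b) / K powr a) (\<lambda>x. inverse (V x powe a))"
    and "a_infinity ((1 / (2 * 3 ^ CARD('d))) powr (b / a) / K powr b) (\<lambda>x. V x powe b)"
proof -
  have [measurable]: "V \<in> borel_measurable lebesgue" and ae: "AE x in lebesgue. 0 < V x \<and> V x < top"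
    using M by (auto simp: muckenhoupt_def)
  note D = M[unfolded muckenhoupt_def, THEN conjunct2, THEN conjunct2, rule_format]
  show "a_infinity ((1 / (2 * 3 ^ CARD('d))) powr (a / b) / K powr a) (\<lambda>x. inverse (V x powe a))"
  proof (rule a_infinity_of_dual_average)
    show "AE x in lebesgue. V x powe b \<noteq> top \<and> inverse (V x powe a) = inverse ((V x powe b) powe (a / b))"
      using ae by eventually_elim (use ab in \<open>auto simp: powe_powe\<close>)
    show "(avg (qbox z l) (\<lambda>x. inverse (V x powe a))) * (avg (qbox z l) (\<lambda>x. V x powe b)) powe (a / b) \<le> ennreal (K powr a)"
      if "0 < l" for z l
      using D[OF that, of z] ab by (intro powe_pull) auto
  qed (use D ab in auto)
  show "a_infinity ((1 / (2 * 3 ^ CARD('d))) powr (b / a) / K powr b) (\<lambda>x. V x powe b)"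
  proof (rule a_infinity_of_dual_average)
    show "AE x in lebesgue. inverse (V x powe a) \<noteq> top \<and> V x powe b = inverse (inverse (V x powe a) powe (b / a))"
      using ae by eventually_elim (use ab in \<open>auto simp: powe_powe powe_inverse\<close>)
    show "(avg (qbox z l) (\<lambda>x. V x powe b)) * (avg (qbox z l) (\<lambda>x. inverse (V x powe a))) powe (b / a) \<le> ennreal (K powr b)"
      if "0 < l" for z l
      using D[OF that, of z] ab by (intro powe_pull) (auto simp: mult.commute)
  qed (use D ab in auto)
qed

text \<open>The weighted Lebesgue space bound for the form. The majorants of the averages of \<open>F\<close> and of \<open>G\<close> are
  both valid off a small exceptional part of the cube, the averages of the weights that are left over
  multiply to at most \<open>K\<close>, and Hoelder's inequality separates the two majorants. For \<open>G\<close> the roles of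
  \<open>V\<close> and its inverse are exchanged.\<close>

theorem bilinear_form_bound:
  assumes ex: "0 < r" "0 < t" "0 < p" "0 < p'" "0 < a" "0 < b"
      "1 / r = 1 / p + 1 / a" "1 / t = 1 / p' + 1 / b" "1 / p + 1 / p' = 1" and K: "0 < K"
  shows "\<exists>C::real. \<forall>(V :: real ^ 'd \<Rightarrow> ennreal) F G. muckenhoupt a b K V \<longrightarrow>
    F \<in> borel_measurable lebesgue \<longrightarrow> G \<in> borel_measurable lebesgue \<longrightarrow>
    maximal_form r t F G
      \<le> ennreal C * (Lpn lebesgue p (\<lambda>x. F x * V x) * Lpn lebesgue p' (\<lambda>x. G x * inverse (V x)))"
proof -
  define c1 where "c1 = (1 / (2 * 3 ^ CARD('d))) powr (a / b) / K powr a"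
  define c2 where "c2 = (1 / (2 * 3 ^ CARD('d))) powr (b / a) / K powr b"
  have c: "0 < c1" "0 < c2" using K by (auto simp: c1_def c2_def)
  define C1 where "C1 = (2 powr (p / r) * (2 * 3 ^ CARD('d) / c1) * (p / r) / (p / r - 1)) powr (1 / p)"
  define C2 where "C2 = (2 powr (p' / t) * (2 * 3 ^ CARD('d) / c2) * (p' / t) / (p' / t - 1)) powr (1 / p')"
  define k where "k = K * ((1 / c1) powr (1 / p) * (1 / c2) powr (1 / p'))"
  have k: "0 \<le> k" using K by (simp add: k_def)
  have C12: "0 \<le> C1" "0 \<le> C2" by (auto simp: C1_def C2_def)
  define C where "C = 2 * 3 ^ CARD('d) * (k * (C1 * C2))"
  show ?thesis
  proof (intro exI[of _ C] allI impI)
    fix V F G :: "real ^ 'd \<Rightarrow> ennreal"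
    assume M: "muckenhoupt a b K V" and F[measurable]: "F \<in> borel_measurable lebesgue" and G[measurable]: "G \<in> borel_measurable lebesgue"
    have V[measurable]: "V \<in> borel_measurable lebesgue" and ae: "AE x in lebesgue. 0 < V x \<and> V x < top"
      using M by (auto simp: muckenhoupt_def)
    note D = M[unfolded muckenhoupt_def, THEN conjunct2, THEN conjunct2, rule_format]
    have f1: "a_infinity c1 (\<lambda>x. inverse (V x powe a))" and f2: "a_infinity c2 (\<lambda>x. V x powe b)"
      unfolding c1_def c2_def using muckenhoupt_a_infinity[OF M] ex K by auto
    have inv2: "inverse (inverse (V x) powe b) = V x powe b" for x
      by (simp add: powe_inverse)
    have f2': "a_infinity c2 (\<lambda>x. inverse (inverse (V x) powe b))"
      unfolding inv2 by (rule f2)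
    have aei: "AE x in lebesgue. 0 < inverse (V x) \<and> inverse (V x) < top"
      using ae by eventually_elim (auto simp: ennreal_inverse_positive less_top[symmetric])
    obtain H1 where H1[measurable]: "H1 \<in> borel_measurable lebesgue"
      and le1: "\<forall>z l x. 0 < l \<longrightarrow> x \<in> qbox z l \<longrightarrow> ennreal c1 * (avg (qbox z l) (\<lambda>x. inverse (V x powe a))) \<le> inverse (V x powe a) \<longrightarrow>
         Lpn (unif (qbox z l)) r F \<le> (avg (qbox z l) (\<lambda>x. inverse (V x powe a))) powe (1 / a) * (ennreal ((1 / c1) powr (1 / p)) * H1 x)"
      and n1: "Lpn lebesgue p H1 \<le> ennreal C1 * Lpn lebesgue p (\<lambda>x. F x * V x)"
      using weighted_average_majorant[OF V F ae f1 ex(1,3,5,7), folded C1_def] by blast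
    have iV: "(\<lambda>x. inverse (V x)) \<in> borel_measurable lebesgue" by measurable
    obtain H2 where H2[measurable]: "H2 \<in> borel_measurable lebesgue"
      and le2: "\<forall>z l x. 0 < l \<longrightarrow> x \<in> qbox z l \<longrightarrow> ennreal c2 * (avg (qbox z l) (\<lambda>x. V x powe b)) \<le> V x powe b \<longrightarrow>
         Lpn (unif (qbox z l)) t G \<le> (avg (qbox z l) (\<lambda>x. V x powe b)) powe (1 / b) * (ennreal ((1 / c2) powr (1 / p')) * H2 x)"
      and n2: "Lpn lebesgue p' H2 \<le> ennreal C2 * Lpn lebesgue p' (\<lambda>x. G x * inverse (V x))"
      using weighted_average_majorant[OF iV G aei f2' ex(2,4,6,8), unfolded inv2, folded C2_def] by blast
    define H where "H x = ennreal k * (H1 x * H2 x)" for x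
    have [measurable]: "H \<in> borel_measurable lebesgue" unfolding H_def by measurable
    have "maximal_form r t F G
        \<le> 2 * ennreal (3 ^ CARD('d)) * (\<integral>\<^sup>+x. H x \<partial>lebesgue)"
    proof (rule sup_cubes_integral_le)
      fix z :: "real ^ 'd" and l :: real assume l: "0 < l"
      let ?Q = "qbox z l"
      define W1 W2 where "W1 = (avg ?Q (\<lambda>x. inverse (V x powe a)))" and "W2 = (avg ?Q (\<lambda>x. V x powe b))"
      define B1 where "B1 = {x \<in> ?Q. inverse (V x powe a) < ennreal c1 * W1}"
      define B2 where "B2 = {x \<in> ?Q. V x powe b < ennreal c2 * W2}"
      define E where "E = {x \<in> ?Q. Lpn (unif ?Q) r F * Lpn (unif ?Q) t G \<le> H x}"
      have [measurable]: "B1 \<in> sets lebesgue" "B2 \<in> sets lebesgue" "E \<in> sets lebesgue"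
        unfolding B1_def B2_def E_def by measurable
      \<comment> \<open>off the exceptional sets of both weights the product of the averages is at most \<open>H\<close>\<close>
      have "x \<in> E" if x: "x \<in> ?Q" "x \<notin> B1" "x \<notin> B2" for x
      proof -
        have "Lpn (unif ?Q) r F * Lpn (unif ?Q) t G \<le>
          (W1 powe (1 / a) * (ennreal ((1 / c1) powr (1 / p)) * H1 x)) * (W2 powe (1 / b) * (ennreal ((1 / c2) powr (1 / p')) * H2 x))"
          unfolding W1_def W2_def using x
          by (intro mult_mono le1[rule_format, OF l] le2[rule_format, OF l]) (auto simp: B1_def B2_def W1_def W2_def not_less)
        also have "\<dots> = (W1 powe (1 / a) * W2 powe (1 / b)) * ((ennreal ((1 / c1) powr (1 / p)) * ennreal ((1 / c2) powr (1 / p'))) * (H1 x * H2 x))"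
          by (simp only: mult_ac)
        also have "\<dots> \<le> ennreal K * ((ennreal ((1 / c1) powr (1 / p)) * ennreal ((1 / c2) powr (1 / p'))) * (H1 x * H2 x))"
          using D[OF l, of z] unfolding W1_def W2_def by (intro mult_right_mono) auto
        also have "\<dots> = H x"
          using K unfolding H_def k_def by (simp add: ennreal_mult mult.assoc)
        finally show ?thesis using x by (simp add: E_def)
      qed
      then have "?Q \<subseteq> E \<union> (B1 \<union> B2)" by auto
      then have "vol ?Q \<le> vol (E \<union> (B1 \<union> B2))"
        by (intro emeasure_mono) auto
      also have "\<dots> \<le> vol E + vol (B1 \<union> B2)"
        by (intro emeasure_subadditive) auto
      also have "\<dots> \<le> vol E + (vol B1 + vol B2)"
        by (intro add_left_mono emeasure_subadditive) auto
      finally have le: "vol ?Q \<le> vol E + (vol B1 + vol B2)" .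
      have b: "vol B1 \<le> ennreal (1 / 4) * vol ?Q" "vol B2 \<le> ennreal (1 / 4) * vol ?Q"
      proof -
        have "(3::real) ^ 1 \<le> 3 ^ CARD('d)" by (intro power_increasing) (auto simp: Suc_le_eq)
        then have "1 / (2 * 3 ^ CARD('d)) \<le> (1 / 4 :: real)" by (simp add: field_simps)
        then have "ennreal (1 / (2 * 3 ^ CARD('d))) * vol ?Q \<le> ennreal (1 / 4) * vol ?Q"
          by (intro mult_right_mono ennreal_leI) auto
        moreover have "vol B1 \<le> ennreal (1 / (2 * 3 ^ CARD('d))) * vol ?Q"
          using f1 l unfolding B1_def W1_def a_infinity_def by blast
        moreover have "vol B2 \<le> ennreal (1 / (2 * 3 ^ CARD('d))) * vol ?Q"
          using f2 l unfolding B2_def W2_def a_infinity_def by blast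
        ultimately show "vol B1 \<le> ennreal (1 / 4) * vol ?Q" "vol B2 \<le> ennreal (1 / 4) * vol ?Q"
          by auto
      qed
      obtain q where q: "vol ?Q = ennreal q" "0 < q"
        using emeasure_qbox[of l z] l by (metis less_imp_le zero_less_power)
      have "ennreal q \<le> vol E + (ennreal (1 / 4) * ennreal q + ennreal (1 / 4) * ennreal q)"
        using le b unfolding q by (meson add_left_mono add_mono order_trans)
      also have "ennreal (1 / 4) * ennreal q + ennreal (1 / 4) * ennreal q = ennreal (q / 2)"
        using q by (simp flip: ennreal_mult ennreal_plus)
      finally have "ennreal q - ennreal (q / 2) \<le> vol E"
        by (subst ennreal_minus_le_iff) (auto simp: add.commute)
      then have "2 * ennreal (q / 2) \<le> 2 * vol E"
        using q by (intro mult_left_mono) (auto simp: ennreal_minus)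
      then show "vol ?Q \<le> 2 * vol {x \<in> ?Q. Lpn (unif ?Q) r F * Lpn (unif ?Q) t G \<le> H x}"
        using q by (simp add: E_def numeral_mult_ennreal)
    qed measurable
    also have "(\<integral>\<^sup>+x. H x \<partial>lebesgue) = ennreal k * (\<integral>\<^sup>+x. H1 x * H2 x \<partial>lebesgue)"
      unfolding H_def by (rule nn_integral_cmult) measurable
    also have "(\<integral>\<^sup>+x. H1 x * H2 x \<partial>lebesgue) = Lpn lebesgue 1 (\<lambda>x. H1 x * H2 x)"
      by (simp add: Lpn_def)
    also have "2 * ennreal (3 ^ CARD('d)) * (ennreal k * Lpn lebesgue 1 (\<lambda>x. H1 x * H2 x)) \<le>
      2 * ennreal (3 ^ CARD('d)) * (ennreal k * ((ennreal C1 * Lpn lebesgue p (\<lambda>x. F x * V x)) *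
        (ennreal C2 * Lpn lebesgue p' (\<lambda>x. G x * inverse (V x)))))"
    proof (intro mult_left_mono)
      have "Lpn lebesgue 1 (\<lambda>x. H1 x * H2 x) \<le> Lpn lebesgue p H1 * Lpn lebesgue p' H2"
        by (rule Lpn_holder) (use ex in auto)
      also have "\<dots> \<le> (ennreal C1 * Lpn lebesgue p (\<lambda>x. F x * V x)) * (ennreal C2 * Lpn lebesgue p' (\<lambda>x. G x * inverse (V x)))"
        by (intro mult_mono n1 n2) auto
      finally show "Lpn lebesgue 1 (\<lambda>x. H1 x * H2 x) \<le> \<dots>" .
    qed auto
    also have "\<dots> = (2 * ennreal (3 ^ CARD('d)) * (ennreal k * (ennreal C1 * ennreal C2))) *
        (Lpn lebesgue p (\<lambda>x. F x * V x) * Lpn lebesgue p' (\<lambda>x. G x * inverse (V x)))"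
      by (simp only: mult_ac)
    also have "2 * ennreal (3 ^ CARD('d)) * (ennreal k * (ennreal C1 * ennreal C2)) = ennreal C"
      unfolding C_def using k C12 by (simp add: ennreal_mult)
    finally show "maximal_form r t F G
      \<le> ennreal C * (Lpn lebesgue p (\<lambda>x. F x * V x) * Lpn lebesgue p' (\<lambda>x. G x * inverse (V x)))" .
  qed
qed

section \<open>The bilinear maximal form on Morrey spaces\<close>

lemma powe_0_exp: "0 < x \<Longrightarrow> x < top \<Longrightarrow> x powe 0 = 1"
  by (cases x rule: ennreal_cases) auto

lemma powe_neg_cancel: "0 < x \<Longrightarrow> x < top \<Longrightarrow> x powe e * (x powe (- e) * y) = y"
  using powe_add[of x e "- e"] by (simp add: powe_0_exp flip: mult.assoc)

lemma cubes_lebesgue: "Q \<in> cubes \<Longrightarrow> Q \<in> sets lebesgue"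
  by (auto simp: cubes_iff)

lemma emeasure_cube_pos: "Q \<in> cubes \<Longrightarrow> 0 < vol Q"
  and emeasure_cube_finite: "Q \<in> cubes \<Longrightarrow> vol Q < top"
  by (auto simp: cubes_iff emeasure_qbox_pos emeasure_qbox_finite)

lemma Lpn_unif:
  assumes [measurable]: "h \<in> borel_measurable lebesgue" and Q: "Q \<in> cubes" and p: "0 < p"
  shows "Lpn (unif Q) p h = vol Q powe (- 1 / p) * Lpn lebesgue p (\<lambda>x. h x * indicator Q x)"
proof -
  have [measurable]: "Q \<in> sets lebesgue" by (rule cubes_lebesgue[OF Q])
  have "(avg Q (\<lambda>x. h x powe p)) = (\<integral>\<^sup>+x\<in>Q. h x powe p \<partial>lebesgue) / vol Q"
    by (rule nn_integral_unif) measurable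
  also have "(\<integral>\<^sup>+x\<in>Q. h x powe p \<partial>lebesgue) = (\<integral>\<^sup>+x. (h x * indicator Q x) powe p \<partial>lebesgue)"
    by (intro nn_integral_cong) (simp add: indicator_def)
  finally have e: "(avg Q (\<lambda>x. h x powe p)) = (\<integral>\<^sup>+x. (h x * indicator Q x) powe p \<partial>lebesgue) / vol Q" .
  obtain m where m: "vol Q = ennreal m" "0 < m"
    using emeasure_cube_pos[OF Q] emeasure_cube_finite[OF Q] by (cases "vol Q" rule: ennreal_cases) auto
  have "inverse (vol Q) powe (1 / p) = vol Q powe (- 1 / p)"
    using m by (simp add: powe_inverse inverse_ennreal powr_minus inverse_powr)
  then show ?thesis
    unfolding Lpn_def e powe_divide by (simp add: divide_ennreal_def powe_inverse mult.commute)
qed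

lemma Lpn_restrict:
  assumes "h \<in> borel_measurable lebesgue" and Q: "Q \<in> cubes" and p: "0 < p"
  shows "Lpn lebesgue p (\<lambda>x. h x * indicator Q x) = vol Q powe (1 / p) * Lpn (unif Q) p h"
  unfolding Lpn_unif[OF assms]
  using powe_neg_cancel[OF emeasure_cube_pos[OF Q] emeasure_cube_finite[OF Q], of "1 / p"] by simp

lemma emeasure_unif_1: "Q \<in> cubes \<Longrightarrow> emeasure (unif Q) (space (unif Q)) = 1"
  using emeasure_cube_pos[of Q] emeasure_cube_finite[of Q] cubes_lebesgue[of Q]
  by (simp add: emeasure_uniform_measure ennreal_divide_self)

lemma muckenhoupt_iff:
  "muckenhoupt a b K V \<longleftrightarrow> V \<in> borel_measurable lebesgue \<and> (AE x in lebesgue. 0 < V x \<and> V x < top) \<and>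
    (\<forall>Q\<in>cubes. 0 < (avg Q (\<lambda>x. inverse (V x) powe a)) \<and> (avg Q (\<lambda>x. inverse (V x) powe a)) < top \<and>
       0 < (avg Q (\<lambda>x. V x powe b)) \<and> (avg Q (\<lambda>x. V x powe b)) < top \<and>
       Lpn (unif Q) a (\<lambda>x. inverse (V x)) * Lpn (unif Q) b V \<le> ennreal K)"
  unfolding muckenhoupt_def Lpn_def powe_inverse[symmetric] Ball_def cubes_iff by blast

lemma AE_unif: "Q \<in> cubes \<Longrightarrow> AE x in lebesgue. P x \<Longrightarrow> AE x in unif Q. P x"
  by (rule AE_uniform_measureI[OF cubes_lebesgue]) auto

lemma nn_integral_unif_pos:
  assumes [measurable]: "h \<in> borel_measurable lebesgue" and Q: "Q \<in> cubes" and ae: "AE x in lebesgue. 0 < h x"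
  shows "0 < (avg Q h)"
proof (rule ccontr)
  assume "\<not> ?thesis"
  then have "AE x in unif Q. h x = 0"
    using nn_integral_0_iff_AE[of h "unif Q"] by (simp add: zero_less_iff_neq_zero)
  with AE_unif[OF Q ae] have "AE x in unif Q. (1::ennreal) = 0" by eventually_elim auto
  then have "(avg Q (\<lambda>x. 1)) = 0" by (subst nn_integral_0_iff_AE) auto
  then show False using emeasure_unif_1[OF Q] by simp
qed

text \<open>Power means over a cube increase with the exponent. This is how the weight condition with exponents
  adapted to \<open>p\<close> and \<open>q\<close> yields those for the pairs \<open>(p, p)\<close> and \<open>(q, q)\<close>.\<close>

lemma muckenhoupt_mono:
  assumes M: "muckenhoupt a b K V" and "0 < a'" "a' \<le> a" "0 < b'" "b' \<le> b"
  shows "muckenhoupt a' b' K V"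
  unfolding muckenhoupt_iff
proof (intro conjI ballI)
  have V[measurable]: "V \<in> borel_measurable lebesgue" and ae: "AE x in lebesgue. 0 < V x \<and> V x < top"
    and D: "\<forall>Q\<in>cubes. 0 < (avg Q (\<lambda>x. inverse (V x) powe a)) \<and> (avg Q (\<lambda>x. inverse (V x) powe a)) < top \<and>
       0 < (avg Q (\<lambda>x. V x powe b)) \<and> (avg Q (\<lambda>x. V x powe b)) < top \<and>
       Lpn (unif Q) a (\<lambda>x. inverse (V x)) * Lpn (unif Q) b V \<le> ennreal K"
    using M unfolding muckenhoupt_iff by auto
  show "V \<in> borel_measurable lebesgue" "AE x in lebesgue. 0 < V x \<and> V x < top" by fact+
  fix Q :: "(real ^ 'a) set" assume Q: "Q \<in> cubes"
  have J: "Lpn (unif Q) a' (\<lambda>x. inverse (V x)) \<le> Lpn (unif Q) a (\<lambda>x. inverse (V x))" "Lpn (unif Q) b' V \<le> Lpn (unif Q) b V"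
    using assms by (auto intro!: Lpn_Jensen emeasure_unif_1[OF Q])
  have "Lpn (unif Q) a (\<lambda>x. inverse (V x)) < top" "Lpn (unif Q) b V < top"
    using D Q by (auto simp: Lpn_def)
  with J have fin: "Lpn (unif Q) a' (\<lambda>x. inverse (V x)) < top" "Lpn (unif Q) b' V < top" by auto
  then show "(avg Q (\<lambda>x. inverse (V x) powe a')) < top" "(avg Q (\<lambda>x. V x powe b')) < top"
    by (auto simp: Lpn_def)
  show "0 < (avg Q (\<lambda>x. inverse (V x) powe a'))" "0 < (avg Q (\<lambda>x. V x powe b'))"
    by (rule nn_integral_unif_pos[OF _ Q]; (measurable; fail)?;
        rule eventually_mono[OF ae]; auto simp: zero_less_iff_neq_zero less_top[symmetric])+
  have "Lpn (unif Q) a' (\<lambda>x. inverse (V x)) * Lpn (unif Q) b' V \<le> Lpn (unif Q) a (\<lambda>x. inverse (V x)) * Lpn (unif Q) b V"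
    by (intro mult_mono J) auto
  then show "Lpn (unif Q) a' (\<lambda>x. inverse (V x)) * Lpn (unif Q) b' V \<le> ennreal K"
    using D Q by (blast intro: order_trans)
qed

definition morrey :: "real \<Rightarrow> real \<Rightarrow> (real ^ 'd \<Rightarrow> ennreal) \<Rightarrow> ennreal" where
  "morrey p q h = (SUP Q\<in>cubes. vol Q powe (1 / q) * Lpn (unif Q) p h)"

lemma Lpn_unif_le_morrey:
  assumes Q: "Q \<in> cubes" shows "Lpn (unif Q) p h \<le> vol Q powe (- 1 / q) * morrey p q h"
proof -
  have "Lpn (unif Q) p h = vol Q powe (- (1 / q)) * (vol Q powe (1 / q) * Lpn (unif Q) p h)"
    using powe_neg_cancel[OF emeasure_cube_pos[OF Q] emeasure_cube_finite[OF Q], of "- (1 / q)"] by simp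
  also have "\<dots> \<le> vol Q powe (- (1 / q)) * morrey p q h"
    unfolding morrey_def by (intro mult_left_mono SUP_upper Q) auto
  finally show ?thesis by simp
qed

lemma Lpn_unif_enlarge:
  assumes h[measurable]: "h \<in> borel_measurable lebesgue" and PQ: "P \<subseteq> Q" "P \<in> cubes" "Q \<in> cubes"
    and m: "vol Q \<le> ennreal k * vol P" and p: "0 < p" and k: "0 \<le> k"
  shows "Lpn (unif P) p h \<le> ennreal (k powr (1 / p)) * Lpn (unif Q) p h"
proof -
  let ?P = "vol P" and ?Q = "vol Q"
  have "Lpn (unif P) p h \<le> ?P powe (- 1 / p) * Lpn lebesgue p (\<lambda>x. h x * indicator Q x)"
    unfolding Lpn_unif[OF h PQ(2) p] using PQ(1) p
    by (intro mult_left_mono Lpn_mono) (auto simp: indicator_def)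
  also have "\<dots> = ?P powe (- 1 / p) * ?Q powe (1 / p) * Lpn (unif Q) p h"
    unfolding Lpn_restrict[OF h PQ(3) p] by (simp add: mult.assoc)
  also have "\<dots> \<le> ?P powe (- 1 / p) * (ennreal k * ?P) powe (1 / p) * Lpn (unif Q) p h"
    using p by (intro mult_right_mono mult_left_mono powe_mono m) auto
  also have "\<dots> = ennreal (k powr (1 / p)) * (?P powe (1 / p) * (?P powe (- (1 / p)) * Lpn (unif Q) p h))"
    using k by (simp add: powe_mult mult_ac)
  also have "\<dots> = ennreal (k powr (1 / p)) * Lpn (unif Q) p h"
    using powe_neg_cancel[OF emeasure_cube_pos[OF PQ(2)] emeasure_cube_finite[OF PQ(2)]] by simp
  finally show ?thesis .
qed

lemma suminf_geometric_ennreal: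
  assumes "0 \<le> \<eta>" "\<eta> < 1" shows "(\<Sum>k. ennreal \<eta> ^ k) = ennreal (1 / (1 - \<eta>))"
proof -
  have "(\<Sum>k. ennreal \<eta> ^ k) = (\<Sum>k. ennreal (\<eta> ^ k))"
    using assms(1) by (simp only: ennreal_power)
  also have "\<dots> = ennreal (\<Sum>k. \<eta> ^ k)"
    using assms by (intro suminf_ennreal2 summable_geometric) auto
  also have "(\<Sum>k. \<eta> ^ k) = 1 / (1 - \<eta>)"
    using assms by (intro suminf_geometric) auto
  finally show ?thesis .
qed

text \<open>Let \<open>G\<close> live in a cube \<open>Q\<close>. Cubes that meet \<open>Q\<close> and are at most as large lie in the triple of \<open>Q\<close>; for
  them \<open>F\<close> may be cut off to the triple, and the bound for the pair \<open>(p, p)\<close> together with the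
  definition of the Morrey norm gives the claim. A cube whose side is about \<open>2\<^sup>k\<close> times that of \<open>Q\<close> may be
  replaced by a dilate \<open>A k\<close> of \<open>Q\<close>. There \<open>F\<close> is estimated by its Morrey norm and the average of \<open>V\<^sup>-\<^sup>1\<close>,
  while \<open>G\<close> only sees \<open>V\<close> on the small cube \<open>Q\<close>; all powers of the volume of \<open>A k\<close> cancel, and what remains
  is the ratio of the norms of \<open>V\<close> over \<open>Q\<close> and over \<open>A k\<close>. By reverse doubling this ratio decays
  geometrically in \<open>k\<close>.\<close>

theorem bilinear_form_morrey_bound:
  assumes ex: "0 < r" "0 < t" "0 < p" "0 < p'" "0 < a" "0 < b" "0 < \<sigma>" "0 < q"
      "1 / r = 1 / p + 1 / a" "1 / t = 1 / p' + 1 / b" "1 / p + 1 / p' = 1"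
      "1 / b = 1 / \<sigma> + (1 / p - 1 / q)" "p \<le> q" and K: "0 < K"
  shows "\<exists>C::real. \<forall>(V :: real ^ 'd \<Rightarrow> ennreal) F G z l. muckenhoupt a \<sigma> K V \<longrightarrow>
    F \<in> borel_measurable lebesgue \<longrightarrow> G \<in> borel_measurable lebesgue \<longrightarrow> 0 < l \<longrightarrow>
    (\<forall>x. x \<notin> qbox z l \<longrightarrow> G x = 0) \<longrightarrow>
    maximal_form r t F G
      \<le> ennreal C * (vol (qbox z l) powe (1 / p - 1 / q) * morrey p q (\<lambda>x. F x * V x)
            * Lpn lebesgue p' (\<lambda>x. G x * inverse (V x)))"
proof -
  define d where "d = CARD('d)"
  define k0 :: real where "k0 = 8 ^ d"
  define \<kappa> where "\<kappa> = k0 powr (1 / r) * k0 powr (1 / t)"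
  have \<kappa>: "0 \<le> \<kappa>" by (simp add: \<kappa>_def)
  define c where "c = (1 / (2 * 3 ^ CARD('d))) powr (\<sigma> / a) / K powr \<sigma>"
  have c: "0 < c" using K by (auto simp: c_def)
  define \<rho> where "\<rho> = 1 + c / (2 * 3 ^ CARD('d))"
  have \<rho>: "1 < \<rho>" using c by (simp add: \<rho>_def)
  define \<eta> where "\<eta> = (1 / \<rho>) powr (1 / \<sigma>)"
  have \<eta>: "0 < \<eta>" "\<eta> < 1" using \<rho> ex(7) powr_less_mono2[of "1 / \<sigma>" "1 / \<rho>" 1] by (auto simp: \<eta>_def)
  have "1 / q \<le> 1 / p" using ex(3,13) by (intro divide_left_mono) auto
  then have pq: "0 \<le> 1 / p - 1 / q" by simp
  have "1 / \<sigma> \<le> 1 / b" using pq ex(12) by linarith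
  then have b\<sigma>: "b \<le> \<sigma>" using ex(6,7) by (simp add: field_simps)
  obtain C1 :: real where C1: "\<And>(V :: real ^ 'd \<Rightarrow> ennreal) F G. muckenhoupt a b K V \<Longrightarrow>
    F \<in> borel_measurable lebesgue \<Longrightarrow> G \<in> borel_measurable lebesgue \<Longrightarrow>
    maximal_form r t F G
      \<le> ennreal C1 * (Lpn lebesgue p (\<lambda>x. F x * V x) * Lpn lebesgue p' (\<lambda>x. G x * inverse (V x)))"
    using bilinear_form_bound[OF ex(1-6,9-11) K] by blast
  define D1 where "D1 = max C1 0 * (3 ^ d) powr (1 / p - 1 / q)"
  define D2 where "D2 = \<kappa> * K / (1 - \<eta>)"
  have D12: "0 \<le> D1" "0 \<le> D2" using \<kappa> K \<eta> by (auto simp: D1_def D2_def)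
  show ?thesis
  proof (intro exI[of _ "D1 + D2"] allI impI)
    fix V F G :: "real ^ 'd \<Rightarrow> ennreal" and z :: "real ^ 'd" and l :: real
    assume M: "muckenhoupt a \<sigma> K V" and F[measurable]: "F \<in> borel_measurable lebesgue"
      and G[measurable]: "G \<in> borel_measurable lebesgue" and l: "0 < l" and G0: "\<forall>x. x \<notin> qbox z l \<longrightarrow> G x = 0"
    have V[measurable]: "V \<in> borel_measurable lebesgue" and ae: "AE x in lebesgue. 0 < V x \<and> V x < top"
      using M unfolding muckenhoupt_iff by auto
    have Mb: "muckenhoupt a b K V" using ex b\<sigma> by (intro muckenhoupt_mono[OF M]) auto
    define Q0 where "Q0 = qbox z l"
    define S where "S = dilate 3 z l"
    define A where "A k = dilate (2 ^ (k + 3)) z l" for k :: nat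
    have Q0: "Q0 \<in> cubes" and S: "S \<in> cubes" and A: "A k \<in> cubes" for k
      using l by (auto simp: Q0_def S_def A_def qbox_cubes dilate_cubes)
    have [measurable]: "Q0 \<in> sets lebesgue" "S \<in> sets lebesgue" "A k \<in> sets lebesgue" for k
      using cubes_lebesgue Q0 S A by auto
    have mQ0: "0 < vol Q0" "vol Q0 < top"
      using emeasure_cube_pos[OF Q0] emeasure_cube_finite[OF Q0] by auto
    have mA: "0 < vol (A k)" "vol (A k) < top" for k
      using emeasure_cube_pos[OF A] emeasure_cube_finite[OF A] by auto
    define N where "N = morrey p q (\<lambda>x. F x * V x)"
    define L where "L = Lpn lebesgue p' (\<lambda>x. G x * inverse (V x))"
    define R where "R = vol Q0 powe (1 / p - 1 / q) * N * L"
    define S1 where "S1 x = (SUP Q\<in>cubes. Lpn (unif Q) r (\<lambda>x. F x * indicator S x) * Lpn (unif Q) t G * indicator Q x)" for x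
    \<comment> \<open>\<open>S1\<close> dominates the cubes at most as large as \<open>Q0\<close>, and \<open>S2 k\<close> those about \<open>2\<^sup>k\<close> times as large\<close>
    define S2 where "S2 k x = ennreal \<kappa> * (Lpn (unif (A k)) r F * Lpn (unif (A k)) t G) * indicator (A k) x" for k x
    have [measurable]: "S1 \<in> borel_measurable lebesgue"
      unfolding S1_def[abs_def] by (rule borel_measurable_sup_cubes) simp
    have [measurable]: "S2 k \<in> borel_measurable lebesgue" for k
      unfolding S2_def[abs_def] by measurable

    have pointwise: "(SUP Q\<in>cubes. Lpn (unif Q) r F * Lpn (unif Q) t G * indicator Q x) \<le> S1 x + (\<Sum>k. S2 k x)" for x
    proof (rule SUP_least)
      fix P :: "(real ^ 'd) set" assume P: "P \<in> cubes"
      then obtain y m where ym: "P = qbox y m" "0 < m" by (auto simp: cubes_iff)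
      have [measurable]: "P \<in> sets lebesgue" by (rule cubes_lebesgue[OF P])
      consider "x \<notin> P" | "x \<in> P" "Q0 \<inter> P = {}" | "x \<in> P" "Q0 \<inter> P \<noteq> {}" "m \<le> l" | "x \<in> P" "Q0 \<inter> P \<noteq> {}" "l < m"
        by fastforce
      then show "Lpn (unif P) r F * Lpn (unif P) t G * indicator P x \<le> S1 x + (\<Sum>k. S2 k x)"
      proof cases
        case 2
        have "(\<lambda>x. G x * indicator P x) = (\<lambda>x. 0)" using 2 G0 by (auto simp: fun_eq_iff indicator_def Q0_def)
        then have "Lpn (unif P) t G = 0" unfolding Lpn_unif[OF G P ex(2)] by (simp add: Lpn_def)
        then show ?thesis by simp
      next
        case 3
        have "P \<subseteq> S" using qbox_subset_dilate[of z l y m 1] 3 by (auto simp: Q0_def S_def ym)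
        then have "(\<lambda>x. F x * indicator P x) = (\<lambda>x. F x * indicator S x * indicator P x)"
          by (auto simp: fun_eq_iff indicator_def)
        then have "Lpn (unif P) r F = Lpn (unif P) r (\<lambda>x. F x * indicator S x)"
          by (simp add: Lpn_unif[OF _ P ex(1)])
        then have "Lpn (unif P) r F * Lpn (unif P) t G * indicator P x \<le> S1 x"
          unfolding S1_def using P by (auto intro: SUP_upper2)
        also have "\<dots> \<le> S1 x + (\<Sum>k. S2 k x)" by simp
        finally show ?thesis .
      next
        case 4
        obtain n where n: "m / l \<le> 2 ^ n" using real_arch_pow[of 2 "m / l"] by (auto intro: less_imp_le)
        \<comment> \<open>\<open>k\<close> is chosen such that \<open>2\<^sup>k l \<le> m \<le> 2\<^sup>k\<^sup>+\<^sup>1 l\<close>; then \<open>P\<close> and \<open>A k\<close> have comparable volumes\<close>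
        define k where "k = (LEAST k. m \<le> 2 ^ (k + 1) * l)"
        have "m \<le> 2 ^ n * l" using n l by (simp add: field_simps)
        also have "\<dots> \<le> 2 ^ (n + 1) * l" using l by (intro mult_right_mono power_increasing) auto
        finally have "m \<le> 2 ^ (n + 1) * l" .
        then have k1: "m \<le> 2 ^ (k + 1) * l" unfolding k_def by (rule LeastI)
        have k2: "2 ^ k * l \<le> m"
        proof (cases k)
          case (Suc j)
          then have "\<not> m \<le> 2 ^ (j + 1) * l" using not_less_Least[of j "\<lambda>k. m \<le> 2 ^ (k + 1) * l"] unfolding k_def by simp
          then show ?thesis using Suc by simp
        qed (use 4 in simp)
        have "P \<subseteq> dilate (1 + 2 * 2 ^ (k + 1)) z l"
          using qbox_subset_dilate[of z l y m "2 ^ (k + 1)"] 4 k1 by (auto simp: Q0_def ym)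
        also have "\<dots> \<subseteq> A k"
        proof -
          have "(1::real) \<le> 2 ^ k" "(2::real) ^ (k + 3) = 8 * 2 ^ k" "(2::real) ^ (k + 1) = 2 * 2 ^ k"
            by (simp_all add: power_add)
          then have "1 + 2 * 2 ^ (k + 1) \<le> (2::real) ^ (k + 3)" by linarith
          then show ?thesis unfolding A_def using l by (intro dilate_mono) auto
        qed
        finally have PA: "P \<subseteq> A k" .
        have vol: "vol (A k) \<le> ennreal k0 * vol P"
        proof -
          have "(2 ^ (k + 3) * l) ^ d \<le> (8 * m) ^ d"
            using k2 l by (intro power_mono) (auto simp: power_add)
          then show ?thesis
            unfolding A_def dilate_def ym k0_def using l ym(2)
            by (simp add: emeasure_qbox power_mult_distrib d_def ennreal_leI flip: ennreal_mult)
        qed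
        have "Lpn (unif P) r F * Lpn (unif P) t G \<le>
            (ennreal (k0 powr (1 / r)) * Lpn (unif (A k)) r F) * (ennreal (k0 powr (1 / t)) * Lpn (unif (A k)) t G)"
          using ex by (intro mult_mono Lpn_unif_enlarge[OF _ PA P A vol]) (auto simp: k0_def)
        also have "\<dots> = S2 k x"
          using 4 PA by (auto simp: S2_def \<kappa>_def ennreal_mult mult_ac)
        also have "\<dots> \<le> (\<Sum>k. S2 k x)"
          using sum_le_suminf[of "\<lambda>k. S2 k x" "{k}"] by simp
        also have "\<dots> \<le> S1 x + (\<Sum>k. S2 k x)" by simp
        finally show ?thesis using 4 by simp
      qed simp
    qed

    have int1: "(\<integral>\<^sup>+x. S1 x \<partial>lebesgue) \<le> ennreal D1 * R"
    proof -
      have mS: "vol S = ennreal (3 ^ d) * vol Q0"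
        using l unfolding S_def dilate_def Q0_def d_def
        by (simp add: emeasure_qbox power_mult_distrib ennreal_mult)
      have "Lpn lebesgue p (\<lambda>x. F x * indicator S x * V x) = Lpn lebesgue p (\<lambda>x. F x * V x * indicator S x)"
        by (simp add: mult_ac)
      also have "\<dots> = vol S powe (1 / p) * Lpn (unif S) p (\<lambda>x. F x * V x)"
        by (rule Lpn_restrict[OF _ S ex(3)]) measurable
      also have "\<dots> \<le> vol S powe (1 / p) * (vol S powe (- 1 / q) * N)"
        unfolding N_def by (intro mult_left_mono Lpn_unif_le_morrey[OF S]) auto
      also have "\<dots> = vol S powe (1 / p - 1 / q) * N"
        using powe_add[of "vol S" "1 / p" "- 1 / q"] by (simp add: mult.assoc)
      also have "\<dots> = ennreal ((3 ^ d) powr (1 / p - 1 / q)) * (vol Q0 powe (1 / p - 1 / q) * N)"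
        unfolding mS powe_mult by (simp add: mult.assoc)
      finally have le: "Lpn lebesgue p (\<lambda>x. F x * indicator S x * V x) \<le> \<dots>" .
      have "(\<integral>\<^sup>+x. S1 x \<partial>lebesgue) \<le> ennreal C1 * (Lpn lebesgue p (\<lambda>x. F x * indicator S x * V x) * L)"
        unfolding S1_def L_def by (intro C1[OF Mb]) measurable
      also have "\<dots> \<le> ennreal (max C1 0) * ((ennreal ((3 ^ d) powr (1 / p - 1 / q)) * (vol Q0 powe (1 / p - 1 / q) * N)) * L)"
        by (intro mult_mono le ennreal_leI) auto
      also have "\<dots> = ennreal D1 * R"
        unfolding R_def D1_def by (simp add: ennreal_mult mult_ac)
      finally show ?thesis .
    qed

    have int2: "(\<integral>\<^sup>+x. S2 k x \<partial>lebesgue) \<le> ennreal (\<kappa> * K) * R * ennreal \<eta> ^ k" for k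
    proof -
      let ?A = "vol (A k)" and ?Q = "vol Q0"
      let ?X = "Lpn (unif (A k)) a (\<lambda>x. inverse (V x))" and ?Y = "Lpn (unif (A k)) \<sigma> V"
      have XY: "?X * ?Y \<le> ennreal K" using M A[of k] unfolding muckenhoupt_iff by blast
      have f: "Lpn (unif (A k)) r F \<le> ?A powe (- 1 / q) * N * ?X"
      proof -
        have "Lpn (unif (A k)) r F = Lpn (unif (A k)) r (\<lambda>x. (F x * V x) * inverse (V x))"
        proof (intro Lpn_cong_AE AE_unif[OF A] eventually_mono[OF ae])
          fix x assume "0 < V x \<and> V x < top"
          then have "V x * inverse (V x) = 1" using ennreal_divide_self[of "V x"] by (auto simp: divide_ennreal_def)
          then show "F x = (F x * V x) * inverse (V x)" by (simp add: mult.assoc)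
        qed
        also have "\<dots> \<le> Lpn (unif (A k)) p (\<lambda>x. F x * V x) * ?X"
          using ex by (intro Lpn_holder) auto
        also have "\<dots> \<le> (?A powe (- 1 / q) * N) * ?X"
          unfolding N_def by (intro mult_right_mono Lpn_unif_le_morrey[OF A]) auto
        finally show ?thesis .
      qed
      \<comment> \<open>reverse doubling of \<open>V\<^sup>\<sigma>\<close>, after taking roots\<close>
      have rev: "Lpn lebesgue \<sigma> (\<lambda>x. V x * indicator Q0 x) \<le> ennreal \<eta> ^ k * (?A powe (1 / \<sigma>) * ?Y)"
      proof -
        have "a_infinity c (\<lambda>x. V x powe \<sigma>)" unfolding c_def by (rule muckenhoupt_a_infinity(2)[OF M]) (use ex K in auto)
        from a_infinity_reverse_doubling[OF this l, of "k + 3" z]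
        have le: "ennreal \<rho> ^ (k + 3) * (\<integral>\<^sup>+x\<in>Q0. V x powe \<sigma> \<partial>lebesgue) \<le> (\<integral>\<^sup>+x\<in>A k. V x powe \<sigma> \<partial>lebesgue)"
          unfolding Q0_def A_def \<rho>_def .
        have "ennreal \<rho> ^ k * (\<integral>\<^sup>+x\<in>Q0. V x powe \<sigma> \<partial>lebesgue) \<le> ennreal \<rho> ^ (k + 3) * (\<integral>\<^sup>+x\<in>Q0. V x powe \<sigma> \<partial>lebesgue)"
          using \<rho> by (intro mult_right_mono power_increasing) auto
        note this[THEN order_trans, OF le]
        then have "ennreal (1 / \<rho>) ^ k * (ennreal \<rho> ^ k * (\<integral>\<^sup>+x\<in>Q0. V x powe \<sigma> \<partial>lebesgue))
            \<le> ennreal (1 / \<rho>) ^ k * (\<integral>\<^sup>+x\<in>A k. V x powe \<sigma> \<partial>lebesgue)"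
          by (rule mult_left_mono) simp
        moreover have "ennreal (1 / \<rho>) ^ k * ennreal \<rho> ^ k = 1"
          using \<rho> by (simp flip: power_mult_distrib ennreal_mult)
        ultimately have "(\<integral>\<^sup>+x\<in>Q0. V x powe \<sigma> \<partial>lebesgue) \<le> ennreal (1 / \<rho>) ^ k * (\<integral>\<^sup>+x\<in>A k. V x powe \<sigma> \<partial>lebesgue)"
          by (simp flip: mult.assoc)
        moreover have ind: "(\<integral>\<^sup>+x\<in>B. V x powe \<sigma> \<partial>lebesgue) = (\<integral>\<^sup>+x. (V x * indicator B x) powe \<sigma> \<partial>lebesgue)" for B
          by (intro nn_integral_cong) (simp add: indicator_def)
        ultimately have "Lpn lebesgue \<sigma> (\<lambda>x. V x * indicator Q0 x) \<le> (ennreal (1 / \<rho>) ^ k * (\<integral>\<^sup>+x. (V x * indicator (A k) x) powe \<sigma> \<partial>lebesgue)) powe (1 / \<sigma>)"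
          unfolding Lpn_def ind using ex by (intro powe_mono) auto
        also have "\<dots> = (ennreal (1 / \<rho>) ^ k) powe (1 / \<sigma>) * Lpn lebesgue \<sigma> (\<lambda>x. V x * indicator (A k) x)"
          by (simp add: powe_mult Lpn_def)
        also have "(ennreal (1 / \<rho>) ^ k) powe (1 / \<sigma>) = ennreal \<eta> ^ k"
        proof (induction k)
          case (Suc k)
          have "ennreal (1 / \<rho>) powe (1 / \<sigma>) = ennreal \<eta>" using \<rho> by (simp add: \<eta>_def)
          then show ?case using Suc by (simp only: power_Suc powe_mult)
        qed simp
        also have "Lpn lebesgue \<sigma> (\<lambda>x. V x * indicator (A k) x) = ?A powe (1 / \<sigma>) * ?Y"
          by (rule Lpn_restrict[OF V A ex(7)])
        finally show ?thesis .
      qed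
      have g: "Lpn (unif (A k)) t G \<le> ?A powe (- 1 / t) * (L * (?Q powe (1 / p - 1 / q) * (ennreal \<eta> ^ k * (?A powe (1 / \<sigma>) * ?Y))))"
      proof -
        have "Lpn (unif (A k)) t G \<le> ?A powe (- 1 / t) * Lpn lebesgue t G"
          unfolding Lpn_unif[OF G A ex(2)] using ex by (intro mult_left_mono Lpn_mono) (auto simp: indicator_def)
        also have "Lpn lebesgue t G = Lpn lebesgue t (\<lambda>x. (G x * inverse (V x)) * (V x * indicator Q0 x))"
        proof (intro Lpn_cong_AE eventually_mono[OF ae])
          fix x assume "0 < V x \<and> V x < top"
          then have "inverse (V x) * V x = 1" using ennreal_divide_self[of "V x"] by (auto simp: divide_ennreal_def mult.commute)
          moreover have "G x = G x * indicator Q0 x" using G0 by (auto simp: Q0_def indicator_def)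
          ultimately show "G x = (G x * inverse (V x)) * (V x * indicator Q0 x)" by (metis mult.assoc mult.commute mult_1)
        qed
        also have "\<dots> \<le> L * Lpn lebesgue b (\<lambda>x. V x * indicator Q0 x)"
          unfolding L_def using ex by (intro Lpn_holder) auto
        also have "Lpn lebesgue b (\<lambda>x. V x * indicator Q0 x) = ?Q powe (1 / b) * Lpn (unif Q0) b V"
          by (rule Lpn_restrict[OF V Q0 ex(6)])
        also have "\<dots> \<le> ?Q powe (1 / b) * Lpn (unif Q0) \<sigma> V"
          using ex b\<sigma> by (intro mult_left_mono Lpn_Jensen emeasure_unif_1[OF Q0]) auto
        also have "\<dots> = ?Q powe (1 / p - 1 / q) * (?Q powe (1 / \<sigma>) * Lpn (unif Q0) \<sigma> V)"
          unfolding ex(12) by (simp only: powe_add mult_ac)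
        also have "?Q powe (1 / \<sigma>) * Lpn (unif Q0) \<sigma> V = Lpn lebesgue \<sigma> (\<lambda>x. V x * indicator Q0 x)"
          by (rule Lpn_restrict[OF V Q0 ex(7), symmetric])
        also note rev
        finally show ?thesis by (simp add: mult_left_mono)
      qed
      \<comment> \<open>all powers of the volume of \<open>A k\<close> cancel\<close>
      have e: "1 + (- 1 / q + (- 1 / t + 1 / \<sigma>)) = 0" using ex(10-12) by simp
      have "(\<integral>\<^sup>+x. S2 k x \<partial>lebesgue) = ennreal \<kappa> * (Lpn (unif (A k)) r F * Lpn (unif (A k)) t G) * ?A"
        unfolding S2_def by (rule nn_integral_cmult_indicator) measurable
      also have "\<dots> \<le> ennreal \<kappa> * ((?A powe (- 1 / q) * N * ?X) *
         (?A powe (- 1 / t) * (L * (?Q powe (1 / p - 1 / q) * (ennreal \<eta> ^ k * (?A powe (1 / \<sigma>) * ?Y)))))) * ?A"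
        by (intro mult_left_mono mult_right_mono mult_mono f g) auto
      also have "\<dots> = ennreal \<kappa> * (?X * ?Y) * (?Q powe (1 / p - 1 / q) * N * L) * ennreal \<eta> ^ k * (?A powe 1 * (?A powe (- 1 / q) * (?A powe (- 1 / t) * ?A powe (1 / \<sigma>))))"
        by (simp only: mult_ac powe_one)
      also have "?A powe 1 * (?A powe (- 1 / q) * (?A powe (- 1 / t) * ?A powe (1 / \<sigma>))) = 1"
        unfolding powe_add[symmetric] e by (rule powe_0_exp[OF mA])
      also have "ennreal \<kappa> * (?X * ?Y) * (?Q powe (1 / p - 1 / q) * N * L) * ennreal \<eta> ^ k * 1
          \<le> ennreal \<kappa> * ennreal K * (?Q powe (1 / p - 1 / q) * N * L) * ennreal \<eta> ^ k * 1"
        by (intro mult_left_mono mult_right_mono XY) auto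
      also have "\<dots> = ennreal (\<kappa> * K) * R * ennreal \<eta> ^ k"
        using \<kappa> K by (simp add: R_def ennreal_mult)
      finally show ?thesis .
    qed

    have "maximal_form r t F G
        \<le> (\<integral>\<^sup>+x. S1 x + (\<Sum>k. S2 k x) \<partial>lebesgue)"
      by (intro nn_integral_mono pointwise)
    also have "\<dots> = (\<integral>\<^sup>+x. S1 x \<partial>lebesgue) + (\<Sum>k. \<integral>\<^sup>+x. S2 k x \<partial>lebesgue)"
      by (subst nn_integral_add; (subst nn_integral_suminf)?; simp?; measurable?)
    also have "\<dots> \<le> ennreal D1 * R + (\<Sum>k. ennreal (\<kappa> * K) * R * ennreal \<eta> ^ k)"
      by (intro add_mono int1 suminf_le int2) auto
    also have "(\<Sum>k. ennreal (\<kappa> * K) * R * ennreal \<eta> ^ k) = ennreal D2 * R"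
    proof -
      have "(\<Sum>k. ennreal (\<kappa> * K) * R * ennreal \<eta> ^ k) = ennreal (\<kappa> * K) * R * ennreal (1 / (1 - \<eta>))"
        using \<eta> by (simp add: suminf_geometric_ennreal)
      also have "\<dots> = (ennreal (\<kappa> * K) * ennreal (1 / (1 - \<eta>))) * R" by (simp only: mult_ac)
      also have "ennreal (\<kappa> * K) * ennreal (1 / (1 - \<eta>)) = ennreal D2"
        unfolding D2_def using \<kappa> K \<eta> by (simp flip: ennreal_mult)
      finally show ?thesis .
    qed
    also have "ennreal D1 * R + ennreal D2 * R = ennreal (D1 + D2) * R"
      using D12 by (simp add: distrib_right)
    finally show "maximal_form r t F G
      \<le> ennreal (D1 + D2) * (vol (qbox z l) powe (1 / p - 1 / q) * morrey p q (\<lambda>x. F x * V x)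
            * Lpn lebesgue p' (\<lambda>x. G x * inverse (V x)))"
      unfolding R_def N_def L_def Q0_def .
  qed
qed

section \<open>Norms, the weight constant, and duality\<close>

lemma Lp_norm_eq: "Lp_norm p f = Lpn lebesgue p (\<lambda>x. ennreal (norm (f x)))"
  by (simp add: Lp_norm_def Lpn_def)

lemma measure_cube_powr: "Q \<in> cubes \<Longrightarrow> ennreal (measure lebesgue Q powr e) = vol Q powe e"
  using emeasure_cube_finite[of Q] by (subst emeasure_eq_ennreal_measure) auto

lemma cube_avg_eq:
  assumes [measurable]: "f \<in> borel_measurable lebesgue" and Q: "Q \<in> cubes" and p: "0 < p"
  shows "cube_avg p Q f = Lpn (unif Q) p (\<lambda>x. ennreal (norm (f x)))"
proof -
  have "(\<lambda>x. ennreal (norm (indicator Q x *\<^sub>R f x))) = (\<lambda>x. ennreal (norm (f x)) * indicator Q x)"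
    by (auto simp: fun_eq_iff indicator_def)
  then show ?thesis
    using Q p by (subst Lpn_unif) (auto simp: cube_avg_def Lp_norm_eq measure_cube_powr)
qed

lemma bilinear_max_eq:
  assumes [measurable]: "f \<in> borel_measurable lebesgue" "g \<in> borel_measurable lebesgue" and "0 < r" "0 < t"
  shows "bilinear_max r t f g x = (SUP Q\<in>cubes. Lpn (unif Q) r (\<lambda>x. ennreal (norm (f x))) *
     Lpn (unif Q) t (\<lambda>x. ennreal (norm (g x))) * indicator Q x)"
  unfolding bilinear_max_def using assms by (intro SUP_cong) (auto simp: cube_avg_eq)

text \<open>A weight is positive only almost everywhere, so scalar multiplication by \<open>v\<close> and multiplication of the
  norm by \<open>ennreal (v x)\<close> may differ on a null set.\<close>

lemma norm_weight_AE:
  assumes "weight v"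
  shows "AE x in lebesgue. ennreal (norm (v x *\<^sub>R f x)) = ennreal (norm (f x)) * ennreal (v x)"
proof -
  have "AE x in lebesgue. 0 < v x" using assms by (simp add: weight_def)
  then show ?thesis by eventually_elim (simp add: ennreal_mult'' mult.commute)
qed

lemma morrey_norm_eq:
  fixes f :: "real ^ 'd \<Rightarrow> 'b::{real_normed_vector, second_countable_topology}"
  assumes v: "weight v" and [measurable]: "f \<in> borel_measurable lebesgue" and p: "0 < p"
  shows "morrey_norm p q v f = morrey p q (\<lambda>x. ennreal (norm (f x)) * ennreal (v x))"
proof -
  have [measurable]: "v \<in> borel_measurable lebesgue" using v by (simp add: weight_def)
  have "cube_avg p Q (\<lambda>x. v x *\<^sub>R f x) = Lpn (unif Q) p (\<lambda>x. ennreal (norm (f x)) * ennreal (v x))"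
    if Q: "Q \<in> cubes" for Q
  proof -
    have "cube_avg p Q (\<lambda>x. v x *\<^sub>R f x) = Lpn (unif Q) p (\<lambda>x. ennreal (norm (v x *\<^sub>R f x)))"
      by (rule cube_avg_eq[OF _ Q p]) measurable
    also have "\<dots> = Lpn (unif Q) p (\<lambda>x. ennreal (norm (f x)) * ennreal (v x))"
      by (intro Lpn_cong_AE AE_unif[OF Q] norm_weight_AE v)
    finally show ?thesis .
  qed
  then show ?thesis
    unfolding morrey_norm_def morrey_def by (intro SUP_cong) (auto simp: measure_cube_powr)
qed

text \<open>Dividing the two norms by the right powers of the volume turns them into power means, and the total
  power is the one in the weight condition. As both means are positive, finiteness of the product makes
  each of them finite. The summand 1 makes the constant positive.\<close>

lemma weight_const_muckenhoupt:
  fixes v :: "real ^ 'd \<Rightarrow> real"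
  assumes v: "weight v" and W: "weight_const r s p q v < top"
    and a: "a = 1 / (1 / r - 1 / p)" "0 < a" and \<sigma>: "\<sigma> = 1 / (1 / q - recip s)" "0 < \<sigma>"
  shows "muckenhoupt a \<sigma> (enn2real (weight_const r s p q v) + 1) (\<lambda>x. ennreal (v x))"
  unfolding muckenhoupt_iff
proof (intro conjI ballI)
  have vm[measurable]: "v \<in> borel_measurable lebesgue" and vpos: "AE x in lebesgue. 0 < v x"
    using v by (auto simp: weight_def)
  show "(\<lambda>x. ennreal (v x)) \<in> borel_measurable lebesgue" by measurable
  show "AE x in lebesgue. 0 < ennreal (v x) \<and> ennreal (v x) < top"
    using vpos by eventually_elim simp
  fix Q :: "(real ^ 'd) set" assume Q: "Q \<in> cubes"
  let ?X = "Lpn (unif Q) a (\<lambda>x. inverse (ennreal (v x)))" and ?Y = "Lpn (unif Q) \<sigma> (\<lambda>x. ennreal (v x))"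
  let ?m = "vol Q"
  have Y: "Lp_norm \<sigma> (\<lambda>x. indicator Q x *\<^sub>R v x) = ?m powe (1 / \<sigma>) * ?Y"
  proof -
    have "Lp_norm \<sigma> (\<lambda>x. indicator Q x *\<^sub>R v x) = Lpn lebesgue \<sigma> (\<lambda>x. ennreal (v x) * indicator Q x)"
      unfolding Lp_norm_eq
      by (intro Lpn_cong_AE eventually_mono[OF vpos]) (auto simp: indicator_def)
    then show ?thesis using Lpn_restrict[OF _ Q \<sigma>(2), of "\<lambda>x. ennreal (v x)"] by simp
  qed
  have X: "Lp_norm a (\<lambda>x. indicator Q x *\<^sub>R inverse (v x)) = ?m powe (1 / a) * ?X"
  proof -
    have "Lp_norm a (\<lambda>x. indicator Q x *\<^sub>R inverse (v x)) = Lpn lebesgue a (\<lambda>x. inverse (ennreal (v x)) * indicator Q x)"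
      unfolding Lp_norm_eq
      by (intro Lpn_cong_AE eventually_mono[OF vpos]) (auto simp: indicator_def inverse_ennreal)
    then show ?thesis using Lpn_restrict[OF _ Q a(2), of "\<lambda>x. inverse (ennreal (v x))"] by simp
  qed
  have e: "1 / r - recip s + 1 / q - 1 / p = 1 / a + 1 / \<sigma>" by (simp add: a(1) \<sigma>(1))
  have "ennreal (measure lebesgue Q powr (- (1 / r - recip s + 1 / q - 1 / p))) *
        Lp_norm \<sigma> (\<lambda>x. indicator Q x *\<^sub>R v x) * Lp_norm a (\<lambda>x. indicator Q x *\<^sub>R inverse (v x))
      \<le> weight_const r s p q v"
    unfolding weight_const_def a(1) \<sigma>(1) by (rule SUP_upper[OF Q])
  also have "ennreal (measure lebesgue Q powr (- (1 / r - recip s + 1 / q - 1 / p))) *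
        Lp_norm \<sigma> (\<lambda>x. indicator Q x *\<^sub>R v x) * Lp_norm a (\<lambda>x. indicator Q x *\<^sub>R inverse (v x))
      = (?m powe (1 / a + 1 / \<sigma>) * (?m powe (- (1 / a + 1 / \<sigma>)) * (?X * ?Y)))"
    unfolding X Y e measure_cube_powr[OF Q] by (simp only: powe_add mult_ac)
  also have "\<dots> = ?X * ?Y"
    by (rule powe_neg_cancel[OF emeasure_cube_pos[OF Q] emeasure_cube_finite[OF Q]])
  finally have XY: "?X * ?Y \<le> weight_const r s p q v" .
  also have "\<dots> \<le> ennreal (enn2real (weight_const r s p q v) + 1)"
    using W by (simp add: ennreal_plus)
  finally show "?X * ?Y \<le> ennreal (enn2real (weight_const r s p q v) + 1)" .
  have pos: "0 < (avg Q (\<lambda>x. inverse (ennreal (v x)) powe a))" "0 < (avg Q (\<lambda>x. ennreal (v x) powe \<sigma>))"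
    by (rule nn_integral_unif_pos[OF _ Q]; (measurable; fail)?;
        rule eventually_mono[OF vpos]; auto simp: zero_less_iff_neq_zero ennreal_eq_0_iff)+
  then show "0 < (avg Q (\<lambda>x. inverse (ennreal (v x)) powe a))" "0 < (avg Q (\<lambda>x. ennreal (v x) powe \<sigma>))" by auto
  have "0 < ?X" "0 < ?Y" using pos by (auto simp: Lpn_def zero_less_iff_neq_zero)
  moreover have "?X * ?Y < top" using XY W by (rule le_less_trans)
  ultimately have "?X < top" "?Y < top" by (auto simp: ennreal_mult_less_top)
  then show "(avg Q (\<lambda>x. inverse (ennreal (v x)) powe a)) < top" "(avg Q (\<lambda>x. ennreal (v x) powe \<sigma>)) < top"
    by (auto simp: Lpn_def)
qed

lemma Linf_cI:
  assumes "f \<in> borel_measurable lebesgue" "\<And>x. norm (f x) \<le> B" "\<And>x. R < norm x \<Longrightarrow> f x = 0"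
  shows "f \<in> Linf_c"
proof -
  have "AE x in lebesgue. norm (f x) \<le> B" "AE x in lebesgue. x \<notin> cball 0 R \<longrightarrow> f x = 0"
    using assms(2,3) by (auto simp: dist_norm)
  then show ?thesis using assms(1) compact_cball unfolding Linf_c_def by blast
qed

text \<open>The usual extremal test function \<open>(h v)\<^sup>p\<^sup>-\<^sup>1 v\<close> is neither bounded nor compactly supported, and the
  left-hand side is not known to be finite. Restricting it to the sets \<open>A n\<close> repairs both: the integral
  over \<open>A n\<close> is finite, so one of its powers can be cancelled, and monotone convergence concludes.\<close>

theorem Lpn_le_by_duality:
  fixes h v :: "real ^ 'd \<Rightarrow> real"
  assumes h[measurable]: "h \<in> borel_measurable lebesgue" "\<And>x. 0 \<le> h x" and v: "weight v"
    and S[measurable]: "S \<in> sets lebesgue" and p: "1 < p" "0 < p'" "1 / p + 1 / p' = 1"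
    and le: "\<And>g :: real ^ 'd \<Rightarrow> 'k::{real_normed_field, euclidean_space}. g \<in> Linf_c \<Longrightarrow> (\<forall>x. x \<notin> S \<longrightarrow> g x = 0) \<Longrightarrow>
      (\<integral>\<^sup>+x. ennreal (h x) * ennreal (norm (g x)) \<partial>lebesgue)
        \<le> B * Lpn lebesgue p' (\<lambda>x. ennreal (norm (g x)) * inverse (ennreal (v x)))"
  shows "Lpn lebesgue p (\<lambda>x. ennreal (h x) * ennreal (v x) * indicator S x) \<le> B"
proof -
  have [measurable]: "v \<in> borel_measurable lebesgue" and vpos: "AE x in lebesgue. 0 < v x"
    using v by (auto simp: weight_def)
  \<comment> \<open>on \<open>A n\<close> the test function is bounded, and \<open>A n\<close> is bounded; these sets exhaust \<open>S\<close> up to a null set\<close>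
  define A where "A n = {x \<in> S. norm x \<le> real n \<and> 0 < v x \<and> v x \<le> real n \<and> h x \<le> real n}" for n
  have [measurable]: "A n \<in> sets lebesgue" for n
  proof -
    have "{x. norm x \<le> real n} = cball (0 :: real ^ 'd) (real n)" by (auto simp: dist_norm)
    then have "{x :: real ^ 'd. norm x \<le> real n} \<in> sets lebesgue" by (metis lborelD borel_closed closed_cball sets_completionI_sets)
    then have "S \<inter> {x. norm x \<le> real n} \<inter> {x \<in> space lebesgue. 0 < v x \<and> v x \<le> real n \<and> h x \<le> real n} \<in> sets lebesgue"
      by measurable
    moreover have "A n = S \<inter> {x. norm x \<le> real n} \<inter> {x \<in> space lebesgue. 0 < v x \<and> v x \<le> real n \<and> h x \<le> real n}"
      by (auto simp: A_def)
    ultimately show ?thesis by simp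
  qed
  define I where "I n = (\<integral>\<^sup>+x. ennreal ((h x * v x) powr p) * indicator (A n) x \<partial>lebesgue)" for n
  have bound: "I n \<le> B powe p" for n
  proof -
    define g :: "real ^ 'd \<Rightarrow> 'k" where "g x = of_real (indicator (A n) x * ((h x * v x) powr (p - 1) * v x))" for x
    have gm[measurable]: "g \<in> borel_measurable lebesgue" unfolding g_def by measurable
    have ng: "norm (g x) = indicator (A n) x * ((h x * v x) powr (p - 1) * v x)" for x
      unfolding g_def norm_of_real by (auto simp: A_def indicator_def)
    have gb: "norm (g x) \<le> (real n * real n) powr (p - 1) * real n" for x
      unfolding ng using p h(2)
      by (auto simp: A_def indicator_def intro!: mult_mono powr_mono2)
    have "g \<in> Linf_c"
      by (rule Linf_cI[OF gm gb, where R = "real n"]) (simp add: g_def A_def)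
    moreover have "\<forall>x. x \<notin> S \<longrightarrow> g x = 0" by (simp add: g_def A_def)
    ultimately have "(\<integral>\<^sup>+x. ennreal (h x) * ennreal (norm (g x)) \<partial>lebesgue)
        \<le> B * Lpn lebesgue p' (\<lambda>x. ennreal (norm (g x)) * inverse (ennreal (v x)))"
      by (rule le)
    also have "(\<integral>\<^sup>+x. ennreal (h x) * ennreal (norm (g x)) \<partial>lebesgue) = I n"
      unfolding I_def
    proof (intro nn_integral_cong)
      fix x
      have "h x * ((h x * v x) powr (p - 1) * v x) = (h x * v x) powr p" if "x \<in> A n"
        using that h(2)[of x] powr_add[of "h x * v x" 1 "p - 1"]
        by (cases "h x = 0") (auto simp: A_def mult_ac)
      then show "ennreal (h x) * ennreal (norm (g x)) = ennreal ((h x * v x) powr p) * indicator (A n) x"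
        unfolding ng using h(2)[of x] by (auto simp: indicator_def simp flip: ennreal_mult')
    qed
    also have "Lpn lebesgue p' (\<lambda>x. ennreal (norm (g x)) * inverse (ennreal (v x))) = I n powe (1 / p')"
      unfolding Lpn_def I_def
    proof (intro arg_cong[where f = "\<lambda>x. x powe _"] nn_integral_cong)
      fix x
      have "p' * (p - 1) = p" using p by (simp add: field_simps)
      moreover have "ennreal ((h x * v x) powr (p - 1) * v x) * inverse (ennreal (v x)) = ennreal ((h x * v x) powr (p - 1))" if "x \<in> A n"
        using that by (auto simp: A_def inverse_ennreal simp flip: ennreal_mult)
      ultimately show "(ennreal (norm (g x)) * inverse (ennreal (v x))) powe p' = ennreal ((h x * v x) powr p) * indicator (A n) x"
        unfolding ng by (auto simp: indicator_def powr_powr mult.commute)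
    qed
    finally have In: "I n \<le> B * I n powe (1 / p')" .
    have "I n \<le> (\<integral>\<^sup>+x. ennreal ((real n * real n) powr p) * indicator (cball (0 :: real ^ 'd) (real n)) x \<partial>lebesgue)"
      unfolding I_def using p h(2)
      by (intro nn_integral_mono) (auto simp: A_def indicator_def intro!: ennreal_leI mult_mono powr_mono2)
    also have "\<dots> = ennreal ((real n * real n) powr p) * vol (cball (0 :: real ^ 'd) (real n))"
      by (rule nn_integral_cmult_indicator) auto
    also have "\<dots> < top"
      using emeasure_bounded_finite[OF bounded_cball, of "0 :: real ^ 'd" "real n"]
      by (simp add: ennreal_mult_less_top emeasure_completion)
    finally have fin: "I n < top" .
    show ?thesis
    proof (cases "I n = 0")
      case False
      have "I n powe (1 / p') * I n powe (1 / p) = I n"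
        using powe_add[of "I n" "1 / p'" "1 / p"] p(3) by (simp add: add.commute)
      then have "I n powe (1 / p') * I n powe (1 / p) \<le> I n powe (1 / p') * B"
        using In by (simp add: mult.commute)
      then have "I n powe (1 / p) \<le> B"
        using False fin by (subst (asm) ennreal_mult_le_mult_iff) auto
      then show ?thesis using p by (subst (asm) powe_le_swap) auto
    qed simp
  qed
  have "(\<integral>\<^sup>+x. (ennreal (h x) * ennreal (v x) * indicator S x) powe p \<partial>lebesgue)
      \<le> (\<integral>\<^sup>+x. (SUP n. ennreal ((h x * v x) powr p) * indicator (A n) x) \<partial>lebesgue)"
  proof (intro nn_integral_mono_AE eventually_mono[OF vpos])
    fix x assume vx: "0 < v x"
    obtain n where n: "max (norm x) (max (v x) (h x)) \<le> real n" using real_arch_simple by blast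
    show "(ennreal (h x) * ennreal (v x) * indicator S x) powe p \<le> (SUP n. ennreal ((h x * v x) powr p) * indicator (A n) x)"
    proof (cases "x \<in> S")
      case True
      then have "x \<in> A n" using n vx by (auto simp: A_def)
      then have "(ennreal (h x) * ennreal (v x) * indicator S x) powe p = ennreal ((h x * v x) powr p) * indicator (A n) x"
        using True vx h(2)[of x] by (simp flip: ennreal_mult)
      also have "\<dots> \<le> (SUP n. ennreal ((h x * v x) powr p) * indicator (A n) x)" by (rule SUP_upper) simp
      finally show ?thesis .
    qed simp
  qed
  also have "\<dots> = (SUP n. I n)"
    unfolding I_def
  proof (intro nn_integral_monotone_convergence_SUP)
    show "incseq (\<lambda>n x. ennreal ((h x * v x) powr p) * indicator (A n) x)"
      by (auto simp: incseq_def le_fun_def A_def indicator_def)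
  qed measurable
  also have "\<dots> \<le> B powe p" by (intro SUP_least bound)
  finally show ?thesis
    unfolding Lpn_def using p by (subst powe_le_swap) auto
qed

section \<open>Extension of operators by fast approximation\<close>

text \<open>The \<open>q\<close>-th power of the distance in the weighted space. For limits the power is harmless, and its
  integral form makes sums and limits directly accessible.\<close>

definition weighted_dist :: "real \<Rightarrow> (real ^ 'd \<Rightarrow> real) \<Rightarrow> (real ^ 'd \<Rightarrow> 'b::real_normed_vector) \<Rightarrow> (real ^ 'd \<Rightarrow> 'b) \<Rightarrow> ennreal" where
  "weighted_dist q v f g = (\<integral>\<^sup>+x. (ennreal (norm (f x - g x)) * ennreal (v x)) powe q \<partial>lebesgue)"

text \<open>Approximation with distances of order \<open>4\<^sup>-\<^sup>k\<close>. This is fast enough for the images under an operator that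
  is Lipschitz in the weighted norm to converge almost everywhere along the whole sequence, and the
  class of such sequences is closed under sums and multiples; so the algebraic laws of an extended
  operator can be read off pointwise.\<close>

definition fast_approx :: "real \<Rightarrow> (real ^ 'd \<Rightarrow> real) \<Rightarrow> (real ^ 'd \<Rightarrow> 'b::real_normed_vector) \<Rightarrow> (nat \<Rightarrow> real ^ 'd \<Rightarrow> 'b) \<Rightarrow> bool" where
  "fast_approx q v f \<xi> \<longleftrightarrow> (\<forall>k. \<xi> k \<in> Linf_c) \<and> (\<exists>B<top. \<forall>k. weighted_dist q v f (\<xi> k) \<le> B * ennreal (4 powr (- q)) ^ k)"

lemma weighted_dist_sym: "weighted_dist q v f g = weighted_dist q v g f"
  by (simp add: weighted_dist_def norm_minus_commute)

lemma powe_add_norm_le: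
  assumes "0 < q" "norm x \<le> norm y + norm z"
  shows "(ennreal (norm x) * V) powe q \<le> 2 powe q * ((ennreal (norm y) * V) powe q + (ennreal (norm z) * V) powe q)"
proof -
  have "ennreal (norm x) * V \<le> ennreal (norm y) * V + ennreal (norm z) * V"
    using assms(2) by (subst distrib_right[symmetric]) (intro mult_right_mono, auto simp flip: ennreal_plus intro: ennreal_leI)
  then have "(ennreal (norm x) * V) powe q \<le> (ennreal (norm y) * V + ennreal (norm z) * V) powe q"
    using assms(1) by (intro powe_mono) auto
  also have "\<dots> \<le> 2 powe q * ((ennreal (norm y) * V) powe q + (ennreal (norm z) * V) powe q)"
    by (rule powe_add_le[OF assms(1)])
  finally show ?thesis .
qed

lemma weighted_dist_add_le:
  fixes f g :: "real ^ 'd \<Rightarrow> 'b::{real_normed_vector, second_countable_topology}"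
  assumes [measurable]: "f \<in> borel_measurable lebesgue" "f' \<in> borel_measurable lebesgue"
      "g \<in> borel_measurable lebesgue" "g' \<in> borel_measurable lebesgue" "v \<in> borel_measurable lebesgue"
    and q: "0 < q" and le: "\<And>x. norm (u x - u' x) \<le> norm (f x - f' x) + norm (g x - g' x)"
  shows "weighted_dist q v u u' \<le> 2 powe q * (weighted_dist q v f f' + weighted_dist q v g g')"
proof -
  have "weighted_dist q v u u' \<le> (\<integral>\<^sup>+x. 2 powe q * ((ennreal (norm (f x - f' x)) * ennreal (v x)) powe q + (ennreal (norm (g x - g' x)) * ennreal (v x)) powe q) \<partial>lebesgue)"
    unfolding weighted_dist_def by (intro nn_integral_mono powe_add_norm_le q le)
  also have "\<dots> = 2 powe q * (weighted_dist q v f f' + weighted_dist q v g g')"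
    unfolding weighted_dist_def by (subst nn_integral_cmult; (subst nn_integral_add)?; measurable?; simp?)
  finally show ?thesis .
qed

lemma Linf_c_measurable: "f \<in> Linf_c \<Longrightarrow> f \<in> borel_measurable lebesgue"
  by (simp add: Linf_c_def)

lemma Linf_c_add:
  fixes f g :: "real ^ 'd \<Rightarrow> 'b::{real_normed_vector, second_countable_topology}"
  assumes "f \<in> Linf_c" "g \<in> Linf_c" shows "(\<lambda>x. f x + g x) \<in> Linf_c"
proof -
  obtain B B' K K' where B: "AE x in lebesgue. norm (f x) \<le> B" "AE x in lebesgue. norm (g x) \<le> B'"
    and K: "compact K" "compact K'" "AE x in lebesgue. x \<notin> K \<longrightarrow> f x = 0" "AE x in lebesgue. x \<notin> K' \<longrightarrow> g x = 0"
    and [measurable]: "f \<in> borel_measurable lebesgue" "g \<in> borel_measurable lebesgue"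
    using assms by (auto simp: Linf_c_def)
  have "AE x in lebesgue. norm (f x + g x) \<le> B + B'"
    using B by eventually_elim (meson norm_triangle_ineq add_mono order_trans)
  moreover have "AE x in lebesgue. x \<notin> K \<union> K' \<longrightarrow> f x + g x = 0"
    using K(3,4) by eventually_elim auto
  ultimately show ?thesis
    unfolding Linf_c_def using compact_Un[OF K(1,2)] by auto
qed

lemma Linf_c_cmult:
  fixes f :: "real ^ 'd \<Rightarrow> 'k::{real_normed_field, euclidean_space}"
  assumes "f \<in> Linf_c" shows "(\<lambda>x. c * f x) \<in> Linf_c"
proof -
  obtain B K where B: "AE x in lebesgue. norm (f x) \<le> B"
    and K: "compact K" "AE x in lebesgue. x \<notin> K \<longrightarrow> f x = 0"
    and [measurable]: "f \<in> borel_measurable lebesgue"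
    using assms by (auto simp: Linf_c_def)
  have "AE x in lebesgue. norm (c * f x) \<le> norm c * B"
    using B by eventually_elim (simp add: norm_mult mult_left_mono)
  moreover have "AE x in lebesgue. x \<notin> K \<longrightarrow> c * f x = 0"
    using K(2) by eventually_elim auto
  ultimately show ?thesis
    unfolding Linf_c_def using K(1) by (auto intro!: borel_measurable_times)
qed

lemma fast_approx_Suc: "fast_approx q v f \<xi> \<Longrightarrow> fast_approx q v f (\<lambda>k. \<xi> (Suc k))"
proof -
  assume "fast_approx q v f \<xi>"
  then obtain B where B: "B < top" "\<And>k. weighted_dist q v f (\<xi> k) \<le> B * ennreal (4 powr (- q)) ^ k" and X: "\<And>k. \<xi> k \<in> Linf_c"
    by (auto simp: fast_approx_def)
  have "weighted_dist q v f (\<xi> (Suc k)) \<le> (B * ennreal (4 powr (- q))) * ennreal (4 powr (- q)) ^ k" for k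
    using B(2)[of "Suc k"] by (simp add: mult_ac)
  moreover have "B * ennreal (4 powr (- q)) < top" using B(1) by (simp add: ennreal_mult_less_top)
  ultimately show ?thesis using X by (auto simp: fast_approx_def)
qed

lemma fast_approx_const: "f \<in> Linf_c \<Longrightarrow> 0 < q \<Longrightarrow> fast_approx q v f (\<lambda>_. f)"
  by (auto simp: fast_approx_def weighted_dist_def intro!: exI[of _ 0])

lemma fast_approx_cong_AE:
  assumes "AE x in lebesgue. f x = g x" "fast_approx q v f \<xi>" shows "fast_approx q v g \<xi>"
proof -
  have "weighted_dist q v f (\<xi> k) = weighted_dist q v g (\<xi> k)" for k
    unfolding weighted_dist_def by (intro nn_integral_cong_AE eventually_mono[OF assms(1)]) auto
  then show ?thesis using assms(2) by (simp add: fast_approx_def)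
qed

lemma fast_approx_add:
  fixes f g :: "real ^ 'd \<Rightarrow> 'b::{real_normed_vector, second_countable_topology}"
  assumes "fast_approx q v f \<xi>" "fast_approx q v g \<psi>" and q: "0 < q"
    and m: "f \<in> borel_measurable lebesgue" "g \<in> borel_measurable lebesgue" "v \<in> borel_measurable lebesgue"
  shows "fast_approx q v (\<lambda>x. f x + g x) (\<lambda>k x. \<xi> k x + \<psi> k x)"
proof -
  let ?\<delta> = "ennreal (4 powr (- q))"
  obtain B B' where B: "B < top" "\<And>k. weighted_dist q v f (\<xi> k) \<le> B * ?\<delta> ^ k" and X: "\<And>k. \<xi> k \<in> Linf_c"
    and B': "B' < top" "\<And>k. weighted_dist q v g (\<psi> k) \<le> B' * ?\<delta> ^ k" and X': "\<And>k. \<psi> k \<in> Linf_c"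
    using assms by (auto simp: fast_approx_def)
  have "weighted_dist q v (\<lambda>x. f x + g x) (\<lambda>x. \<xi> k x + \<psi> k x) \<le> (2 powe q * (B + B')) * ?\<delta> ^ k" for k
  proof -
    have "weighted_dist q v (\<lambda>x. f x + g x) (\<lambda>x. \<xi> k x + \<psi> k x) \<le> 2 powe q * (weighted_dist q v f (\<xi> k) + weighted_dist q v g (\<psi> k))"
      using X X' m q by (intro weighted_dist_add_le) (auto intro: Linf_c_measurable norm_diff_triangle_ineq)
    also have "\<dots> \<le> 2 powe q * (B * ?\<delta> ^ k + B' * ?\<delta> ^ k)"
      by (intro mult_left_mono add_mono B B') auto
    finally show ?thesis by (simp add: distrib_right distrib_left mult_ac)
  qed
  moreover have "2 powe q * (B + B') < top" using B(1) B'(1) by (simp add: ennreal_mult_less_top)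
  ultimately show ?thesis using X X' by (auto simp: fast_approx_def intro: Linf_c_add)
qed

lemma fast_approx_cmult:
  fixes f :: "real ^ 'd \<Rightarrow> 'k::{real_normed_field, euclidean_space}"
  assumes "fast_approx q v f \<xi>" and q: "0 < q"
    and [measurable]: "f \<in> borel_measurable lebesgue" "v \<in> borel_measurable lebesgue"
  shows "fast_approx q v (\<lambda>x. c * f x) (\<lambda>k x. c * \<xi> k x)"
proof -
  let ?\<delta> = "ennreal (4 powr (- q))"
  obtain B where B: "B < top" "\<And>k. weighted_dist q v f (\<xi> k) \<le> B * ?\<delta> ^ k" and X: "\<And>k. \<xi> k \<in> Linf_c"
    using assms by (auto simp: fast_approx_def)
  have [measurable]: "\<xi> k \<in> borel_measurable lebesgue" for k using X by (rule Linf_c_measurable)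
  have "weighted_dist q v (\<lambda>x. c * f x) (\<lambda>x. c * \<xi> k x) \<le> (ennreal (norm c) powe q * B) * ?\<delta> ^ k" for k
  proof -
    have "weighted_dist q v (\<lambda>x. c * f x) (\<lambda>x. c * \<xi> k x) =
        (\<integral>\<^sup>+x. ennreal (norm c) powe q * (ennreal (norm (f x - \<xi> k x)) * ennreal (v x)) powe q \<partial>lebesgue)"
      unfolding weighted_dist_def right_diff_distrib[symmetric] norm_mult
      by (intro nn_integral_cong) (simp only: ennreal_mult' norm_ge_zero powe_mult mult.assoc)
    also have "\<dots> = ennreal (norm c) powe q * weighted_dist q v f (\<xi> k)"
      unfolding weighted_dist_def by (rule nn_integral_cmult) measurable
    also have "\<dots> \<le> ennreal (norm c) powe q * (B * ?\<delta> ^ k)" by (intro mult_left_mono B) auto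
    finally show ?thesis by (simp only: mult.assoc)
  qed
  moreover have "ennreal (norm c) powe q * B < top" using B(1) by (simp add: ennreal_mult_less_top)
  ultimately show ?thesis using X by (auto simp: fast_approx_def intro: Linf_c_cmult)
qed

text \<open>Truncate in height and in space, and use dominated convergence.\<close>

lemma fast_approx_exists:
  fixes f :: "real ^ 'd \<Rightarrow> 'b::{real_normed_vector, second_countable_topology}"
  assumes f: "f \<in> Lq_weighted q v" and v: "weight v" and q: "0 < q"
  shows "\<exists>\<xi>. fast_approx q v f \<xi> \<and> (\<forall>k x. norm (\<xi> k x) \<le> norm (f x))"
proof -
  have fm[measurable]: "f \<in> borel_measurable lebesgue" and vm[measurable]: "v \<in> borel_measurable lebesgue"
    using f v by (auto simp: Lq_weighted_def weight_def)
  define w where "w x = (ennreal (norm (f x)) * ennreal (v x)) powe q" for x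
  have [measurable]: "w \<in> borel_measurable lebesgue" unfolding w_def by measurable
  have "Lpn lebesgue q (\<lambda>x. ennreal (norm (f x)) * ennreal (v x)) = Lp_norm q (\<lambda>x. v x *\<^sub>R f x)"
    unfolding Lp_norm_eq by (rule Lpn_cong_AE, rule eventually_mono[OF norm_weight_AE[OF v, of f]], erule sym)
  also have "\<dots> < top" using f by (simp add: Lq_weighted_def)
  finally have wfin: "(\<integral>\<^sup>+x. w x \<partial>lebesgue) < \<infinity>" by (simp add: Lpn_def w_def)
  define A :: "nat \<Rightarrow> (real ^ 'd) set" where "A n = {x. norm x \<le> real n \<and> norm (f x) \<le> real n}" for n
  have [measurable]: "A n \<in> sets lebesgue" for n
  proof -
    have "A n = cball 0 (real n) \<inter> {x \<in> space lebesgue. norm (f x) \<le> real n}" by (auto simp: A_def dist_norm)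
    moreover have "cball (0 :: real ^ 'd) (real n) \<in> sets lebesgue" by simp
    moreover have "{x \<in> space lebesgue. norm (f x) \<le> real n} \<in> sets lebesgue" by measurable
    ultimately show ?thesis by (simp only: sets.Int)
  qed
  \<comment> \<open>\<open>f\<close> truncated in height and in space\<close>
  define \<tau> where "\<tau> n x = (if x \<in> A n then f x else 0)" for n x
  have \<tau>m[measurable]: "\<tau> n \<in> borel_measurable lebesgue" for n unfolding \<tau>_def by measurable
  have \<tau>X: "\<tau> n \<in> Linf_c" for n
    by (rule Linf_cI[OF \<tau>m, of n "real n" "real n"]) (auto simp: \<tau>_def A_def)
  have "(\<lambda>n. \<integral>\<^sup>+x. (ennreal (norm (f x - \<tau> n x)) * ennreal (v x)) powe q \<partial>lebesgue) \<longlonglongrightarrow> (\<integral>\<^sup>+x. 0 \<partial>(lebesgue :: (real ^ 'd) measure))"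
  proof (rule nn_integral_dominated_convergence[where w = w])
    show "AE x in lebesgue. (ennreal (norm (f x - \<tau> n x)) * ennreal (v x)) powe q \<le> w x" for n
      by (auto simp: \<tau>_def w_def)
    show "AE x in lebesgue. (\<lambda>n. (ennreal (norm (f x - \<tau> n x)) * ennreal (v x)) powe q) \<longlonglongrightarrow> 0"
    proof (intro AE_I2 tendsto_eventually)
      fix x
      obtain N where N: "max (norm x) (norm (f x)) \<le> real N" using real_arch_simple by blast
      show "\<forall>\<^sub>F n in sequentially. (ennreal (norm (f x - \<tau> n x)) * ennreal (v x)) powe q = 0"
        using eventually_ge_at_top[of N]
      proof eventually_elim
        case (elim n)
        then have "x \<in> A n" using N by (auto simp: A_def)
        then show ?case by (simp add: \<tau>_def)
      qed
    qed
  qed (use wfin in measurable)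
  then have lim: "(\<lambda>n. weighted_dist q v f (\<tau> n)) \<longlonglongrightarrow> 0" by (simp add: weighted_dist_def)
  have "\<exists>n. weighted_dist q v f (\<tau> n) \<le> ennreal (4 powr (- q)) ^ k" for k
  proof -
    have "ennreal (4 powr (- q)) ^ k = ennreal ((4 powr (- q)) ^ k)" by (rule ennreal_power) simp
    then have "(0::ennreal) < ennreal (4 powr (- q)) ^ k" by simp
    from eventually_happens[OF order_tendstoD(2)[OF lim this]]
    obtain n where "weighted_dist q v f (\<tau> n) < ennreal (4 powr (- q)) ^ k" by auto
    then show ?thesis by (intro exI[of _ n]) simp
  qed
  then obtain n where n: "\<And>k. weighted_dist q v f (\<tau> (n k)) \<le> ennreal (4 powr (- q)) ^ k" by metis
  have "fast_approx q v f (\<lambda>k. \<tau> (n k))"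
    unfolding fast_approx_def using \<tau>X n by (intro conjI allI exI[of _ 1]) auto
  moreover have "\<forall>k x. norm (\<tau> (n k) x) \<le> norm (f x)" by (auto simp: \<tau>_def)
  ultimately show ?thesis by blast
qed

text \<open>The decay leaves room for a factor \<open>2\<^sup>k\<close>: the integral of the sum of \<open>(2\<^sup>k D\<^sub>k v)\<^sup>q\<close> is finite, so almost
  everywhere the terms are bounded and \<open>D\<^sub>k\<close> is dominated by a geometric sequence.\<close>

lemma AE_summable_of_fast_decay:
  fixes D :: "nat \<Rightarrow> real ^ 'd \<Rightarrow> real"
  assumes [measurable]: "\<And>k. D k \<in> borel_measurable lebesgue" and D0: "\<And>k x. 0 \<le> D k x"
    and v: "weight v" and q: "0 < q" and M: "M < top"
    and le: "\<And>k. (\<integral>\<^sup>+x. (ennreal (D k x) * ennreal (v x)) powe q \<partial>lebesgue) \<le> M * ennreal (4 powr (- q)) ^ k"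
  shows "AE x in lebesgue. summable (\<lambda>k. D k x)"
proof -
  have [measurable]: "v \<in> borel_measurable lebesgue" and vpos: "AE x in lebesgue. 0 < v x"
    using v by (auto simp: weight_def)
  define E where "E k x = ennreal (2 powr q) ^ k * (ennreal (D k x) * ennreal (v x)) powe q" for k x
  have [measurable]: "E k \<in> borel_measurable lebesgue" for k unfolding E_def by measurable
  have "(\<integral>\<^sup>+x. (\<Sum>k. E k x) \<partial>lebesgue) = (\<Sum>k. \<integral>\<^sup>+x. E k x \<partial>lebesgue)"
    by (rule nn_integral_suminf) measurable
  also have "\<dots> \<le> (\<Sum>k. M * ennreal (2 powr (- q)) ^ k)"
  proof (intro suminf_le)
    fix k
    have "(\<integral>\<^sup>+x. E k x \<partial>lebesgue) = ennreal (2 powr q) ^ k * (\<integral>\<^sup>+x. (ennreal (D k x) * ennreal (v x)) powe q \<partial>lebesgue)"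
      unfolding E_def by (rule nn_integral_cmult) measurable
    also have "\<dots> \<le> ennreal (2 powr q) ^ k * (M * ennreal (4 powr (- q)) ^ k)"
      by (intro mult_left_mono le) auto
    also have "\<dots> = M * (ennreal (2 powr q) * ennreal (4 powr (- q))) ^ k"
      by (simp only: power_mult_distrib mult_ac)
    also have "ennreal (2 powr q) * ennreal (4 powr (- q)) = ennreal (2 powr (- q))"
    proof -
      have "4 powr (- q) = 2 powr (- q) * 2 powr (- q)" using powr_mult[of 2 2 "- q"] by simp
      then show ?thesis by (simp add: powr_minus field_simps flip: ennreal_mult)
    qed
    finally show "(\<integral>\<^sup>+x. E k x \<partial>lebesgue) \<le> M * ennreal (2 powr (- q)) ^ k" .
  qed auto
  also have "\<dots> = M * ennreal (1 / (1 - 2 powr (- q)))"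
    using q powr_less_mono[of "- q" 0 2] by (subst ennreal_suminf_cmult) (simp add: suminf_geometric_ennreal)
  also have "\<dots> < top" using M by (simp add: ennreal_mult_less_top)
  finally have "AE x in lebesgue. (\<Sum>k. E k x) \<noteq> \<infinity>"
    by (intro nn_integral_noteq_infinite) auto
  then show ?thesis using vpos
  proof eventually_elim
    case (elim x)
    then obtain s where s: "(\<Sum>k. E k x) = ennreal s" "0 \<le> s" by (cases "\<Sum>k. E k x" rule: ennreal_cases) auto
    have "D k x \<le> s powr (1 / q) / v x * (1 / 2) ^ k" for k
    proof -
      have "E k x \<le> ennreal s" unfolding s(1)[symmetric] using sum_le_suminf[of "\<lambda>k. E k x" "{k}"] by simp
      moreover have "E k x = ennreal ((2 ^ k * (D k x * v x)) powr q)"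
      proof -
        have "(2 ^ k) powr q = (2 powr q) ^ k" by (simp add: powr_powr mult.commute flip: powr_realpow)
        then show ?thesis
          unfolding E_def using D0[of k x] elim(2)
          by (simp add: powr_mult ennreal_power flip: ennreal_mult)
      qed
      ultimately have "(2 ^ k * (D k x * v x)) powr q \<le> s" using s by (simp add: ennreal_le_iff)
      then have "((2 ^ k * (D k x * v x)) powr q) powr (1 / q) \<le> s powr (1 / q)"
        using q by (intro powr_mono2) auto
      then have "2 ^ k * (D k x * v x) \<le> s powr (1 / q)"
        using q D0[of k x] elim(2) by (simp add: powr_powr)
      then show ?thesis using elim(2) by (simp add: field_simps power_divide)
    qed
    then have b: "norm (D k x) \<le> s powr (1 / q) / v x * (1 / 2) ^ k" for k
      using D0 by simp
    have "summable (\<lambda>k. s powr (1 / q) / v x * (1 / 2) ^ k)"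
      by (intro summable_mult summable_geometric) simp
    then show "summable (\<lambda>k. D k x)"
      by (rule summable_comparison_test') (rule b)
  qed
qed

text \<open>Used twice: with a shifted copy of one sequence it shows that the images converge, and with two
  sequences that the limit is independent of the choice.\<close>

lemma fast_approx_images_summable:
  fixes S :: "(real ^ 'd \<Rightarrow> 'b::{real_normed_vector, second_countable_topology}) \<Rightarrow> real ^ 'd \<Rightarrow> 'e::euclidean_space"
  assumes Sm: "\<forall>\<phi>\<in>Linf_c. S \<phi> \<in> borel_measurable lebesgue"
    and Lip: "\<forall>\<phi>\<in>Linf_c. \<forall>\<psi>\<in>Linf_c. weighted_dist q v (S \<phi>) (S \<psi>) \<le> ennreal L * weighted_dist q v \<phi> \<psi>"
    and v: "weight v" and q: "0 < q" and f: "f \<in> borel_measurable lebesgue"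
    and \<xi>: "fast_approx q v f \<xi>" and \<psi>: "fast_approx q v f \<psi>"
  shows "AE x in lebesgue. summable (\<lambda>k. norm (S (\<xi> k) x - S (\<psi> k) x))"
proof -
  let ?\<delta> = "ennreal (4 powr (- q))"
  have vm: "v \<in> borel_measurable lebesgue" using v by (simp add: weight_def)
  obtain B B' where B: "B < top" "\<And>k. weighted_dist q v f (\<xi> k) \<le> B * ?\<delta> ^ k" and X: "\<And>k. \<xi> k \<in> Linf_c"
    and B': "B' < top" "\<And>k. weighted_dist q v f (\<psi> k) \<le> B' * ?\<delta> ^ k" and X': "\<And>k. \<psi> k \<in> Linf_c"
    using \<xi> \<psi> by (auto simp: fast_approx_def)
  define M where "M = ennreal L * (2 powe q * (B + B'))"
  show ?thesis
  proof (rule AE_summable_of_fast_decay[OF _ _ v q, where M = M])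
    show "M < top" using B(1) B'(1) by (simp add: M_def ennreal_mult_less_top)
    show "(\<lambda>x. norm (S (\<xi> k) x - S (\<psi> k) x)) \<in> borel_measurable lebesgue" for k
      using Sm[rule_format, OF X, of k] Sm[rule_format, OF X', of k] by measurable
    fix k
    have "(\<integral>\<^sup>+x. (ennreal (norm (S (\<xi> k) x - S (\<psi> k) x)) * ennreal (v x)) powe q \<partial>lebesgue)
        \<le> ennreal L * weighted_dist q v (\<xi> k) (\<psi> k)"
      using Lip[rule_format, OF X X', of k k] by (simp add: weighted_dist_def)
    also have "\<dots> \<le> ennreal L * (2 powe q * (weighted_dist q v (\<xi> k) f + weighted_dist q v f (\<psi> k)))"
    proof -
      have "norm (\<xi> k x - \<psi> k x) \<le> norm (\<xi> k x - f x) + norm (f x - \<psi> k x)" for x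
        using norm_triangle_ineq[of "\<xi> k x - f x" "f x - \<psi> k x"] by simp
      then show ?thesis
        using X X' vm q f by (intro mult_left_mono weighted_dist_add_le) (auto intro: Linf_c_measurable)
    qed
    also have "\<dots> \<le> ennreal L * (2 powe q * (B * ?\<delta> ^ k + B' * ?\<delta> ^ k))"
      unfolding weighted_dist_sym[of q v "\<xi> k" f] by (intro mult_left_mono add_mono B B') auto
    also have "\<dots> = M * ?\<delta> ^ k" by (simp add: M_def distrib_right distrib_left mult_ac)
    finally show "(\<integral>\<^sup>+x. (ennreal (norm (S (\<xi> k) x - S (\<psi> k) x)) * ennreal (v x)) powe q \<partial>lebesgue) \<le> M * ?\<delta> ^ k" .
  qed auto
qed

text \<open>\<open>S\<close> need not be linear, only Lipschitz. It will be an operator \<open>T\<close> itself or the pointwise norm of \<open>T\<close>.\<close>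

lemma fast_approx_limit_exists:
  fixes S :: "(real ^ 'd \<Rightarrow> 'b::{real_normed_vector, second_countable_topology}) \<Rightarrow> real ^ 'd \<Rightarrow> 'e::euclidean_space"
  assumes Sm: "\<forall>\<phi>\<in>Linf_c. S \<phi> \<in> borel_measurable lebesgue"
    and Lip: "\<forall>\<phi>\<in>Linf_c. \<forall>\<psi>\<in>Linf_c. weighted_dist q v (S \<phi>) (S \<psi>) \<le> ennreal L * weighted_dist q v \<phi> \<psi>"
    and v: "weight v" and q: "0 < q"
  shows "\<exists>U. \<forall>f\<in>borel_measurable lebesgue. U f \<in> borel_measurable lebesgue \<and>
    (\<forall>\<xi>. fast_approx q v f \<xi> \<longrightarrow> (AE x in lebesgue. (\<lambda>k. S (\<xi> k) x) \<longlonglongrightarrow> U f x))"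
proof -
  have "\<exists>h. h \<in> borel_measurable lebesgue \<and> (\<forall>\<xi>. fast_approx q v f \<xi> \<longrightarrow> (AE x in lebesgue. (\<lambda>k. S (\<xi> k) x) \<longlonglongrightarrow> h x))"
    if f: "f \<in> borel_measurable lebesgue" for f
  proof (cases "\<exists>\<phi>. fast_approx q v f \<phi>")
    case True
    then obtain \<phi> where \<phi>: "fast_approx q v f \<phi>" by blast
    from this have [measurable]: "S (\<phi> k) \<in> borel_measurable lebesgue" for k using Sm by (auto simp: fast_approx_def)
    define h where "h x = lim (\<lambda>k. S (\<phi> k) x)" for x
    have conv: "AE x in lebesgue. (\<lambda>k. S (\<phi> k) x) \<longlonglongrightarrow> h x"
      using fast_approx_images_summable[OF Sm Lip v q f fast_approx_Suc[OF \<phi>] \<phi>]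
    proof eventually_elim
      case (elim x)
      then have "summable (\<lambda>k. S (\<phi> (Suc k)) x - S (\<phi> k) x)" by (rule summable_norm_cancel)
      then have "convergent (\<lambda>n. S (\<phi> 0) x + (\<Sum>k<n. S (\<phi> (Suc k)) x - S (\<phi> k) x))"
        by (intro convergent_add convergent_const) (simp add: summable_iff_convergent)
      moreover have "S (\<phi> 0) x + (\<Sum>k<n. S (\<phi> (Suc k)) x - S (\<phi> k) x) = S (\<phi> n) x" for n
        using sum_lessThan_telescope[of "\<lambda>k. S (\<phi> k) x" n] by simp
      ultimately show ?case by (simp add: h_def convergent_LIMSEQ_iff)
    qed
    have "AE x in lebesgue. (\<lambda>k. S (\<xi> k) x) \<longlonglongrightarrow> h x" if \<xi>: "fast_approx q v f \<xi>" for \<xi>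
      using conv fast_approx_images_summable[OF Sm Lip v q f \<xi> \<phi>]
    proof eventually_elim
      case (elim x)
      have "(\<lambda>k. S (\<xi> k) x - S (\<phi> k) x) \<longlonglongrightarrow> 0"
        using summable_LIMSEQ_zero[OF elim(2)] by (rule tendsto_norm_zero_cancel)
      from tendsto_add[OF this elim(1)] show ?case by simp
    qed
    moreover have "h \<in> borel_measurable lebesgue" unfolding h_def by measurable
    ultimately show ?thesis by blast
  next
    case False
    then show ?thesis by (intro exI[of _ "\<lambda>_. 0"]) simp
  qed
  then show ?thesis by (intro bchoice) blast
qed

lemma linear_imp_sublinear:
  assumes "linear_operator X T" shows "sublinear_operator X T"
  unfolding sublinear_operator_def
proof (intro conjI ballI allI)
  show "ae_operator X T" using assms by (simp add: linear_operator_def)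
  show "AE x in lebesgue. norm (T (\<lambda>y. f y + g y) x) \<le> norm (T f x) + norm (T g x)" if "f \<in> X" "g \<in> X" for f g
  proof -
    have "AE x in lebesgue. T (\<lambda>y. f y + g y) x = T f x + T g x"
      using assms that by (simp add: linear_operator_def)
    then show ?thesis by eventually_elim (simp add: norm_triangle_ineq)
  qed
  show "AE x in lebesgue. norm (T (\<lambda>y. c * f y) x) = norm c * norm (T f x)" if "f \<in> X" for f c
  proof -
    have "AE x in lebesgue. T (\<lambda>y. c * f y) x = c * T f x"
      using assms that by (simp add: linear_operator_def)
    then show ?thesis by eventually_elim (simp add: norm_mult)
  qed
qed

lemma Linf_c_diff:
  fixes f g :: "real ^ 'd \<Rightarrow> 'k::{real_normed_field, euclidean_space}"
  assumes "f \<in> Linf_c" "g \<in> Linf_c" shows "(\<lambda>x. f x - g x) \<in> Linf_c"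
  using Linf_c_add[OF assms(1) Linf_c_cmult[OF assms(2), of "-1"]] by simp

text \<open>For a sublinear operator only the norm of the image is Lipschitz.\<close>

lemma sublinear_norm_diff_le:
  fixes T :: "(real ^ 'd \<Rightarrow> 'k::{real_normed_field, euclidean_space}) \<Rightarrow> real ^ 'd \<Rightarrow> 'k"
  assumes T: "sublinear_operator Linf_c T" and f: "f \<in> Linf_c" and g: "g \<in> Linf_c"
  shows "AE x in lebesgue. norm (norm (T f x) - norm (T g x)) \<le> norm (T (\<lambda>y. f y - g y) x)"
proof -
  have add: "AE x in lebesgue. norm (T (\<lambda>y. u y + w y) x) \<le> norm (T u x) + norm (T w x)"
    if "u \<in> Linf_c" "w \<in> Linf_c" for u w using T that by (simp add: sublinear_operator_def)
  have hom: "AE x in lebesgue. norm (T (\<lambda>y. c * u y) x) = norm c * norm (T u x)"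
    if "u \<in> Linf_c" for u c using T that by (simp add: sublinear_operator_def)
  have "AE x in lebesgue. norm (T f x) \<le> norm (T (\<lambda>y. f y - g y) x) + norm (T g x)"
    using add[OF Linf_c_diff[OF f g] g] by simp
  moreover have "AE x in lebesgue. norm (T g x) \<le> norm (T (\<lambda>y. g y - f y) x) + norm (T f x)"
    using add[OF Linf_c_diff[OF g f] f] by simp
  moreover have "AE x in lebesgue. norm (T (\<lambda>y. (-1) * (f y - g y)) x) = norm (-1 :: 'k) * norm (T (\<lambda>y. f y - g y) x)"
    by (rule hom[OF Linf_c_diff[OF f g]])
  then have "AE x in lebesgue. norm (T (\<lambda>y. g y - f y) x) = norm (T (\<lambda>y. f y - g y) x)" by simp
  ultimately show ?thesis by eventually_elim (simp add: abs_le_iff)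
qed

text \<open>If \<open>T\<close> is linear, it is Lipschitz and the limits along fast approximations extend it. If it is only
  sublinear, then \<open>T\<close> itself need not have limits, but the norm of \<open>T\<close> does; the laws of a sublinear
  operator only concern this norm, so the limit of the norm serves as the value for functions outside
  \<open>Linf_c\<close>. In both cases the norms converge, which is all that is needed to transfer estimates.\<close>

theorem bounded_operator_extension:
  fixes T :: "(real ^ 'd \<Rightarrow> 'k::{real_normed_field, euclidean_space}) \<Rightarrow> real ^ 'd \<Rightarrow> 'k"
  assumes T: "linear_operator Linf_c T \<or> sublinear_operator Linf_c T"
    and bd: "\<And>\<phi>. \<phi> \<in> Linf_c \<Longrightarrow> (\<integral>\<^sup>+x. (ennreal (norm (T \<phi> x)) * ennreal (v x)) powe q \<partial>lebesgue)
        \<le> ennreal L * (\<integral>\<^sup>+x. (ennreal (norm (\<phi> x)) * ennreal (v x)) powe q \<partial>lebesgue)"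
    and v: "weight v" and q: "0 < q" and XY: "(Linf_c :: (real ^ 'd \<Rightarrow> 'k) set) \<subseteq> Lq_weighted q v"
  shows "\<exists>U. operator_extension Linf_c (Lq_weighted q v) T U \<and>
    (\<forall>f\<in>Lq_weighted q v. \<forall>\<xi>. fast_approx q v f \<xi> \<longrightarrow> (AE x in lebesgue. (\<lambda>k. norm (T (\<xi> k) x)) \<longlonglongrightarrow> norm (U f x)))"
proof -
  let ?X = "Linf_c :: (real ^ 'd \<Rightarrow> 'k) set" and ?Y = "Lq_weighted q v :: (real ^ 'd \<Rightarrow> 'k) set"
  have sub: "sublinear_operator ?X T" using T linear_imp_sublinear by blast
  then have Tm: "T f \<in> borel_measurable lebesgue" if "f \<in> ?X" for f
    using that by (simp add: sublinear_operator_def ae_operator_def)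
  have vm[measurable]: "v \<in> borel_measurable lebesgue" using v by (simp add: weight_def)
  have Ym: "f \<in> borel_measurable lebesgue" if "f \<in> ?Y" for f using that by (simp add: Lq_weighted_def)
  have ex: "\<exists>\<xi>. fast_approx q v f \<xi>" if "f \<in> ?Y" for f using fast_approx_exists[OF that v q] by blast
  have fX: "\<xi> k \<in> ?X" if "fast_approx q v f \<xi>" for f \<xi> k using that by (simp add: fast_approx_def)
  show ?thesis
  proof (cases "linear_operator ?X T")
    case True
    have Tadd: "AE x in lebesgue. T (\<lambda>y. f y + g y) x = T f x + T g x" if "f \<in> ?X" "g \<in> ?X" for f g
      using True that by (simp add: linear_operator_def)
    have Tmul: "AE x in lebesgue. T (\<lambda>y. c * f y) x = c * T f x" if "f \<in> ?X" for f c
      using True that by (simp add: linear_operator_def)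
    have Lip: "\<forall>\<phi>\<in>?X. \<forall>\<psi>\<in>?X. weighted_dist q v (T \<phi>) (T \<psi>) \<le> ennreal L * weighted_dist q v \<phi> \<psi>"
    proof (intro ballI)
      fix \<phi> \<psi> assume X: "\<phi> \<in> ?X" "\<psi> \<in> ?X"
      have "AE x in lebesgue. T \<phi> x = T (\<lambda>y. \<phi> y - \<psi> y) x + T \<psi> x"
        using Tadd[OF Linf_c_diff[OF X] X(2)] by simp
      then have "weighted_dist q v (T \<phi>) (T \<psi>) = (\<integral>\<^sup>+x. (ennreal (norm (T (\<lambda>y. \<phi> y - \<psi> y) x)) * ennreal (v x)) powe q \<partial>lebesgue)"
        unfolding weighted_dist_def by (intro nn_integral_cong_AE) (auto elim: eventually_mono)
      also have "\<dots> \<le> ennreal L * weighted_dist q v \<phi> \<psi>"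
        unfolding weighted_dist_def by (rule bd[OF Linf_c_diff[OF X]])
      finally show "weighted_dist q v (T \<phi>) (T \<psi>) \<le> ennreal L * weighted_dist q v \<phi> \<psi>" .
    qed
    have "\<forall>\<phi>\<in>?X. T \<phi> \<in> borel_measurable lebesgue" using Tm by blast
    from fast_approx_limit_exists[OF this Lip v q] obtain U where
      Um: "\<And>f. f \<in> borel_measurable lebesgue \<Longrightarrow> U f \<in> borel_measurable lebesgue" and
      U: "\<And>f \<xi>. f \<in> borel_measurable lebesgue \<Longrightarrow> fast_approx q v f \<xi> \<Longrightarrow> AE x in lebesgue. (\<lambda>k. T (\<xi> k) x) \<longlonglongrightarrow> U f x"
      by blast
    have "linear_operator ?Y U"
      unfolding linear_operator_def ae_operator_def
    proof (intro conjI ballI allI impI)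
      show "U f \<in> borel_measurable lebesgue" if "f \<in> ?Y" for f using Um Ym that by blast
      show "AE x in lebesgue. U f x = U g x" if fg: "f \<in> ?Y" "g \<in> ?Y" "AE x in lebesgue. f x = g x" for f g
      proof -
        obtain \<xi> where \<xi>: "fast_approx q v f \<xi>" using ex fg by blast
        show ?thesis
          using U[OF Ym[OF fg(1)] \<xi>] U[OF Ym[OF fg(2)] fast_approx_cong_AE[OF fg(3) \<xi>]]
          by eventually_elim (rule LIMSEQ_unique)
      qed
      show "AE x in lebesgue. U (\<lambda>y. f y + g y) x = U f x + U g x" if fg: "f \<in> ?Y" "g \<in> ?Y" for f g
      proof -
        obtain \<xi> \<psi> where \<xi>: "fast_approx q v f \<xi>" and \<psi>: "fast_approx q v g \<psi>" using ex fg by blast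
        have "(\<lambda>y. f y + g y) \<in> borel_measurable lebesgue" using Ym[OF fg(1)] Ym[OF fg(2)] by measurable
        note lim = U[OF this fast_approx_add[OF \<xi> \<psi> q Ym[OF fg(1)] Ym[OF fg(2)] vm]]
        have "AE x in lebesgue. \<forall>k. T (\<lambda>y. \<xi> k y + \<psi> k y) x = T (\<xi> k) x + T (\<psi> k) x"
          unfolding AE_all_countable using Tadd fX[OF \<xi>] fX[OF \<psi>] by blast
        then show ?thesis
          using lim U[OF Ym[OF fg(1)] \<xi>] U[OF Ym[OF fg(2)] \<psi>]
        proof eventually_elim
          case (elim x)
          have "(\<lambda>k. T (\<xi> k) x + T (\<psi> k) x) \<longlonglongrightarrow> U (\<lambda>y. f y + g y) x" using elim(1,2) by simp
          from LIMSEQ_unique[OF this tendsto_add[OF elim(3,4)]] show ?case .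
        qed
      qed
      show "AE x in lebesgue. U (\<lambda>y. c * f y) x = c * U f x" if f: "f \<in> ?Y" for f c
      proof -
        obtain \<xi> where \<xi>: "fast_approx q v f \<xi>" using ex f by blast
        have "(\<lambda>y. c * f y) \<in> borel_measurable lebesgue" using Ym[OF f] by measurable
        note lim = U[OF this fast_approx_cmult[OF \<xi> q Ym[OF f] vm, of c]]
        have "AE x in lebesgue. \<forall>k. T (\<lambda>y. c * \<xi> k y) x = c * T (\<xi> k) x"
          unfolding AE_all_countable using Tmul fX[OF \<xi>] by blast
        then show ?thesis
          using lim U[OF Ym[OF f] \<xi>]
        proof eventually_elim
          case (elim x)
          have "(\<lambda>k. c * T (\<xi> k) x) \<longlonglongrightarrow> U (\<lambda>y. c * f y) x" using elim(1,2) by simp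
          from LIMSEQ_unique[OF this tendsto_mult_left[OF elim(3)]] show ?case .
        qed
      qed
    qed
    moreover have "AE x in lebesgue. U f x = T f x" if f: "f \<in> ?X" for f
      using U[OF Linf_c_measurable[OF f] fast_approx_const[OF f q]]
      by eventually_elim (rule LIMSEQ_unique[OF _ tendsto_const])
    ultimately have "operator_extension ?X ?Y T U"
      using XY linear_imp_sublinear unfolding operator_extension_def by blast
    moreover have "AE x in lebesgue. (\<lambda>k. norm (T (\<xi> k) x)) \<longlonglongrightarrow> norm (U f x)" if "f \<in> ?Y" "fast_approx q v f \<xi>" for f \<xi>
      using U[OF Ym[OF that(1)] that(2)] by eventually_elim (rule tendsto_norm)
    ultimately show ?thesis by blast
  next
    case False
    define S where "S \<phi> x = norm (T \<phi> x)" for \<phi> x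
    have Sm: "\<forall>\<phi>\<in>?X. S \<phi> \<in> borel_measurable lebesgue"
      unfolding S_def using Tm by (auto intro: borel_measurable_norm)
    have Lip: "\<forall>\<phi>\<in>?X. \<forall>\<psi>\<in>?X. weighted_dist q v (S \<phi>) (S \<psi>) \<le> ennreal L * weighted_dist q v \<phi> \<psi>"
    proof (intro ballI)
      fix \<phi> \<psi> assume X: "\<phi> \<in> ?X" "\<psi> \<in> ?X"
      have "weighted_dist q v (S \<phi>) (S \<psi>) \<le> (\<integral>\<^sup>+x. (ennreal (norm (T (\<lambda>y. \<phi> y - \<psi> y) x)) * ennreal (v x)) powe q \<partial>lebesgue)"
        unfolding weighted_dist_def S_def using sublinear_norm_diff_le[OF sub X]
        by (intro nn_integral_mono_AE, eventually_elim)
           (use q in \<open>intro powe_mono mult_right_mono ennreal_leI; simp\<close>)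
      also have "\<dots> \<le> ennreal L * weighted_dist q v \<phi> \<psi>"
        unfolding weighted_dist_def by (rule bd[OF Linf_c_diff[OF X]])
      finally show "weighted_dist q v (S \<phi>) (S \<psi>) \<le> ennreal L * weighted_dist q v \<phi> \<psi>" .
    qed
    from fast_approx_limit_exists[OF Sm Lip v q] obtain N where
      Nm: "\<And>f. f \<in> borel_measurable lebesgue \<Longrightarrow> N f \<in> borel_measurable lebesgue" and
      N: "\<And>f \<xi>. f \<in> borel_measurable lebesgue \<Longrightarrow> fast_approx q v f \<xi> \<Longrightarrow> AE x in lebesgue. (\<lambda>k. norm (T (\<xi> k) x)) \<longlonglongrightarrow> N f x"
      unfolding S_def by blast
    \<comment> \<open>on \<open>Linf_c\<close> the operator has to be kept; elsewhere only the norm of the value matters\<close>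
    define U where "U f = (if f \<in> ?X then T f else (\<lambda>x. of_real (N f x)))" for f
    have normU: "AE x in lebesgue. norm (U f x) = N f x" if f: "f \<in> ?Y" for f
    proof (cases "f \<in> ?X")
      case True
      from N[OF Ym[OF f] fast_approx_const[OF True q]] show ?thesis
        by eventually_elim (simp add: U_def True LIMSEQ_const_iff)
    next
      case False
      obtain \<xi> where \<xi>: "fast_approx q v f \<xi>" using ex f by blast
      from N[OF Ym[OF f] \<xi>] show ?thesis
      proof eventually_elim
        case (elim x)
        then have "0 \<le> N f x" by (rule LIMSEQ_le_const) auto
        then show ?case using False by (simp add: U_def)
      qed
    qed
    have lim: "AE x in lebesgue. (\<lambda>k. norm (T (\<xi> k) x)) \<longlonglongrightarrow> norm (U f x)" if "f \<in> ?Y" "fast_approx q v f \<xi>" for f \<xi>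
      using N[OF Ym[OF that(1)] that(2)] normU[OF that(1)] by eventually_elim simp
    have closed: "(\<lambda>y. f y + g y) \<in> ?Y" if fg: "f \<in> ?Y" "g \<in> ?Y" for f g
    proof -
      have m: "f \<in> borel_measurable lebesgue" "g \<in> borel_measurable lebesgue" using Ym fg by auto
      have fin: "weighted_dist q v h (\<lambda>_. 0) < top \<longleftrightarrow> Lp_norm q (\<lambda>x. v x *\<^sub>R h x) < top" for h :: "real ^ 'd \<Rightarrow> 'k"
      proof -
        have "Lp_norm q (\<lambda>x. v x *\<^sub>R h x) = Lpn lebesgue q (\<lambda>x. ennreal (norm (h x)) * ennreal (v x))"
          unfolding Lp_norm_eq by (rule Lpn_cong_AE[OF norm_weight_AE[OF v, of h]])
        then show ?thesis by (simp add: Lpn_def weighted_dist_def)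
      qed
      have "weighted_dist q v (\<lambda>y. f y + g y) (\<lambda>_. 0) \<le> 2 powe q * (weighted_dist q v f (\<lambda>_. 0) + weighted_dist q v g (\<lambda>_. 0))"
        using m by (intro weighted_dist_add_le vm q) (auto simp: norm_triangle_ineq)
      also have "\<dots> < top"
        using fg fin by (simp add: Lq_weighted_def ennreal_mult_less_top)
      finally show ?thesis using fin m by (simp add: Lq_weighted_def)
    qed
    have closedm: "(\<lambda>y. c * f y) \<in> ?Y" if f: "f \<in> ?Y" for f c
    proof -
      have m[measurable]: "f \<in> borel_measurable lebesgue" using Ym f by auto
      have "Lp_norm q (\<lambda>x. v x *\<^sub>R (c * f x)) = Lpn lebesgue q (\<lambda>x. ennreal (norm c) * ennreal (norm (v x *\<^sub>R f x)))"
        unfolding Lp_norm_eq by (simp add: norm_mult ennreal_mult mult_ac)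
      also have "\<dots> = ennreal (norm c) * Lp_norm q (\<lambda>x. v x *\<^sub>R f x)"
        unfolding Lp_norm_eq by (rule Lpn_cmult[OF _ q]) measurable
      also have "\<dots> < top" using f by (simp add: Lq_weighted_def ennreal_mult_less_top)
      finally show ?thesis by (simp add: Lq_weighted_def)
    qed
    have subadd: "AE x in lebesgue. norm (U (\<lambda>y. f y + g y) x) \<le> norm (U f x) + norm (U g x)" if fg: "f \<in> ?Y" "g \<in> ?Y" for f g
    proof -
      obtain \<xi> \<psi> where \<xi>: "fast_approx q v f \<xi>" and \<psi>: "fast_approx q v g \<psi>" using ex fg by blast
      have "AE x in lebesgue. \<forall>k. norm (T (\<lambda>y. \<xi> k y + \<psi> k y) x) \<le> norm (T (\<xi> k) x) + norm (T (\<psi> k) x)"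
        unfolding AE_all_countable using sub fX[OF \<xi>] fX[OF \<psi>] unfolding sublinear_operator_def by blast
      then show ?thesis
        using lim[OF closed[OF fg] fast_approx_add[OF \<xi> \<psi> q Ym[OF fg(1)] Ym[OF fg(2)] vm]] lim[OF fg(1) \<xi>] lim[OF fg(2) \<psi>]
      proof eventually_elim
        case (elim x)
        show ?case by (rule LIMSEQ_le[OF elim(2) tendsto_add[OF elim(3,4)]]) (use elim(1) in auto)
      qed
    qed
    have homog: "AE x in lebesgue. norm (U (\<lambda>y. c * f y) x) = norm c * norm (U f x)" if f: "f \<in> ?Y" for f c
    proof -
      obtain \<xi> where \<xi>: "fast_approx q v f \<xi>" using ex f by blast
      have "AE x in lebesgue. \<forall>k. norm (T (\<lambda>y. c * \<xi> k y) x) = norm c * norm (T (\<xi> k) x)"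
        unfolding AE_all_countable using sub fX[OF \<xi>] unfolding sublinear_operator_def by blast
      then show ?thesis
        using lim[OF closedm[OF f] fast_approx_cmult[OF \<xi> q Ym[OF f] vm, of c]] lim[OF f \<xi>]
      proof eventually_elim
        case (elim x)
        have "(\<lambda>k. norm c * norm (T (\<xi> k) x)) \<longlonglongrightarrow> norm (U (\<lambda>y. c * f y) x)" using elim(1,2) by simp
        from LIMSEQ_unique[OF this tendsto_mult_left[OF elim(3)]] show ?case .
      qed
    qed
    have aeU: "AE x in lebesgue. U f x = U g x" if fg: "f \<in> ?Y" "g \<in> ?Y" "AE x in lebesgue. f x = g x" for f g
    proof -
      have inX: "g \<in> ?X" if a: "f \<in> ?X" "g \<in> ?Y" "AE x in lebesgue. f x = g x" for f g
      proof -
        obtain B K where B: "AE x in lebesgue. norm (f x) \<le> B" and K: "compact K" "AE x in lebesgue. x \<notin> K \<longrightarrow> f x = 0"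
          using a(1) unfolding Linf_c_def by blast
        have "AE x in lebesgue. norm (g x) \<le> B" using B a(3) by eventually_elim simp
        moreover have "AE x in lebesgue. x \<notin> K \<longrightarrow> g x = 0" using K(2) a(3) by eventually_elim simp
        ultimately show ?thesis using K(1) Ym[OF a(2)] unfolding Linf_c_def by blast
      qed
      have "AE x in lebesgue. g x = f x" using fg(3) by eventually_elim simp
      then have iff: "f \<in> ?X \<longleftrightarrow> g \<in> ?X"
        using inX[OF _ fg(2,3)] inX[OF _ fg(1)] by blast
      show ?thesis
      proof (cases "f \<in> ?X")
        case True
        then show ?thesis using iff fg(3) sub unfolding U_def sublinear_operator_def ae_operator_def by simp
      next
        case False
        obtain \<xi> where \<xi>: "fast_approx q v f \<xi>" using ex fg by blast
        have "AE x in lebesgue. N f x = N g x"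
          using N[OF Ym[OF fg(1)] \<xi>] N[OF Ym[OF fg(2)] fast_approx_cong_AE[OF fg(3) \<xi>]]
          by eventually_elim (rule LIMSEQ_unique)
        then show ?thesis using False iff by (auto simp: U_def)
      qed
    qed
    have Umeas: "U f \<in> borel_measurable lebesgue" if "f \<in> ?Y" for f
      using Nm[OF Ym[OF that]] Tm by (simp add: U_def)
    have "sublinear_operator ?Y U"
      unfolding sublinear_operator_def ae_operator_def using Umeas aeU subadd homog by blast
    then have "operator_extension ?X ?Y T U"
      using XY False unfolding operator_extension_def U_def by simp
    then show ?thesis using lim by blast
  qed
qed

section \<open>The Morrey space bound for the operator\<close>

lemma recip_bounds:
  assumes "ereal q < s" "0 < q" shows "0 \<le> recip s" "recip s < 1 / q"
  using assms by (cases s; simp add: recip_def field_simps one_ereal_def)+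

text \<open>The condition on \<open>V\<close> contains local integrability of \<open>V\<^sup>b\<close>, hence of \<open>V\<^sup>q\<close>.\<close>

lemma Linf_c_subset_Lq_weighted:
  assumes v: "weight v" and M: "muckenhoupt a b K (\<lambda>x. ennreal (v x))" and q: "0 < q" "q \<le> b" "0 < a"
  shows "(Linf_c :: (real ^ 'd \<Rightarrow> 'b::real_normed_vector) set) \<subseteq> Lq_weighted q v"
proof
  fix f :: "real ^ 'd \<Rightarrow> 'b" assume f: "f \<in> Linf_c"
  then obtain B0 K where B0: "AE x in lebesgue. norm (f x) \<le> B0" and K: "compact K" "AE x in lebesgue. x \<notin> K \<longrightarrow> f x = 0"
    and fm[measurable]: "f \<in> borel_measurable lebesgue"
    unfolding Linf_c_def by blast
  have [measurable]: "v \<in> borel_measurable lebesgue" using v by (simp add: weight_def)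
  define B where "B = max B0 0"
  have B: "AE x in lebesgue. norm (f x) \<le> B" "0 \<le> B" using B0 by (auto simp: B_def elim: eventually_mono)
  obtain R where R: "0 < R" "K \<subseteq> cball 0 R" using compact_imp_bounded[OF K(1)] unfolding bounded_pos by (auto simp: subset_iff)
  define Q :: "(real ^ 'd) set" where "Q = qbox (\<chi> i. - R - 1) (2 * R + 2)"
  have Q: "Q \<in> cubes" "cball 0 R \<subseteq> Q"
    unfolding Q_def using R by (auto intro!: qbox_cubes mem_centred_qbox)
  have "muckenhoupt a q K' (\<lambda>x. ennreal (v x))" if "muckenhoupt a b K' (\<lambda>x. ennreal (v x))" for K'
    using that q by (intro muckenhoupt_mono[OF that]) auto
  then have "(avg Q (\<lambda>x. ennreal (v x) powe q)) < top"
    using M Q(1) unfolding muckenhoupt_iff by blast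
  moreover obtain z l where zl: "Q = qbox z l" "0 < l" using Q(1) by (auto simp: cubes_iff)
  ultimately have fin: "(\<integral>\<^sup>+x\<in>Q. ennreal (v x) powe q \<partial>lebesgue) < top"
    unfolding zl(1) using emeasure_qbox_finite[OF zl(2)]
    by (subst set_nn_integral_unif[OF _ zl(2)]) (auto simp: ennreal_mult_less_top)
  have [measurable]: "Q \<in> sets lebesgue" by (rule cubes_lebesgue[OF Q(1)])
  have "(\<integral>\<^sup>+x. (ennreal (norm (f x)) * ennreal (v x)) powe q \<partial>lebesgue)
      \<le> (\<integral>\<^sup>+x. ennreal B powe q * (ennreal (v x) powe q * indicator Q x) \<partial>lebesgue)"
    using B(1) K(2)
  proof (intro nn_integral_mono_AE, eventually_elim)
    case (elim x)
    show ?case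
    proof (cases "x \<in> Q")
      case True
      have "ennreal (norm (f x)) powe q \<le> ennreal B powe q"
        using elim q by (intro powe_mono ennreal_leI) auto
      then show ?thesis unfolding powe_mult using True by (simp add: mult_right_mono)
    next
      case False
      then show ?thesis using elim R Q(2) by auto
    qed
  qed
  also have "\<dots> = ennreal B powe q * (\<integral>\<^sup>+x\<in>Q. ennreal (v x) powe q \<partial>lebesgue)"
    by (rule nn_integral_cmult) measurable
  also have "\<dots> < top" using fin by (simp add: ennreal_mult_less_top)
  finally have "Lpn lebesgue q (\<lambda>x. ennreal (norm (f x)) * ennreal (v x)) < top" by (simp add: Lpn_def)
  also have "Lpn lebesgue q (\<lambda>x. ennreal (norm (f x)) * ennreal (v x)) = Lp_norm q (\<lambda>x. v x *\<^sub>R f x)"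
    unfolding Lp_norm_eq by (rule Lpn_cong_AE, rule eventually_mono[OF norm_weight_AE[OF v, of f]], erule sym)
  finally show "f \<in> Lq_weighted q v" by (simp add: Lq_weighted_def)
qed

lemma Lpn_image_le_by_duality:
  fixes T :: "(real ^ 'd \<Rightarrow> 'k::{real_normed_field, euclidean_space}) \<Rightarrow> real ^ 'd \<Rightarrow> 'k"
  assumes hyp: "\<forall>f\<in>Linf_c. \<forall>g\<in>Linf_c. Lp_norm 1 (\<lambda>x. T f x * g x)
           \<le> ennreal C\<^sub>T * (\<integral>\<^sup>+ x. bilinear_max r t f g x \<partial>lebesgue)"
    and f: "f \<in> Linf_c" and Tf: "T f \<in> borel_measurable lebesgue" and v: "weight v" and S: "S \<in> sets lebesgue"
    and ex: "0 < r" "0 < t" "1 < p" "0 < p'" "1 / p + 1 / p' = 1"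
    and le: "\<And>G. G \<in> borel_measurable lebesgue \<Longrightarrow> (\<forall>x. x \<notin> S \<longrightarrow> G x = 0) \<Longrightarrow>
      maximal_form r t (\<lambda>x. ennreal (norm (f x))) G
        \<le> B * Lpn lebesgue p' (\<lambda>x. G x * inverse (ennreal (v x)))"
  shows "Lpn lebesgue p (\<lambda>x. ennreal (norm (T f x)) * ennreal (v x) * indicator S x) \<le> ennreal C\<^sub>T * B"
proof (rule Lpn_le_by_duality[where 'k = 'k, OF _ _ v S ex(3-5)])
  show "(\<lambda>x. norm (T f x)) \<in> borel_measurable lebesgue" using Tf by measurable
  fix g :: "real ^ 'd \<Rightarrow> 'k" assume g: "g \<in> Linf_c" "\<forall>x. x \<notin> S \<longrightarrow> g x = 0"
  note fm = Linf_c_measurable[OF f] and gm = Linf_c_measurable[OF g(1)]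
  have "(\<integral>\<^sup>+x. ennreal (norm (T f x)) * ennreal (norm (g x)) \<partial>lebesgue) = Lp_norm 1 (\<lambda>x. T f x * g x)"
    unfolding Lp_norm_eq Lpn_def by (simp add: norm_mult ennreal_mult)
  also have "\<dots> \<le> ennreal C\<^sub>T * (\<integral>\<^sup>+ x. bilinear_max r t f g x \<partial>lebesgue)" using hyp f g by blast
  also have "\<dots> \<le> ennreal C\<^sub>T * (B * Lpn lebesgue p' (\<lambda>x. ennreal (norm (g x)) * inverse (ennreal (v x))))"
    unfolding bilinear_max_eq[OF fm gm ex(1,2)] using g(2) gm by (intro mult_left_mono le) auto
  finally show "(\<integral>\<^sup>+x. ennreal (norm (T f x)) * ennreal (norm (g x)) \<partial>lebesgue)
      \<le> ennreal C\<^sub>T * B * Lpn lebesgue p' (\<lambda>x. ennreal (norm (g x)) * inverse (ennreal (v x)))"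
    by (simp only: mult.assoc)
qed auto

text \<open>Fatou's lemma on each cube.\<close>

lemma morrey_le_of_limit:
  fixes u :: "nat \<Rightarrow> real ^ 'd \<Rightarrow> 'k::{real_normed_field, euclidean_space}" and w :: "real ^ 'd \<Rightarrow> 'k"
  assumes um: "\<And>k. u k \<in> borel_measurable lebesgue" and v: "weight v" and p: "0 < p"
    and lim: "AE x in lebesgue. (\<lambda>k. norm (u k x)) \<longlonglongrightarrow> norm (w x)"
    and le: "\<And>k. morrey p q (\<lambda>x. ennreal (norm (u k x)) * ennreal (v x)) \<le> B"
  shows "morrey p q (\<lambda>x. ennreal (norm (w x)) * ennreal (v x)) \<le> B"
  unfolding morrey_def
proof (rule SUP_least)
  fix Q :: "(real ^ 'd) set" assume Q: "Q \<in> cubes"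
  let ?m = "vol Q"
  have m: "0 < ?m" "?m < top" using emeasure_cube_pos[OF Q] emeasure_cube_finite[OF Q] by auto
  note um[measurable]
  have vm[measurable]: "v \<in> borel_measurable lebesgue" and vpos: "AE x in lebesgue. 0 < v x"
    using v by (auto simp: weight_def)
  define h where "h k x = (ennreal (norm (u k x)) * ennreal (v x)) powe p" for k x
  have hm: "h k \<in> borel_measurable (unif Q)" for k
    unfolding h_def measurable_cong_sets[OF sets_uniform_measure refl] by measurable
  have bound: "(avg Q (\<lambda>x. h k x)) \<le> (?m powe (- (1 / q)) * B) powe p" for k
  proof -
    have "Lpn (unif Q) p (\<lambda>x. ennreal (norm (u k x)) * ennreal (v x)) \<le> ?m powe (- 1 / q) * morrey p q (\<lambda>x. ennreal (norm (u k x)) * ennreal (v x))"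
      by (rule Lpn_unif_le_morrey[OF Q])
    also have "\<dots> \<le> ?m powe (- 1 / q) * B" by (intro mult_left_mono le) auto
    finally show ?thesis unfolding Lpn_def h_def powe_le_swap[OF p] by simp
  qed
  have "AE x in unif Q. (ennreal (norm (w x)) * ennreal (v x)) powe p = liminf (\<lambda>k. h k x)"
    using AE_unif[OF Q lim] AE_unif[OF Q vpos]
  proof eventually_elim
    case (elim x)
    have e: "(ennreal (norm y) * ennreal (v x)) powe p = ennreal ((norm y * v x) powr p)" for y :: 'k
      using elim(2) by (simp flip: ennreal_mult)
    have "(\<lambda>k. (norm (u k x) * v x) powr p) \<longlonglongrightarrow> (norm (w x) * v x) powr p"
      using elim p by (intro tendsto_powr' tendsto_mult tendsto_const) auto
    then have "(\<lambda>k. h k x) \<longlonglongrightarrow> (ennreal (norm (w x)) * ennreal (v x)) powe p"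
      unfolding h_def e by (rule tendsto_ennrealI)
    then show ?case by (rule lim_imp_Liminf[OF sequentially_bot, symmetric])
  qed
  then have "(avg Q (\<lambda>x. (ennreal (norm (w x)) * ennreal (v x)) powe p)) = (avg Q (\<lambda>x. liminf (\<lambda>k. h k x)))"
    by (rule nn_integral_cong_AE)
  also have "\<dots> \<le> liminf (\<lambda>k. \<integral>\<^sup>+x. h k x \<partial>unif Q)"
    by (rule nn_integral_liminf[OF hm])
  also have "\<dots> \<le> (?m powe (- (1 / q)) * B) powe p"
    using bound by (intro Liminf_le always_eventually allI) auto
  finally have "Lpn (unif Q) p (\<lambda>x. ennreal (norm (w x)) * ennreal (v x)) \<le> ?m powe (- (1 / q)) * B"
    unfolding Lpn_def powe_le_swap[OF p] .
  then have "?m powe (1 / q) * Lpn (unif Q) p (\<lambda>x. ennreal (norm (w x)) * ennreal (v x)) \<le> ?m powe (1 / q) * (?m powe (- (1 / q)) * B)"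
    by (rule mult_left_mono) simp
  also have "\<dots> = B" by (rule powe_neg_cancel[OF m])
  finally show "?m powe (1 / q) * Lpn (unif Q) p (\<lambda>x. ennreal (norm (w x)) * ennreal (v x)) \<le> B" .
qed

lemma morrey_mono: "0 < p \<Longrightarrow> (\<And>x. f x \<le> g x) \<Longrightarrow> morrey p q f \<le> morrey p q g"
  unfolding morrey_def by (intro SUP_mono') (auto intro!: mult_left_mono Lpn_mono)


text \<open>The exponents of the theorem satisfy the relations assumed for the form bound. Writing \<open>\<theta>\<close> for the
  reciprocal of \<open>s\<close>, the dual exponent has reciprocal \<open>1 - \<theta> = (1 - 1 / p) + (1 / p - \<theta>)\<close>.\<close>

lemma morrey_form_constant:
  assumes "1 \<le> r" "r < p" "p \<le> q" "ereal q < s" "0 < K"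
  shows "\<exists>C::real. \<forall>(V :: real ^ 'd \<Rightarrow> ennreal) F G z l.
    muckenhoupt (1 / (1 / r - 1 / p)) (1 / (1 / q - recip s)) K V \<longrightarrow>
    F \<in> borel_measurable lebesgue \<longrightarrow> G \<in> borel_measurable lebesgue \<longrightarrow> 0 < l \<longrightarrow>
    (\<forall>x. x \<notin> qbox z l \<longrightarrow> G x = 0) \<longrightarrow>
    maximal_form r (dual_exponent s) F G
      \<le> ennreal C * (vol (qbox z l) powe (1 / p - 1 / q) * morrey p q (\<lambda>x. F x * V x)
            * Lpn lebesgue (1 / (1 - 1 / p)) (\<lambda>x. G x * inverse (V x)))"
proof -
  have q: "0 < q" "1 < p" using assms by auto
  have \<theta>: "0 \<le> recip s" "recip s < 1 / q" using recip_bounds[OF assms(4) q(1)] by auto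
  have qp: "1 / q \<le> 1 / p" "1 / p < 1 / r" "1 / p < 1"
    using assms by (auto simp: field_simps)
  then have \<theta>1: "recip s < 1 / p" "recip s < 1" using \<theta> by auto
  show ?thesis
    by (rule bilinear_form_morrey_bound[where b = "1 / (1 / p - recip s)"])
       (use assms q \<theta> qp \<theta>1 in \<open>simp_all add: dual_exponent_def\<close>)
qed

text \<open>The same with \<open>q\<close> in place of \<open>p\<close>. This non-quantitative use of the weighted Lebesgue bound is only to
  make the operator extendable.\<close>

lemma lebesgue_form_constant:
  assumes "1 \<le> r" "r < p" "p \<le> q" "ereal q < s" "0 < K"
  shows "\<exists>C::real. \<forall>(V :: real ^ 'd \<Rightarrow> ennreal) F G.
    muckenhoupt (1 / (1 / r - 1 / p)) (1 / (1 / q - recip s)) K V \<longrightarrow>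
    F \<in> borel_measurable lebesgue \<longrightarrow> G \<in> borel_measurable lebesgue \<longrightarrow>
    maximal_form r (dual_exponent s) F G
      \<le> ennreal C * (Lpn lebesgue q (\<lambda>x. F x * V x) * Lpn lebesgue (1 / (1 - 1 / q)) (\<lambda>x. G x * inverse (V x)))"
proof -
  have q: "0 < q" "1 < q" using assms by auto
  have \<theta>: "0 \<le> recip s" "recip s < 1 / q" using recip_bounds[OF assms(4) q(1)] by auto
  have qp: "1 / q \<le> 1 / p" "1 / p < 1 / r" "1 / q < 1"
    using assms by (auto simp: field_simps)
  then have \<theta>1: "recip s < 1" using \<theta> by auto
  define a where "a = 1 / (1 / r - 1 / q)"
  define \<sigma> where "\<sigma> = 1 / (1 / q - recip s)"
  have a: "0 < a" "a \<le> 1 / (1 / r - 1 / p)" and \<sigma>: "0 < \<sigma>"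
    unfolding a_def \<sigma>_def using qp \<theta> by (auto intro!: divide_left_mono)
  have "\<exists>C::real. \<forall>(V :: real ^ 'd \<Rightarrow> ennreal) F G. muckenhoupt a \<sigma> K V \<longrightarrow>
    F \<in> borel_measurable lebesgue \<longrightarrow> G \<in> borel_measurable lebesgue \<longrightarrow>
    maximal_form r (dual_exponent s) F G
      \<le> ennreal C * (Lpn lebesgue q (\<lambda>x. F x * V x) * Lpn lebesgue (1 / (1 - 1 / q)) (\<lambda>x. G x * inverse (V x)))"
    by (rule bilinear_form_bound)
       (use assms q \<theta> qp \<theta>1 a \<sigma> in \<open>simp_all add: dual_exponent_def\<close>, simp_all add: a_def \<sigma>_def)
  moreover have "muckenhoupt a \<sigma> K V" if "muckenhoupt (1 / (1 / r - 1 / p)) (1 / (1 / q - recip s)) K V" for V :: "real ^ 'd \<Rightarrow> ennreal"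
    using a \<sigma> by (intro muckenhoupt_mono[OF that]) (auto simp: \<sigma>_def)
  ultimately show ?thesis by meson
qed

text \<open>On each cube, test against functions supported in it.\<close>

lemma morrey_image_le:
  fixes T :: "(real ^ 'd \<Rightarrow> 'k::{real_normed_field, euclidean_space}) \<Rightarrow> real ^ 'd \<Rightarrow> 'k"
  assumes hyp: "\<forall>f\<in>Linf_c. \<forall>g\<in>Linf_c. Lp_norm 1 (\<lambda>x. T f x * g x)
           \<le> ennreal C\<^sub>T * (\<integral>\<^sup>+ x. bilinear_max r t f g x \<partial>lebesgue)"
    and f: "f \<in> Linf_c" and Tf: "T f \<in> borel_measurable lebesgue" and v: "weight v"
    and ex: "0 < r" "0 < t" "1 < p" and C: "0 \<le> C\<^sub>T"
    and form: "\<And>G z l. G \<in> borel_measurable lebesgue \<Longrightarrow> 0 < l \<Longrightarrow> (\<forall>x. x \<notin> qbox z l \<longrightarrow> G x = 0) \<Longrightarrow>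
      maximal_form r t (\<lambda>x. ennreal (norm (f x))) G
        \<le> ennreal C * (vol (qbox z l) powe (1 / p - 1 / q) * morrey p q (\<lambda>x. ennreal (norm (f x)) * ennreal (v x))
            * Lpn lebesgue (1 / (1 - 1 / p)) (\<lambda>x. G x * inverse (ennreal (v x))))"
  shows "morrey p q (\<lambda>x. ennreal (norm (T f x)) * ennreal (v x)) \<le> ennreal (C * C\<^sub>T) * morrey p q (\<lambda>x. ennreal (norm (f x)) * ennreal (v x))"
    (is "_ \<le> _ * ?N")
  unfolding morrey_def[of p q "\<lambda>x. ennreal (norm (T f x)) * ennreal (v x)"]
proof (rule SUP_least)
  fix Q :: "(real ^ 'd) set" assume Q: "Q \<in> cubes"
  then obtain z l where zl: "Q = qbox z l" "0 < l" by (auto simp: cubes_iff)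
  let ?m = "vol Q"
  let ?h = "\<lambda>x. ennreal (norm (T f x)) * ennreal (v x)"
  note m = emeasure_cube_pos[OF Q] emeasure_cube_finite[OF Q]
  have vm[measurable]: "v \<in> borel_measurable lebesgue" using v by (simp add: weight_def)
  note Tf[measurable]
  have p': "0 < 1 / (1 - 1 / p)" "1 / p + 1 / (1 / (1 - 1 / p)) = 1" using ex by auto
  have "Lpn lebesgue p (\<lambda>x. ?h x * indicator Q x) \<le> ennreal C\<^sub>T * (ennreal C * (?m powe (1 / p - 1 / q) * ?N))"
    using form zl
    by (intro Lpn_image_le_by_duality[OF hyp f Tf v cubes_lebesgue[OF Q] ex p']) (simp add: mult.assoc)
  then have "?m powe (1 / q) * (?m powe (- 1 / p) * Lpn lebesgue p (\<lambda>x. ?h x * indicator Q x))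
      \<le> ?m powe (1 / q) * (?m powe (- 1 / p) * (ennreal C\<^sub>T * (ennreal C * (?m powe (1 / p - 1 / q) * ?N))))"
    by (intro mult_left_mono) auto
  also have "\<dots> = (?m powe (1 / q) * (?m powe (- 1 / p) * ?m powe (1 / p - 1 / q))) * (ennreal C * ennreal C\<^sub>T * ?N)"
    by (simp only: mult_ac)
  also have "?m powe (1 / q) * (?m powe (- 1 / p) * ?m powe (1 / p - 1 / q)) = 1"
    unfolding powe_add[symmetric] using powe_0_exp[OF m] by simp
  also have "ennreal C * ennreal C\<^sub>T = ennreal (C * C\<^sub>T)"
    using C by (simp add: ennreal_mult'')
  finally show "?m powe (1 / q) * Lpn (unif Q) p ?h \<le> ennreal (C * C\<^sub>T) * ?N"
    using ex by (subst Lpn_unif[OF _ Q]) auto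
qed

text \<open>The constant has to be chosen before the operator and the weight, but may depend on the exponents and
  the weight constant; the form bounds above provide it in this order.\<close>

theorem theorem6p3:
  shows "\<exists>\<Phi> :: real \<Rightarrow> ereal \<Rightarrow> real \<Rightarrow> real \<Rightarrow> ennreal \<Rightarrow> real.
    \<forall>(r::real) (s::ereal)
      (T :: (real ^ 'd \<Rightarrow> 'k::{real_normed_field, euclidean_space}) \<Rightarrow> real ^ 'd \<Rightarrow> 'k) (C\<^sub>T::real).
      1 \<le> r \<longrightarrow> ereal r < s \<longrightarrow> 0 \<le> C\<^sub>T \<longrightarrow>
      linear_operator Linf_c T \<or> sublinear_operator Linf_c T \<longrightarrow>
      (\<forall>f\<in>Linf_c. \<forall>g\<in>Linf_c.
         Lp_norm 1 (\<lambda>x. T f x * g x)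
           \<le> ennreal C\<^sub>T * (\<integral>\<^sup>+ x. bilinear_max r (dual_exponent s) f g x \<partial>lebesgue)) \<longrightarrow>
      (\<forall>(p::real) (q::real) (v :: real ^ 'd \<Rightarrow> real).
         r < p \<longrightarrow> ereal p < s \<longrightarrow> p \<le> q \<longrightarrow> ereal q < s \<longrightarrow>
         weight v \<longrightarrow> weight_const r s p q v < top \<longrightarrow>
         (\<exists>U. operator_extension Linf_c (Lq_weighted q v) T U \<and>
              (\<forall>f\<in>Lq_weighted q v.
                 morrey_norm p q v (U f)
                   \<le> ennreal (\<Phi> r s p q (weight_const r s p q v) * C\<^sub>T) * morrey_norm p q v f)))"
proof -
  define P where "P r s p q K C \<longleftrightarrow> (\<forall>(V :: real ^ 'd \<Rightarrow> ennreal) F G z l.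
    muckenhoupt (1 / (1 / r - 1 / p)) (1 / (1 / q - recip s)) (enn2real K + 1) V \<longrightarrow>
    F \<in> borel_measurable lebesgue \<longrightarrow> G \<in> borel_measurable lebesgue \<longrightarrow> 0 < l \<longrightarrow>
    (\<forall>x. x \<notin> qbox z l \<longrightarrow> G x = 0) \<longrightarrow>
    maximal_form r (dual_exponent s) F G
      \<le> ennreal C * (vol (qbox z l) powe (1 / p - 1 / q) * morrey p q (\<lambda>x. F x * V x)
            * Lpn lebesgue (1 / (1 - 1 / p)) (\<lambda>x. G x * inverse (V x))))"
    for r p q C :: real and s :: ereal and K :: ennreal
  have ex: "\<exists>C. 1 \<le> r \<and> r < p \<and> p \<le> q \<and> ereal q < s \<longrightarrow> P r s p q K C" for r s p q K
  proof (cases "1 \<le> r \<and> r < p \<and> p \<le> q \<and> ereal q < s")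
    case True
    then have "\<exists>C. P r s p q K C"
      unfolding P_def by (intro morrey_form_constant) (auto simp: add_nonneg_pos)
    then show ?thesis by blast
  qed blast
  define \<Phi> where "\<Phi> r s p q K = (SOME C. 1 \<le> r \<and> r < p \<and> p \<le> q \<and> ereal q < s \<longrightarrow> P r s p q K C)" for r s p q K
  have \<Phi>: "P r s p q K (\<Phi> r s p q K)" if "1 \<le> r" "r < p" "p \<le> q" "ereal q < s" for r s p q K
    using someI_ex[OF ex, of r p q s K] that unfolding \<Phi>_def by blast
  show ?thesis
  proof (intro exI[of _ \<Phi>] allI impI)
    fix r :: real and s :: ereal and T :: "(real ^ 'd \<Rightarrow> 'k) \<Rightarrow> real ^ 'd \<Rightarrow> 'k" and C\<^sub>T p q :: real and v :: "real ^ 'd \<Rightarrow> real"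
    assume r: "1 \<le> r" and C\<^sub>T: "0 \<le> C\<^sub>T"
      and T: "linear_operator Linf_c T \<or> sublinear_operator Linf_c T"
      and hyp: "\<forall>f\<in>Linf_c. \<forall>g\<in>Linf_c. Lp_norm 1 (\<lambda>x. T f x * g x)
           \<le> ennreal C\<^sub>T * (\<integral>\<^sup>+ x. bilinear_max r (dual_exponent s) f g x \<partial>lebesgue)"
      and rp: "r < p" and pq: "p \<le> q" and qs: "ereal q < s" and v: "weight v"
      and W: "weight_const r s p q v < top"
    let ?K = "weight_const r s p q v"
    let ?V = "\<lambda>x. ennreal (v x)"
    let ?a = "1 / (1 / r - 1 / p)" and ?\<sigma> = "1 / (1 / q - recip s)"
    have p: "1 < p" "0 < p" "0 < q" "1 < q" "0 < r" using r rp pq by auto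
    have \<theta>: "0 \<le> recip s" "recip s < 1 / q" using recip_bounds[OF qs p(3)] by auto
    have t: "0 < dual_exponent s"
    proof -
      have "1 / q < 1" using p by simp
      then show ?thesis using \<theta> by (simp add: dual_exponent_def)
    qed
    have a: "0 < ?a" and \<sigma>: "0 < ?\<sigma>" using r rp \<theta> by (auto simp: frac_less2)
    have q\<sigma>: "q \<le> ?\<sigma>" using \<theta> p by (simp add: field_simps)
    have M: "muckenhoupt ?a ?\<sigma> (enn2real ?K + 1) ?V"
      by (rule weight_const_muckenhoupt[OF v W refl a refl \<sigma>])
    have K: "0 < enn2real ?K + 1" by (simp add: add_nonneg_pos)
    have vm[measurable]: "v \<in> borel_measurable lebesgue" using v by (simp add: weight_def)
    have "sublinear_operator Linf_c T" using T linear_imp_sublinear by blast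
    then have Tm: "T f \<in> borel_measurable lebesgue" if "f \<in> Linf_c" for f
      using that by (simp add: sublinear_operator_def ae_operator_def)
    have XY: "(Linf_c :: (real ^ 'd \<Rightarrow> 'k) set) \<subseteq> Lq_weighted q v"
      by (rule Linf_c_subset_Lq_weighted[OF v M p(3) q\<sigma> a])

    obtain C :: real where C: "\<And>F G :: real ^ 'd \<Rightarrow> ennreal. F \<in> borel_measurable lebesgue \<Longrightarrow> G \<in> borel_measurable lebesgue \<Longrightarrow>
      maximal_form r (dual_exponent s) F G
      \<le> ennreal C * (Lpn lebesgue q (\<lambda>x. F x * ?V x) * Lpn lebesgue (1 / (1 - 1 / q)) (\<lambda>x. G x * inverse (?V x)))"
      using lebesgue_form_constant[OF r rp pq qs K] M by blast
    define L where "L = (C\<^sub>T * max C 0) powr q"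
    have bd: "(\<integral>\<^sup>+x. (ennreal (norm (T \<phi> x)) * ennreal (v x)) powe q \<partial>lebesgue)
        \<le> ennreal L * (\<integral>\<^sup>+x. (ennreal (norm (\<phi> x)) * ennreal (v x)) powe q \<partial>lebesgue)" if \<phi>: "\<phi> \<in> Linf_c" for \<phi>
    proof -
      have q': "0 < 1 / (1 - 1 / q)" "1 / q + 1 / (1 / (1 - 1 / q)) = 1" using p by auto
      have \<phi>m: "(\<lambda>x. ennreal (norm (\<phi> x))) \<in> borel_measurable lebesgue"
        using Linf_c_measurable[OF \<phi>] by measurable
      let ?N = "Lpn lebesgue q (\<lambda>x. ennreal (norm (\<phi> x)) * ?V x)"
      have "Lpn lebesgue q (\<lambda>x. ennreal (norm (T \<phi> x)) * ?V x * indicator UNIV x) \<le> ennreal C\<^sub>T * (ennreal C * ?N)"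
      proof (rule Lpn_image_le_by_duality[OF hyp \<phi> Tm[OF \<phi>] v _ p(5) t p(4) q'])
        show "UNIV \<in> sets lebesgue" by simp
        fix G :: "real ^ 'd \<Rightarrow> ennreal" assume "G \<in> borel_measurable lebesgue"
        from C[OF \<phi>m this] show "maximal_form r (dual_exponent s) (\<lambda>x. ennreal (norm (\<phi> x))) G
            \<le> ennreal C * ?N * Lpn lebesgue (1 / (1 - 1 / q)) (\<lambda>x. G x * inverse (?V x))"
          by (simp only: mult.assoc)
      qed
      also have "\<dots> \<le> ennreal C\<^sub>T * (ennreal (max C 0) * ?N)"
        by (intro mult_left_mono mult_right_mono ennreal_leI) auto
      finally have "Lpn lebesgue q (\<lambda>x. ennreal (norm (T \<phi> x)) * ?V x) \<le> ennreal (C\<^sub>T * max C 0) * ?N"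
        using C\<^sub>T by (simp add: ennreal_mult mult.assoc)
      then have "Lpn lebesgue q (\<lambda>x. ennreal (norm (T \<phi> x)) * ?V x) powe q \<le> (ennreal (C\<^sub>T * max C 0) * ?N) powe q"
        using p by (intro powe_mono) auto
      also have "\<dots> = ennreal L * ?N powe q"
        unfolding powe_mult[of "ennreal (C\<^sub>T * max C 0)"] L_def using C\<^sub>T by (subst powe_ennreal) auto
      finally show ?thesis unfolding Lpn_powe[OF p(3)] .
    qed
    from bounded_operator_extension[OF T bd v p(3) XY] obtain U where
      U: "operator_extension Linf_c (Lq_weighted q v) T U"
      and lim: "\<And>f \<xi>. f \<in> Lq_weighted q v \<Longrightarrow> fast_approx q v f \<xi> \<Longrightarrow> AE x in lebesgue. (\<lambda>k. norm (T (\<xi> k) x)) \<longlonglongrightarrow> norm (U f x)"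
      by blast
    have "morrey_norm p q v (U f) \<le> ennreal (\<Phi> r s p q ?K * C\<^sub>T) * morrey_norm p q v f"
      if f: "f \<in> Lq_weighted q v" for f
    proof -
      obtain \<xi> where \<xi>: "fast_approx q v f \<xi>" "\<And>k x. norm (\<xi> k x) \<le> norm (f x)"
        using fast_approx_exists[OF f v p(3)] by blast
      have X: "\<xi> k \<in> Linf_c" for k using \<xi>(1) by (simp add: fast_approx_def)
      have fm: "f \<in> borel_measurable lebesgue" using f by (simp add: Lq_weighted_def)
      have "sublinear_operator (Lq_weighted q v) U"
        using U \<open>sublinear_operator Linf_c T\<close> by (simp add: operator_extension_def)
      then have Um: "U f \<in> borel_measurable lebesgue"
        using f by (simp add: sublinear_operator_def ae_operator_def)
      have "morrey p q (\<lambda>x. ennreal (norm (U f x)) * ?V x)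
          \<le> ennreal (\<Phi> r s p q ?K * C\<^sub>T) * morrey p q (\<lambda>x. ennreal (norm (f x)) * ?V x)"
      proof (rule morrey_le_of_limit[OF Tm[OF X] v p(2) lim[OF f \<xi>(1)]])
        fix k
        have km: "(\<lambda>x. ennreal (norm (\<xi> k x))) \<in> borel_measurable lebesgue"
          using Linf_c_measurable[OF X] by measurable
        have "morrey p q (\<lambda>x. ennreal (norm (T (\<xi> k) x)) * ?V x)
            \<le> ennreal (\<Phi> r s p q ?K * C\<^sub>T) * morrey p q (\<lambda>x. ennreal (norm (\<xi> k x)) * ?V x)"
          using \<Phi>[OF r rp pq qs, of ?K] M km unfolding P_def
          by (intro morrey_image_le[OF hyp X Tm[OF X] v p(5) t p(1) C\<^sub>T]) blast
        also have "\<dots> \<le> ennreal (\<Phi> r s p q ?K * C\<^sub>T) * morrey p q (\<lambda>x. ennreal (norm (f x)) * ?V x)"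
          using \<xi>(2) p by (intro mult_left_mono morrey_mono mult_right_mono ennreal_leI) auto
        finally show "morrey p q (\<lambda>x. ennreal (norm (T (\<xi> k) x)) * ?V x)
            \<le> ennreal (\<Phi> r s p q ?K * C\<^sub>T) * morrey p q (\<lambda>x. ennreal (norm (f x)) * ?V x)" .
      qed
      then show ?thesis
        unfolding morrey_norm_eq[OF v Um p(2)] morrey_norm_eq[OF v fm p(2)] .
    qed
    then show "\<exists>U. operator_extension Linf_c (Lq_weighted q v) T U \<and>
              (\<forall>f\<in>Lq_weighted q v. morrey_norm p q v (U f)
                   \<le> ennreal (\<Phi> r s p q (weight_const r s p q v) * C\<^sub>T) * morrey_norm p q v f)"
      using U by blast
  qed
qed

end
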